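(* Let $q\in\mathbb{C}$ with $0<|q|<1$. Then $$\psi(q)+q\,\phi(-q^4)+X(q^8)=\frac{\overline{J}_{1,2}\,j(-q^6;-q^{10})}{J_{2,8}}.$$
   Context: For a complex number $p$ with $0<|p|<1$ and $x\in\mathbb{C}^*=\mathbb{C}\setminus\{0\}$: $(x;p)_n=\prod_{i=0}^{n-1}(1-p^ix)$, $(x;p)_\infty=\prod_{i\ge0}(1-p^ix)$, and $j(x;p)=(x;p)_\infty(p/x;p)_\infty(p;p)_\infty=\sum_{n\in\mathbb{Z}}(-1)^np^{\binom n2}x^n$. For integers $a,m$ with $m\ge1$: $J_{a,m}=j(q^a;q^m)$ and $\overline{J}_{a,m}=j(-q^a;q^m)$. The tenth-order mock theta functions used are, for $|q|<1$, $\phi(q)=\sum_{n\ge0}\frac{q^{\binom{n+1}{2}}}{(q;q^2)_{n+1}}$, $\psi(q)=\sum_{n\ge0}\frac{q^{\binom{n+2}{2}}}{(q;q^2)_{n+1}}$, $X(q)=\sum_{n\ge0}\frac{(-1)^nq^{n^2}}{(-q;q)_{2n}}$. *)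

theory Defs
  imports "HOL-Analysis.Analysis"
begin

definition qpoch :: "complex \<Rightarrow> complex \<Rightarrow> nat \<Rightarrow> complex" where
  "qpoch x p n = (\<Prod>i<n. 1 - p ^ i * x)"

definition qpoch_inf :: "complex \<Rightarrow> complex \<Rightarrow> complex" where
  "qpoch_inf x p = (\<Prod>i. 1 - p ^ i * x)"

text \<open>
  The theta function \<open>j(x;p)\<close>, meaningful for \<open>x \<noteq> 0\<close> and \<open>0 < \<bar>p\<bar> < 1\<close>. Of its two usual
  expressions, the product is taken as the definition; the bilateral series is the
  Jacobi triple product identity.
\<close>
definition jtheta :: "complex \<Rightarrow> complex \<Rightarrow> complex" where
  "jtheta x p = qpoch_inf x p * qpoch_inf (p / x) p * qpoch_inf p p"

text \<open>\<open>J\<^sub>a\<^sub>,\<^sub>m\<close> and its barred variant, with the base \<open>q\<close> as an explicit first argument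
  (\<open>m \<ge> 1\<close>).\<close>
definition J :: "complex \<Rightarrow> int \<Rightarrow> nat \<Rightarrow> complex" where
  "J q a m = jtheta (q powi a) (q ^ m)"

definition Jbar :: "complex \<Rightarrow> int \<Rightarrow> nat \<Rightarrow> complex" where
  "Jbar q a m = jtheta (- (q powi a)) (q ^ m)"

text \<open>The tenth-order mock theta functions \<open>\<phi>\<close>, \<open>\<psi>\<close> and \<open>X\<close>, for \<open>\<bar>q\<bar> < 1\<close>.\<close>
definition mock_phi :: "complex \<Rightarrow> complex" where
  "mock_phi q = (\<Sum>n. q ^ ((n + 1) choose 2) / qpoch q (q ^ 2) (n + 1))"

definition mock_psi :: "complex \<Rightarrow> complex" where
  "mock_psi q = (\<Sum>n. q ^ ((n + 2) choose 2) / qpoch q (q ^ 2) (n + 1))"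

definition mock_X :: "complex \<Rightarrow> complex" where
  "mock_X q = (\<Sum>n. (- 1) ^ n * q ^ (n ^ 2) / qpoch (- q) q (2 * n))"

end

(* Indefinite Hecke-type expansions come from Bailey pairs: the coefficients kappa_N with
   kappa_{N+2} = q^{N+1} kappa_N + 2 and kappa_{-N} = 2 - kappa_N turn phi, psi and X, up to
   theta factors, into values of F(x;q) = sum over all integers N of q^{N^2} x^N kappa_N.

   F is holomorphic on C - {0} and satisfies functional equations, up to theta functions, under
   x -> q^5 x and x -> 1/x. For k = 1, 2 and L(x) = j(x;q) (m(q^3/x, q^5, q^k) + m(q^3/x, q^5, q^-k)),
   the function L(s) + L(-s) obeys the same equations in s as 2 F(s^2/q; q^2), and the difference
   vanishes by counting zeros. Thus the mock theta functions become Appell functions.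

   Splitting the Appell series for psi, of base q^10, by the parity of the index gives Appell
   functions of base q^40 that cancel those in q phi(-q^4) and X(q^8), plus theta quotients. The
   sum of these quotients is evaluated with the product formula for j(s) j(t). *)

theory Submission
  imports Defs "HOL-Complex_Analysis.Complex_Analysis"
begin

section \<open>Infinite products and the theta function\<close>

text \<open>Appell functions are handled through their numerators, a double series convergent for
  all nonzero arguments. It is symmetric and holomorphic on the punctured plane, so no poles have to
  be followed; the change of z and the comparison with F then rest on one fact: functions with equal
  multipliers are proportional if the zeros of the second are simple and shared by the first. In
  base q, which phi and psi need, the analogue of L has twice the multiplicative period of F, and
  its values half a period apart are added; for X the sum over s and -s does this work. At the
  arguments that occur, j(x;q) makes one of the two values of L vanish, leaving one pair of Appell
  functions. This requires that no pole meets that zero, which fixes k: k = 2 for psi, k = 1 for phi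
  and X. The same choice aligns the parameters: the dissection turns z = q^4 of psi into q^8, which
  is the z of both phi(-q^4) and X(q^8), so the Appell functions cancel as they stand.\<close>

definition nome :: "complex \<Rightarrow> bool" where
  "nome q \<longleftrightarrow> q \<noteq> 0 \<and> norm q < 1"

lemma nome_nonzero: "nome q \<Longrightarrow> q \<noteq> 0"
  and nome_norm: "nome q \<Longrightarrow> norm q < 1"
  by (auto simp: nome_def)

lemma nome_power: "nome q \<Longrightarrow> n > 0 \<Longrightarrow> nome (q ^ n)"
  by (auto simp: nome_def norm_power power_less_one_iff)

lemma nome_uminus: "nome q \<Longrightarrow> nome (- q)"
  by (auto simp: nome_def)

lemma nome_power_neq_1:
  assumes "nome q" "n > 0"
  shows "q ^ n \<noteq> 1"
  using nome_norm[OF nome_power[OF assms]] by auto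

lemma nome_powi_eq_1_iff:
  assumes "nome q"
  shows "q powi n = 1 \<longleftrightarrow> n = 0"
proof
  assume *: "q powi n = 1"
  have "q ^ nat \<bar>n\<bar> = 1"
    using * by (cases "n \<ge> 0") (auto simp: power_int_def field_simps power_inverse)
  then show "n = 0"
    using nome_power_neq_1[OF assms, of "nat \<bar>n\<bar>"] by auto
qed auto

lemma convergent_prod_qpoch:
  fixes p x :: complex
  assumes "norm p < 1"
  shows "convergent_prod (\<lambda>i. 1 - p ^ i * x)"
proof -
  have "summable (\<lambda>i. norm (p ^ i * x))"
    using assms summable_mult2[OF summable_geometric[of "norm p"]] by (simp add: norm_mult norm_power)
  then have "abs_convergent_prod (\<lambda>i. 1 - p ^ i * x)"
    by (simp add: abs_convergent_prod_conv_summable)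
  then show ?thesis
    by (rule abs_convergent_prod_imp_convergent_prod)
qed

lemma qpoch_tendsto:
  assumes "norm p < 1"
  shows "(\<lambda>n. qpoch x p n) \<longlonglongrightarrow> qpoch_inf x p"
proof -
  have "(\<lambda>n. \<Prod>i\<le>n. 1 - p ^ i * x) \<longlonglongrightarrow> qpoch_inf x p"
    unfolding qpoch_inf_def by (rule convergent_prod_LIMSEQ[OF convergent_prod_qpoch[OF assms]])
  then show ?thesis
    by (simp add: qpoch_def flip: LIMSEQ_lessThan_iff_atMost)
qed

lemma qpoch_0 [simp]: "qpoch x p 0 = 1"
  by (simp add: qpoch_def)

lemma qpoch_Suc: "qpoch x p (Suc n) = qpoch x p n * (1 - p ^ n * x)"
  by (simp add: qpoch_def)

lemma qpoch_add: "qpoch x p (m + n) = qpoch x p m * qpoch (p ^ m * x) p n"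
  by (induction n) (auto simp: qpoch_Suc power_add mult_ac)

lemma qpoch_section:
  "qpoch x p (k * n) = (\<Prod>i<k. qpoch (p ^ i * x) (p ^ k) n)"
proof (induction n)
  case (Suc n)
  have "qpoch x p (k * Suc n) = qpoch x p (k * n) * qpoch (p ^ (k * n) * x) p k"
    by (simp add: add.commute[of k] flip: qpoch_add)
  also have "qpoch (p ^ (k * n) * x) p k = (\<Prod>i<k. 1 - (p ^ k) ^ n * (p ^ i * x))"
    by (simp add: qpoch_def power_mult mult_ac)
  finally show ?case
    by (simp add: Suc qpoch_Suc prod.distrib)
qed auto

lemma qpoch_inf_section:
  assumes "norm p < 1" "k > 0"
  shows "qpoch_inf x p = (\<Prod>i<k. qpoch_inf (p ^ i * x) (p ^ k))"
proof (rule LIMSEQ_unique)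
  show "(\<lambda>n. qpoch x p (k * n)) \<longlonglongrightarrow> qpoch_inf x p"
    using LIMSEQ_subseq_LIMSEQ[OF qpoch_tendsto[OF assms(1), of x], of "\<lambda>n. k * n"] assms(2)
    by (auto simp: strict_mono_def o_def)
  have "norm (p ^ k) < 1"
    using assms by (simp add: norm_power power_less_one_iff)
  then show "(\<lambda>n. qpoch x p (k * n)) \<longlonglongrightarrow> (\<Prod>i<k. qpoch_inf (p ^ i * x) (p ^ k))"
    unfolding qpoch_section by (intro tendsto_prod qpoch_tendsto)
qed

lemma qpoch_inf_split:
  assumes "norm p < 1"
  shows "qpoch_inf x p = qpoch x p n * qpoch_inf (p ^ n * x) p"
proof (rule LIMSEQ_unique)
  show "(\<lambda>m. qpoch x p (n + m)) \<longlonglongrightarrow> qpoch_inf x p"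
    using LIMSEQ_ignore_initial_segment[OF qpoch_tendsto[OF assms, of x], of n]
    by (simp add: add.commute)
  show "(\<lambda>m. qpoch x p (n + m)) \<longlonglongrightarrow> qpoch x p n * qpoch_inf (p ^ n * x) p"
    unfolding qpoch_add by (intro tendsto_intros qpoch_tendsto assms)
qed

lemma qpoch_inf_step:
  assumes "norm p < 1"
  shows "qpoch_inf x p = (1 - x) * qpoch_inf (p * x) p"
  using qpoch_inf_split[OF assms, of x 1] by (simp add: qpoch_Suc)

lemma qpoch_inf_eq_0_iff:
  assumes "norm p < 1"
  shows "qpoch_inf x p = 0 \<longleftrightarrow> (\<exists>i. p ^ i * x = 1)"
proof -
  have "(\<lambda>i. 1 - p ^ i * x) has_prod qpoch_inf x p"
    unfolding qpoch_inf_def by (rule convergent_prod_has_prod[OF convergent_prod_qpoch[OF assms]])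
  then show ?thesis
    using has_prod_eq_0_iff by fastforce
qed

lemma qpoch_self_nonzero:
  assumes "nome q"
  shows "qpoch q q n \<noteq> 0"
proof (induction n)
  case (Suc n)
  have "q ^ n * q \<noteq> 1"
    using nome_power_neq_1[OF assms, of "Suc n"] by (simp add: mult.commute)
  then show ?case
    using Suc by (simp add: qpoch_Suc)
qed auto

lemma qpoch_inf_self_nonzero:
  assumes "nome q"
  shows "qpoch_inf q q \<noteq> 0"
proof -
  have "q ^ n * q \<noteq> 1" for n
    using nome_power_neq_1[OF assms, of "Suc n"] by (simp add: mult.commute)
  then show ?thesis
    using nome_norm[OF assms] by (simp add: qpoch_inf_eq_0_iff)
qed

lemma qpoch_inf_mult_neg:
  assumes "norm p < 1"
  shows "qpoch_inf x p * qpoch_inf (- x) p = qpoch_inf (x ^ 2) (p ^ 2)"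
proof (rule LIMSEQ_unique)
  show "(\<lambda>n. qpoch x p n * qpoch (- x) p n) \<longlonglongrightarrow> qpoch_inf x p * qpoch_inf (- x) p"
    by (intro tendsto_intros qpoch_tendsto assms)
  have "qpoch x p n * qpoch (- x) p n = qpoch (x ^ 2) (p ^ 2) n" for n
    by (induction n) (auto simp: qpoch_Suc algebra_simps power2_eq_square power_mult_distrib)
  moreover have "norm (p ^ 2) < 1"
    using assms by (simp add: norm_power power_less_one_iff)
  ultimately show "(\<lambda>n. qpoch x p n * qpoch (- x) p n) \<longlonglongrightarrow> qpoch_inf (x ^ 2) (p ^ 2)"
    by (simp add: qpoch_tendsto)
qed

lemma qpoch_inf_holomorphic:
  assumes "norm p < 1"
  shows "(\<lambda>x. qpoch_inf x p) holomorphic_on UNIV"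
proof -
  define P where "P = (\<lambda>n x. qpoch x p n)"
  have ulim: "uniform_limit (cball 0 R) P (\<lambda>x. qpoch_inf x p) sequentially" for R
  proof -
    have "uniformly_convergent_on (cball 0 R) (\<lambda>n x. \<Prod>i<n. 1 - p ^ i * x)"
    proof (rule uniformly_convergent_on_prod')
      show "uniformly_convergent_on (cball 0 R) (\<lambda>N x. \<Sum>n<N. norm (1 - p ^ n * x - 1))"
      proof (rule Weierstrass_m_test'_ev)
        show "\<forall>\<^sub>F n in sequentially. \<forall>x\<in>cball 0 R. norm (norm (1 - p ^ n * x - 1)) \<le> norm p ^ n * R"
          by (intro always_eventually allI ballI) (auto simp: norm_mult norm_power intro!: mult_left_mono)
        show "summable (\<lambda>n. norm p ^ n * R)"
          using assms by (intro summable_mult2 summable_geometric) auto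
      qed
    qed (auto intro!: continuous_intros)
    then obtain g where g: "uniform_limit (cball 0 R) P g sequentially"
      by (auto simp: uniformly_convergent_on_def P_def qpoch_def)
    have "g x = qpoch_inf x p" if "x \<in> cball 0 R" for x
      using tendsto_uniform_limitI[OF g that] qpoch_tendsto[OF assms, of x] LIMSEQ_unique
      unfolding P_def by blast
    then show ?thesis
      using uniform_limit_cong'[of "cball 0 R" P P g "\<lambda>x. qpoch_inf x p" sequentially] g by simp
  qed
  show ?thesis
  proof (rule holomorphic_uniform_sequence)
    fix x :: complex
    have "uniform_limit (cball x 1) P (\<lambda>x. qpoch_inf x p) sequentially"
      by (rule uniform_limit_on_subset[OF ulim[of "norm x + 1"]]) (simp add: cball_subset_cball_iff)
    then show "\<exists>d>0. cball x d \<subseteq> UNIV \<and> uniform_limit (cball x d) P (\<lambda>x. qpoch_inf x p) sequentially"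
      by (intro exI[of _ 1]) auto
  qed (auto simp: P_def qpoch_def intro!: holomorphic_intros)
qed

lemma qpoch_inf_holomorphic_comp [holomorphic_intros]:
  assumes "norm p < 1" "f holomorphic_on A"
  shows "(\<lambda>x. qpoch_inf (f x) p) holomorphic_on A"
  using holomorphic_on_compose_gen[OF assms(2) qpoch_inf_holomorphic[OF assms(1)]]
  by (auto simp: o_def)

section \<open>The theta function: quasi-periodicity, zeros and sections\<close>

lemma jtheta_holomorphic [holomorphic_intros]:
  assumes "norm p < 1" "f holomorphic_on A" "\<And>x. x \<in> A \<Longrightarrow> f x \<noteq> 0"
  shows "(\<lambda>x. jtheta (f x) p) holomorphic_on A"
  unfolding jtheta_def using assms by (intro holomorphic_intros) auto

lemma jtheta_shift:
  assumes "nome p" "x \<noteq> 0"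
  shows "jtheta (p * x) p = - jtheta x p / x"
proof -
  have "qpoch_inf (1 / x) p = (1 - 1 / x) * qpoch_inf (p / x) p"
    using qpoch_inf_step[OF nome_norm[OF assms(1)], of "1 / x"] by simp
  moreover have "qpoch_inf x p = (1 - x) * qpoch_inf (p * x) p"
    using qpoch_inf_step[OF nome_norm[OF assms(1)]] .
  ultimately have "x * (qpoch_inf (p * x) p * qpoch_inf (1 / x) p) = - (qpoch_inf x p * qpoch_inf (p / x) p)"
    using assms(2) by (simp only:) (simp add: field_simps)
  then have "x * (qpoch_inf (p * x) p * qpoch_inf (1 / x) p) * qpoch_inf p p / x =
      - (qpoch_inf x p * qpoch_inf (p / x) p) * qpoch_inf p p / x"
    by (simp only:)
  then show ?thesis
    using assms by (simp add: jtheta_def nome_def mult_ac)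
qed

lemma jtheta_reflect:
  assumes "nome p" "x \<noteq> 0"
  shows "jtheta (p / x) p = jtheta x p"
  using assms by (simp add: jtheta_def nome_def mult_ac)

lemma jtheta_inverse:
  assumes "nome p" "x \<noteq> 0"
  shows "jtheta (1 / x) p = - jtheta x p / x"
  using jtheta_reflect[OF assms] jtheta_shift[OF assms(1), of "1 / x"] assms(2)
  by (simp add: field_simps)

lemma jtheta_shift_back:
  assumes "nome p" "x \<noteq> 0"
  shows "jtheta (x / p) p = - (x / p) * jtheta x p"
  using jtheta_shift[OF assms(1), of "x / p"] assms by (simp add: nome_def field_simps)

lemma jtheta_eq_0_iff:
  assumes "nome p" "x \<noteq> 0"
  shows "jtheta x p = 0 \<longleftrightarrow> (\<exists>n::int. x = p powi n)"
proof
  have p: "p \<noteq> 0" "norm p < 1"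
    using assms by (auto simp: nome_def)
  assume "jtheta x p = 0"
  then consider i where "p ^ i * x = 1" | i where "p ^ i * (p / x) = 1"
    using qpoch_inf_self_nonzero[OF assms(1)] p
    by (auto simp: jtheta_def qpoch_inf_eq_0_iff)
  then show "\<exists>n::int. x = p powi n"
  proof cases
    case 1
    then have "x = p powi (- int i)"
      using p by (simp add: power_int_minus field_simps)
    then show ?thesis ..
  next
    case 2
    then have "x = p powi int (Suc i)"
      using assms(2) by (simp add: field_simps del: of_nat_Suc)
    then show ?thesis ..
  qed
next
  have p: "p \<noteq> 0" "norm p < 1"
    using assms by (auto simp: nome_def)
  assume "\<exists>n::int. x = p powi n"
  then obtain n where x: "x = p powi n" ..
  show "jtheta x p = 0"
  proof (cases "n > 0")
    case True
    have "p ^ (nat n - 1) * (p / x) = 1"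
      using p True by (simp add: x power_int_def field_simps flip: power_Suc)
    then have "qpoch_inf (p / x) p = 0"
      using p by (auto simp: qpoch_inf_eq_0_iff)
    then show ?thesis by (simp add: jtheta_def)
  next
    case False
    then have "p ^ nat (- n) * x = 1"
      using p by (auto simp: x power_int_def field_simps power_inverse)
    then have "qpoch_inf x p = 0"
      using p by (auto simp: qpoch_inf_eq_0_iff)
    then show ?thesis by (simp add: jtheta_def)
  qed
qed

lemma jtheta_1 [simp]: "nome p \<Longrightarrow> jtheta 1 p = 0"
  by (subst jtheta_eq_0_iff) (auto intro!: exI[of _ 0])

lemma jtheta_section:
  assumes "nome p" "k > 0" "x \<noteq> 0"
  shows "jtheta x p * qpoch_inf (p ^ k) (p ^ k) ^ k =
    (\<Prod>i<k. jtheta (p ^ i * x) (p ^ k)) * qpoch_inf p p"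
proof -
  have p: "p \<noteq> 0" "norm p < 1"
    using assms by (auto simp: nome_def)
  \<comment> \<open>The factors containing \<open>p / x\<close> run through the residues in reverse
    order, so \<open>i\<close> is matched with \<open>k - 1 - i\<close>.\<close>
  have "(\<Prod>i<k. qpoch_inf (p ^ k / (p ^ i * x)) (p ^ k)) =
        (\<Prod>i<k. qpoch_inf (p ^ i * (p / x)) (p ^ k))"
  proof (rule prod.reindex_bij_witness[of _ "\<lambda>i. k - Suc i" "\<lambda>i. k - Suc i"])
    fix i assume "i \<in> {..<k}"
    then have "p ^ k = p ^ i * p * p ^ (k - Suc i)"
      by (simp add: power_Suc2[symmetric] power_add[symmetric] del: power_Suc)
    then show "qpoch_inf (p ^ (k - Suc i) * (p / x)) (p ^ k) = qpoch_inf (p ^ k / (p ^ i * x)) (p ^ k)"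
      using p by (simp add: field_simps)
  qed auto
  then show ?thesis
    using qpoch_inf_section[OF p(2) assms(2), of x] qpoch_inf_section[OF p(2) assms(2), of "p / x"]
    by (simp add: jtheta_def prod.distrib)
qed

lemma jtheta_square:
  assumes "nome p" "x \<noteq> 0"
  shows "jtheta (x ^ 2) (p ^ 2) * qpoch_inf p p ^ 2 =
    jtheta x p * jtheta (- x) p * qpoch_inf (p ^ 2) (p ^ 2)"
proof -
  have p: "p \<noteq> 0" "norm p < 1"
    using assms by (auto simp: nome_def)
  have "qpoch_inf (x ^ 2) (p ^ 2) = qpoch_inf x p * qpoch_inf (- x) p"
    using qpoch_inf_mult_neg[OF p(2), of x] by simp
  moreover have "qpoch_inf (p ^ 2 / x ^ 2) (p ^ 2) = qpoch_inf (p / x) p * qpoch_inf (- (p / x)) p"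
    using qpoch_inf_mult_neg[OF p(2), of "p / x"] by (simp add: power_divide)
  ultimately show ?thesis
    by (simp add: jtheta_def power2_eq_square mult_ac)
qed

section \<open>Bilateral series\<close>

text \<open>The binomial coefficient \<open>n choose 2\<close> continued to negative integers; the
  division is exact.\<close>

definition tri :: "int \<Rightarrow> int" where
  "tri n = n * (n - 1) div 2"

lemma two_tri: "2 * tri n = n * (n - 1)"
  unfolding tri_def by (rule dvd_mult_div_cancel) auto

lemma tri_add: "tri (m + n) = tri m + tri n + m * n"
proof -
  have "2 * tri (m + n) = 2 * (tri m + tri n + m * n)"
    unfolding distrib_left two_tri by (simp add: algebra_simps)
  then show ?thesis by simp
qed

lemma tri_0 [simp]: "tri 0 = 0" and tri_1 [simp]: "tri 1 = 0"
  by (auto simp: tri_def)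

lemma tri_Suc: "tri (n + 1) = tri n + n"
  using tri_add[of n 1] by simp

lemma tri_uminus: "tri (- n) = tri n + n"
  using two_tri[of "-n"] two_tri[of n] by (simp add: algebra_simps)

lemma tri_one_minus: "tri (- n + 1) = tri n"
  using tri_Suc[of "- n"] tri_uminus[of n] by simp

lemma summable_on_int:
  fixes f :: "int \<Rightarrow> 'a :: {uniform_topological_group_add, topological_comm_monoid_add, ab_group_add, complete_uniform_space}"
  assumes "(\<lambda>n. f (int n)) summable_on UNIV" "(\<lambda>n. f (- int n)) summable_on UNIV"
  shows "f summable_on UNIV"
proof -
  have 1: "f summable_on range int"
    using assms(1) by (subst summable_on_reindex) (auto simp: o_def inj_on_def)
  have 2: "f summable_on range (\<lambda>n. - int n)"
    using assms(2) by (subst summable_on_reindex) (auto simp: o_def inj_on_def)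
  have "k \<in> range int \<union> range (\<lambda>n. - int n)" for k
    by (cases k rule: int_cases2) auto
  then have "UNIV = range int \<union> range (\<lambda>n. - int n)"
    by blast
  then show ?thesis
    using summable_on_union[OF 1 2] by metis
qed

lemma summable_on_int_shift_iff:
  fixes f :: "int \<Rightarrow> 'a :: {comm_monoid_add, topological_space}"
  shows "(\<lambda>n. f (n + k)) summable_on UNIV \<longleftrightarrow> f summable_on UNIV"
  by (rule summable_on_reindex_bij_witness[of _ "\<lambda>n. n - k" "\<lambda>n. n + k"]) auto

lemma infsum_int_shift:
  fixes f :: "int \<Rightarrow> 'a :: {comm_monoid_add, t2_space}"
  shows "(\<Sum>\<^sub>\<infinity>n. f (n + k)) = (\<Sum>\<^sub>\<infinity>n. f n)"
  by (rule infsum_reindex_bij_witness[of _ "\<lambda>n. n - k" "\<lambda>n. n + k"]) auto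

lemma infsum_int_uminus:
  fixes f :: "int \<Rightarrow> 'a :: {comm_monoid_add, t2_space}"
  shows "(\<Sum>\<^sub>\<infinity>n. f (- n)) = (\<Sum>\<^sub>\<infinity>n. f n)"
  by (rule infsum_reindex_bij_witness[of _ "\<lambda>n. - n" "\<lambda>n. - n"]) auto

lemma summable_on_int_uminus_iff:
  fixes f :: "int \<Rightarrow> 'a :: {comm_monoid_add, topological_space}"
  shows "(\<lambda>n. f (- n)) summable_on UNIV \<longleftrightarrow> f summable_on UNIV"
  by (rule summable_on_reindex_bij_witness[of _ "\<lambda>n. - n" "\<lambda>n. - n"]) auto

text \<open>The common majorant of the bilateral series below. On the nonnegative half the ratio of
  consecutive terms is \<open>r ^ n * b\<close>, which tends to 0.\<close>

lemma summable_on_tri_real: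
  fixes r a :: real
  assumes r: "0 < r" "r < 1" and a: "a > 0"
  shows "(\<lambda>n. r powi tri n * a powi n) summable_on UNIV"
proof (rule summable_on_int)
  have half: "(\<lambda>n. r powi tri (int n) * b ^ n) summable_on UNIV" if b: "b > 0" for b :: real
  proof (rule summable_nonneg_imp_summable_on)
    have "(\<lambda>n. r ^ n * b) \<longlonglongrightarrow> 0 * b"
      using r by (intro tendsto_intros LIMSEQ_realpow_zero) auto
    then have "eventually (\<lambda>n. r ^ n * b < 1 / 2) sequentially"
      by (rule order_tendstoD) auto
    then obtain N where N: "\<And>n. n \<ge> N \<Longrightarrow> r ^ n * b < 1 / 2"
      by (auto simp: eventually_sequentially)
    show "summable (\<lambda>n. r powi tri (int n) * b ^ n)"
    proof (rule summable_ratio_test[of "1 / 2" N])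
      fix n assume n: "n \<ge> N"
      have "r powi tri (int (Suc n)) * b ^ Suc n = r ^ n * b * (r powi tri (int n) * b ^ n)"
        using r tri_Suc[of "int n"] by (simp add: power_int_add add.commute)
      also have "\<dots> \<le> 1 / 2 * (r powi tri (int n) * b ^ n)"
        using N[OF n] r b by (intro mult_right_mono) auto
      finally show "norm (r powi tri (int (Suc n)) * b ^ Suc n) \<le> 1 / 2 * norm (r powi tri (int n) * b ^ n)"
        using r b by (simp add: abs_mult)
    qed auto
  qed (use r b in auto)
  show "(\<lambda>n. r powi tri (int n) * a powi int n) summable_on UNIV"
    using half[OF a] by simp
  \<comment> \<open>Negative indices are the half-line case with parameter \<open>r / a\<close>,
    because \<open>tri (- n) = tri n + n\<close>.\<close>
  have "(\<lambda>n. r powi tri (int n) * (r / a) ^ n) summable_on UNIV"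
    by (rule half) (use r a in auto)
  then show "(\<lambda>n. r powi tri (- int n) * a powi (- int n)) summable_on UNIV"
    using r a by (simp add: tri_uminus power_int_add power_int_minus power_mult_distrib divide_inverse mult_ac power_inverse)
qed

lemma summable_on_tri_bound:
  fixes f :: "int \<Rightarrow> complex"
  assumes "nome q" "a > 0" "\<And>n. norm (f n) \<le> C * (norm q powi tri n * a powi n)"
  shows "f summable_on UNIV"
proof -
  have "(\<lambda>n. C * (norm q powi tri n * a powi n)) summable_on UNIV"
    using assms by (intro summable_on_cmult_right summable_on_tri_real) (auto simp: nome_def)
  then have "(\<lambda>n. norm (f n)) summable_on UNIV"
    by (rule Infinite_Sum.abs_summable_on_comparison_test') (use assms in auto)
  then show ?thesis
    by (rule abs_summable_summable)
qed

text \<open>Dominated convergence over the integers; the enumeration \<open>int_decode\<close>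
  reduces it to Tannery's theorem for ordinary series.\<close>

lemma infsum_int_tannery:
  fixes a :: "nat \<Rightarrow> int \<Rightarrow> complex"
  assumes lim: "\<And>k. (\<lambda>n. a n k) \<longlonglongrightarrow> b k"
    and bound: "\<And>n k. norm (a n k) \<le> M k"
    and M: "M summable_on UNIV"
  shows "(\<lambda>n. \<Sum>\<^sub>\<infinity>k. a n k) \<longlonglongrightarrow> (\<Sum>\<^sub>\<infinity>k. b k)"
proof -
  have Ms: "summable (\<lambda>i. M (int_decode i))"
    using M summable_on_reindex_bij_betw[OF bij_int_decode, of M] summable_on_imp_summable by blast
  have eq: "(\<Sum>\<^sub>\<infinity>k. f k) = (\<Sum>i. f (int_decode i))" if "\<And>k. norm (f k) \<le> M k" for f :: "int \<Rightarrow> complex"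
  proof -
    have "f summable_on UNIV"
      by (rule abs_summable_summable, rule Infinite_Sum.abs_summable_on_comparison_test'[OF M])
         (use that in auto)
    then have "((\<lambda>i. f (int_decode i)) has_sum (\<Sum>\<^sub>\<infinity>k. f k)) UNIV"
      using has_sum_reindex_bij_betw[OF bij_int_decode, of f] by simp
    then show ?thesis
      using has_sum_imp_sums sums_unique by blast
  qed
  have "norm (b k) \<le> M k" for k
    using tendsto_norm[OF lim[of k]] by (rule LIMSEQ_le_const2) (use bound in auto)
  moreover have "(\<lambda>n. \<Sum>i. a n (int_decode i)) \<longlonglongrightarrow> (\<Sum>i. b (int_decode i))"
    by (intro conjunct2[OF conjunct2[OF tannerys_theorem[OF lim _ Ms]]])
       (use bound in \<open>auto simp: case_prod_unfold\<close>)
  ultimately show ?thesis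
    using bound by (simp add: eq)
qed

section \<open>The finite and infinite triple product\<close>

text \<open>The value 0 at negative \<open>k\<close> is the one that keeps the recurrence
  \<open>rqp_pred\<close> valid at every integer. It also lets finite sums be written over all
  integers, where they can be shifted and reflected freely.\<close>

definition rqp :: "complex \<Rightarrow> int \<Rightarrow> complex" where
  "rqp q k = (if k < 0 then 0 else 1 / qpoch q q (nat k))"

lemma rqp_pred:
  assumes "nome q"
  shows "rqp q (k - 1) = (1 - q powi k) * rqp q k"
proof (cases "k \<ge> 1")
  case True
  define m where "m = nat (k - 1)"
  have k: "k = int (Suc m)"
    using True by (simp add: m_def)
  have "qpoch q q (Suc m) = qpoch q q m * (1 - q ^ Suc m)"
    by (simp add: qpoch_Suc mult.commute)
  moreover have "1 - q ^ Suc m \<noteq> 0"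
    using nome_power_neq_1[OF assms, of "Suc m"] by auto
  ultimately show ?thesis
    by (simp add: k rqp_def nat_add_distrib power_int_def del: power_Suc)
next
  case False
  then have "k = 0 \<or> k < 0" by auto
  then show ?thesis
    by (auto simp: rqp_def)
qed

lemma rqp_bounded:
  assumes "nome q"
  obtains C where "C > 0" "\<And>k. norm (rqp q k) \<le> C"
proof -
  have "(\<lambda>n. inverse (qpoch q q n)) \<longlonglongrightarrow> inverse (qpoch_inf q q)"
    using assms by (intro tendsto_inverse qpoch_tendsto qpoch_inf_self_nonzero nome_norm)
  then have "Bseq (\<lambda>n. inverse (qpoch q q n))"
    by (rule convergent_imp_Bseq[OF convergentI])
  then obtain C where C: "C > 0" "\<And>n. norm (inverse (qpoch q q n)) \<le> C"
    by (auto simp: Bseq_def)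
  have "norm (rqp q k) \<le> C" for k
    using C(1) C(2)[of "nat k"] by (auto simp: rqp_def divide_inverse)
  then show ?thesis
    using that C(1) by blast
qed

lemma rqp_tendsto:
  assumes "nome q"
  shows "(\<lambda>n. rqp q (int n + k)) \<longlonglongrightarrow> 1 / qpoch_inf q q"
proof -
  have "(\<lambda>n. 1 / qpoch q q (nat (int n + k))) \<longlonglongrightarrow> 1 / qpoch_inf q q"
  proof (intro tendsto_divide tendsto_const qpoch_inf_self_nonzero assms)
    have "filterlim (\<lambda>n. nat (int n + k)) sequentially sequentially"
      unfolding filterlim_at_top eventually_sequentially
    proof (intro allI)
      fix Z :: nat
      show "\<exists>N. \<forall>n\<ge>N. Z \<le> nat (int n + k)"
        by (intro exI[of _ "Z + nat \<bar>k\<bar>"]) auto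
    qed
    then show "(\<lambda>n. qpoch q q (nat (int n + k))) \<longlonglongrightarrow> qpoch_inf q q"
      using qpoch_tendsto[OF nome_norm[OF assms], of q] filterlim_compose by blast
  qed
  moreover have "eventually (\<lambda>n. 1 / qpoch q q (nat (int n + k)) = rqp q (int n + k)) sequentially"
    using eventually_ge_at_top[of "nat (- k)"] by eventually_elim (auto simp: rqp_def)
  ultimately show ?thesis
    by (rule Lim_transform_eventually)
qed

text \<open>\<open>(q;q)\<^bsub>2n+e\<^esub>\<close> times these weights are the signed \<open>q\<close>-binomial coefficients of the
  finite triple product. They are also the kernel of a Bailey pair relative to \<open>q\<^sup>e\<close>, read on
  all integers instead of on the naturals.\<close>

definition jtc :: "complex \<Rightarrow> int \<Rightarrow> nat \<Rightarrow> int \<Rightarrow> complex" where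
  "jtc q e n N = (- 1) powi N * q powi tri (N + 1) * rqp q (int n - N) * rqp q (int n + N + e)"

lemma jtc_support: "N \<notin> {- int n - e..int n} \<Longrightarrow> jtc q e n N = 0"
  by (auto simp: jtc_def rqp_def)

lemma summable_on_jtc: "(\<lambda>N. jtc q e n N * f N) summable_on UNIV"
proof (rule finite_nonzero_values_imp_summable_on)
  have "{N \<in> UNIV. jtc q e n N * f N \<noteq> 0} \<subseteq> {- int n - e..int n}"
    using jtc_support by fastforce
  then show "finite {N \<in> UNIV. jtc q e n N * f N \<noteq> 0}"
    using finite_subset by blast
qed

lemma summable_on_jtc_shift: "(\<lambda>N. jtc q e n (N + k) * f N) summable_on UNIV"
  using summable_on_int_shift_iff[of "\<lambda>N. jtc q e n N * f (N - k)" k] summable_on_jtc by simp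

text \<open>A q-Pascal rule: after normalisation it leads from row \<open>2 * n\<close> of the
  q-binomial triangle to row \<open>2 * n + 1\<close>, and \<open>jtc_Suc_eq\<close> leads on to row
  \<open>2 * n + 2\<close>.\<close>

lemma jtc_1_eq:
  assumes "nome q"
  shows "(1 - q ^ (2 * n + 1)) * jtc q 1 n N = jtc q 0 n N - q ^ n * jtc q 0 n (N + 1)"
proof -
  have q: "q \<noteq> 0" using assms by (rule nome_nonzero)
  define A B s y m where "A = rqp q (int n - N)" and "B = rqp q (int n + N + 1)"
    and "s = (- 1) powi N * q powi tri (N + 1)" and "y = q powi N" and "m = q ^ n"
  have y: "y \<noteq> 0" using q by (simp add: y_def)
  have "rqp q (int n + N) = (1 - m * y * q) * B"
    using rqp_pred[OF assms, of "int n + N + 1"] q by (simp add: B_def m_def y_def power_int_add)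
  then have 0: "jtc q 0 n N = s * A * ((1 - m * y * q) * B)"
    by (simp add: jtc_def A_def s_def)
  have "rqp q (int n - (N + 1)) = (1 - m / y) * A"
    using rqp_pred[OF assms, of "int n - N"] q by (simp add: A_def m_def y_def power_int_diff diff_diff_eq)
  moreover have "q powi tri (N + 1 + 1) = q powi tri (N + 1) * (y * q)"
    using q by (simp only: tri_Suc[of "N + 1"]) (simp add: power_int_add y_def mult_ac)
  moreover have "(- 1 :: complex) powi (N + 1) = - ((- 1) powi N)"
    by (simp add: power_int_add)
  ultimately have 1: "jtc q 0 n (N + 1) = - s * (y * q) * ((1 - m / y) * A) * B"
    by (simp add: jtc_def B_def s_def add_ac)
  have 2: "jtc q 1 n N = s * A * B"
    by (simp add: jtc_def A_def B_def s_def)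
  have 3: "q ^ (2 * n + 1) = m * m * q"
    by (simp add: m_def mult_2 power_add)
  show ?thesis
    unfolding 0 1 2 3 unfolding m_def[symmetric] using y by (simp add: field_simps)
qed

lemma jtc_Suc_eq:
  assumes "nome q"
  shows "(1 - q ^ (2 * n + 2)) * jtc q 0 (Suc n) N = jtc q 1 n N - q ^ (n + 1) * jtc q 1 n (N - 1)"
proof -
  have q: "q \<noteq> 0" using assms by (rule nome_nonzero)
  define A B s y m where "A = rqp q (int n + 1 - N)" and "B = rqp q (int n + N + 1)"
    and "s = (- 1) powi N * q powi tri N" and "y = q powi N" and "m = q ^ n"
  have y: "y \<noteq> 0" using q by (simp add: y_def)
  have s: "(- 1) powi N * q powi tri (N + 1) = s * y"
    using q by (simp add: s_def y_def tri_Suc power_int_add)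
  have "rqp q (int n - N) = (1 - m * q / y) * A"
    using rqp_pred[OF assms, of "int n + 1 - N"] q
    by (simp add: A_def m_def y_def power_int_diff power_int_add algebra_simps)
  then have 0: "jtc q 1 n N = s * y * ((1 - m * q / y) * A) * B"
    by (simp add: jtc_def B_def s)
  have "rqp q (int n + (N - 1) + 1) = (1 - m * y * q) * B"
    using rqp_pred[OF assms, of "int n + N + 1"] q by (simp add: B_def m_def y_def power_int_add)
  moreover have "(- 1 :: complex) powi (N - 1) = - ((- 1) powi N)"
    by (simp add: power_int_diff)
  moreover have "rqp q (int n - (N - 1)) = A"
    unfolding A_def by (rule arg_cong[of _ _ "rqp q"]) simp
  ultimately have 1: "jtc q 1 n (N - 1) = - s * A * ((1 - m * y * q) * B)"
    by (simp add: jtc_def s_def)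
  have "int (Suc n) - N = int n + 1 - N" "int (Suc n) + N + 0 = int n + N + 1"
    by auto
  then have 2: "jtc q 0 (Suc n) N = s * y * A * B"
    unfolding jtc_def by (simp only: A_def B_def s)
  have 3: "q ^ (2 * n + 2) = m * m * q * q" "q ^ (n + 1) = m * q"
    by (simp_all add: m_def mult_2 power_add power2_eq_square)
  show ?thesis
    unfolding 0 1 2 3 using y by (simp add: field_simps)
qed

lemma infsum_diff:
  fixes f g :: "'a \<Rightarrow> complex"
  assumes "f summable_on A" "g summable_on A"
  shows "(\<Sum>\<^sub>\<infinity>x\<in>A. f x - g x) = infsum f A - infsum g A"
  using infsum_add[OF assms(1) summable_on_uminus[THEN iffD2, OF assms(2)]]
  by (simp add: infsum_uminus)

text \<open>Under the generating function in \<open>z\<close>, each of the two q-Pascal rules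
  multiplies by one linear factor, \<open>1 - q ^ n / z\<close> or
  \<open>1 - q ^ n * (z * q)\<close>. Applying them alternately builds both products.\<close>

lemma finite_triple_product:
  assumes "nome q" "z \<noteq> 0"
  shows "qpoch q q (2 * n) * (\<Sum>\<^sub>\<infinity>N. jtc q 0 n N * z powi N) = qpoch (z * q) q n * qpoch (1 / z) q n"
    (is "?P0 n")
  and "qpoch q q (2 * n + 1) * (\<Sum>\<^sub>\<infinity>N. jtc q 1 n N * z powi N) = qpoch (z * q) q n * qpoch (1 / z) q (n + 1)"
    (is "?P1 n")
proof -
  have shift: "(\<Sum>\<^sub>\<infinity>N. jtc q e n (N + k) * z powi N) = z powi (- k) * (\<Sum>\<^sub>\<infinity>N. jtc q e n N * z powi N)" for e n k
    using infsum_int_shift[of "\<lambda>N. jtc q e n N * z powi (N - k)" k] assms(2)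
    by (simp add: power_int_diff power_int_minus divide_inverse mult_ac flip: infsum_cmult_right')
  have 1: "?P1 n" if "?P0 n" for n
  proof -
    have "(1 - q ^ (2 * n + 1)) * (\<Sum>\<^sub>\<infinity>N. jtc q 1 n N * z powi N) =
        (\<Sum>\<^sub>\<infinity>N. jtc q 0 n N * z powi N - q ^ n * (jtc q 0 n (N + 1) * z powi N))"
      by (subst infsum_cmult_right'[symmetric], subst mult.assoc[symmetric], subst jtc_1_eq[OF assms(1)])
         (simp add: algebra_simps)
    also have "\<dots> = (\<Sum>\<^sub>\<infinity>N. jtc q 0 n N * z powi N) - q ^ n * (\<Sum>\<^sub>\<infinity>N. jtc q 0 n (N + 1) * z powi N)"
      by (subst infsum_diff) (auto intro!: summable_on_jtc summable_on_jtc_shift summable_on_cmult_right simp: infsum_cmult_right')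
    also have "\<dots> = (1 - q ^ n * (1 / z)) * (\<Sum>\<^sub>\<infinity>N. jtc q 0 n N * z powi N)"
      unfolding shift by (simp add: algebra_simps power_int_minus divide_inverse)
    finally have *: "(1 - q ^ (2 * n + 1)) * (\<Sum>\<^sub>\<infinity>N. jtc q 1 n N * z powi N) = \<dots>" .
    have "qpoch q q (2 * n + 1) * (\<Sum>\<^sub>\<infinity>N. jtc q 1 n N * z powi N) =
        qpoch q q (2 * n) * ((1 - q ^ (2 * n + 1)) * (\<Sum>\<^sub>\<infinity>N. jtc q 1 n N * z powi N))"
      by (simp add: qpoch_Suc mult_ac)
    also have "\<dots> = (1 - q ^ n * (1 / z)) * (qpoch q q (2 * n) * (\<Sum>\<^sub>\<infinity>N. jtc q 0 n N * z powi N))"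
      by (simp only: * mult.left_commute)
    finally show ?thesis
      unfolding that by (simp add: qpoch_Suc mult_ac)
  qed
  have 2: "?P0 (Suc n)" if "?P1 n" for n
  proof -
    have "(1 - q ^ (2 * n + 2)) * (\<Sum>\<^sub>\<infinity>N. jtc q 0 (Suc n) N * z powi N) =
        (\<Sum>\<^sub>\<infinity>N. jtc q 1 n N * z powi N - q ^ (n + 1) * (jtc q 1 n (N + (- 1)) * z powi N))"
      by (subst infsum_cmult_right'[symmetric], subst mult.assoc[symmetric], subst jtc_Suc_eq[OF assms(1)])
         (simp add: algebra_simps)
    also have "\<dots> = (\<Sum>\<^sub>\<infinity>N. jtc q 1 n N * z powi N) - q ^ (n + 1) * (\<Sum>\<^sub>\<infinity>N. jtc q 1 n (N + (- 1)) * z powi N)"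
      by (subst infsum_diff; (intro summable_on_jtc summable_on_jtc_shift summable_on_cmult_right)?)
         (simp add: infsum_cmult_right')
    also have "\<dots> = (1 - q ^ n * (z * q)) * (\<Sum>\<^sub>\<infinity>N. jtc q 1 n N * z powi N)"
      unfolding shift by (simp add: algebra_simps)
    finally have *: "(1 - q ^ (2 * n + 2)) * (\<Sum>\<^sub>\<infinity>N. jtc q 0 (Suc n) N * z powi N) = \<dots>" .
    have "qpoch q q (2 * Suc n) * (\<Sum>\<^sub>\<infinity>N. jtc q 0 (Suc n) N * z powi N) =
        qpoch q q (2 * n + 1) * ((1 - q ^ (2 * n + 2)) * (\<Sum>\<^sub>\<infinity>N. jtc q 0 (Suc n) N * z powi N))"
      by (simp add: qpoch_Suc mult_ac)
    also have "\<dots> = (1 - q ^ n * (z * q)) * (qpoch q q (2 * n + 1) * (\<Sum>\<^sub>\<infinity>N. jtc q 1 n N * z powi N))"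
      by (simp only: * mult.left_commute)
    finally show ?thesis
      unfolding that by (simp add: qpoch_Suc mult_ac)
  qed
  have 0: "?P0 0"
  proof -
    have "(\<Sum>\<^sub>\<infinity>N. jtc q 0 0 N * z powi N) = (\<Sum>\<^sub>\<infinity>N\<in>{0}. jtc q 0 0 N * z powi N)"
      using jtc_support[of _ 0 0 q] by (intro infsum_cong_neutral) auto
    then show ?thesis
      by (simp add: jtc_def rqp_def)
  qed
  have P0: "?P0 n" for n
    by (induction n) (use 0 1 2 in blast)+
  then show "?P0 n" "?P1 n"
    using 1 by blast+
qed

lemma neg_one_powi_uminus: "(- 1 :: complex) powi (- n) = (- 1) powi n"
  by (simp add: power_int_minus flip: power_int_inverse)

lemma norm_neg_one_powi [simp]: "norm ((- 1 :: complex) powi n) = 1"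
  by (simp add: norm_power_int)

text \<open>Jacobi's triple product, as the limit of the even rows of the finite identity at
  \<open>z = 1 / x\<close>. The boundedness of \<open>rqp\<close> supplies the majorant for the
  passage to the limit, and a final reflection of the index restores \<open>x\<close>.\<close>

lemma jtheta_series:
  assumes "nome q" "x \<noteq> 0"
  shows "jtheta x q = (\<Sum>\<^sub>\<infinity>n. (- 1) powi n * q powi tri n * x powi n)"
proof -
  define z where "z = 1 / x"
  have z: "z \<noteq> 0" using assms by (simp add: z_def)
  have q: "q \<noteq> 0" "norm q < 1" using assms by (auto simp: nome_def)
  obtain C where C: "C > 0" "\<And>k. norm (rqp q k) \<le> C"
    using rqp_bounded[OF assms(1)] by blast
  have "Bseq (\<lambda>n. qpoch q q n)"
    using qpoch_tendsto[OF q(2)] convergent_imp_Bseq convergentI by blast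
  then obtain D where D: "D > 0" "\<And>n. norm (qpoch q q n) \<le> D"
    by (auto simp: Bseq_def)
  have sub: "(\<lambda>n. qpoch q q (2 * n)) \<longlonglongrightarrow> qpoch_inf q q"
    using LIMSEQ_subseq_LIMSEQ[OF qpoch_tendsto[OF q(2), of q], of "\<lambda>n. 2 * n"]
    by (auto simp: strict_mono_def o_def)
  have "(\<lambda>n. \<Sum>\<^sub>\<infinity>N. qpoch q q (2 * n) * (jtc q 0 n N * z powi N)) \<longlonglongrightarrow>
     (\<Sum>\<^sub>\<infinity>N. qpoch_inf q q * ((- 1) powi N * q powi tri (N + 1) * (1 / qpoch_inf q q) * (1 / qpoch_inf q q) * z powi N))"
    (is "?L \<longlonglongrightarrow> infsum ?R UNIV")
  proof (rule infsum_int_tannery[where M = "\<lambda>N. D * C * C * (norm q powi tri N * norm (q * z) powi N)"])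
    fix N :: int
    show "(\<lambda>n. qpoch q q (2 * n) * (jtc q 0 n N * z powi N)) \<longlonglongrightarrow>
      qpoch_inf q q * ((- 1) powi N * q powi tri (N + 1) * (1 / qpoch_inf q q) * (1 / qpoch_inf q q) * z powi N)"
      unfolding jtc_def
      using rqp_tendsto[OF assms(1), of "- N"] rqp_tendsto[OF assms(1), of N]
      by (intro tendsto_intros sub) auto
  next
    fix n N
    have "norm (qpoch q q (2 * n) * (jtc q 0 n N * z powi N)) =
       norm (qpoch q q (2 * n)) * norm (rqp q (int n - N)) * norm (rqp q (int n + N)) * (norm q powi tri N * norm (q * z) powi N)"
      using q by (simp add: jtc_def norm_mult norm_power_int tri_Suc power_int_add power_int_mult_distrib mult_ac)
    also have "\<dots> \<le> D * C * C * (norm q powi tri N * norm (q * z) powi N)"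
      using C D by (intro mult_right_mono mult_mono) auto
    finally show "norm (qpoch q q (2 * n) * (jtc q 0 n N * z powi N)) \<le> \<dots>" .
  next
    show "(\<lambda>N. D * C * C * (norm q powi tri N * norm (q * z) powi N)) summable_on UNIV"
      using q z assms by (intro summable_on_cmult_right summable_on_tri_real) (auto simp: nome_def)
  qed
  then have "(\<lambda>n. qpoch (z * q) q n * qpoch (1 / z) q n) \<longlonglongrightarrow>
     (\<Sum>\<^sub>\<infinity>N. (- 1) powi N * q powi tri (N + 1) * z powi N) / qpoch_inf q q"
  proof -
    have "?R = (\<lambda>N. ((- 1) powi N * q powi tri (N + 1) * z powi N) * inverse (qpoch_inf q q))"
      using qpoch_inf_self_nonzero[OF assms(1)] by (auto simp: field_simps)
    then have R: "infsum ?R UNIV = (\<Sum>\<^sub>\<infinity>N. (- 1) powi N * q powi tri (N + 1) * z powi N) / qpoch_inf q q"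
      by (simp only: infsum_cmult_left' divide_inverse)
    have L: "?L = (\<lambda>n. qpoch (z * q) q n * qpoch (1 / z) q n)"
      using finite_triple_product(1)[OF assms(1) z] by (simp add: infsum_cmult_right')
    show "?L \<longlonglongrightarrow> infsum ?R UNIV \<Longrightarrow> ?thesis"
      unfolding R L .
  qed
  moreover have "(\<lambda>n. qpoch (z * q) q n * qpoch (1 / z) q n) \<longlonglongrightarrow> qpoch_inf (z * q) q * qpoch_inf (1 / z) q"
    by (intro tendsto_intros qpoch_tendsto q)
  ultimately have "qpoch_inf (z * q) q * qpoch_inf (1 / z) q =
     (\<Sum>\<^sub>\<infinity>N. (- 1) powi N * q powi tri (N + 1) * z powi N) / qpoch_inf q q"
    using LIMSEQ_unique by blast
  then have "jtheta x q = (\<Sum>\<^sub>\<infinity>N. (- 1) powi N * q powi tri (N + 1) * z powi N)"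
    using qpoch_inf_self_nonzero[OF assms(1)] by (simp add: jtheta_def z_def field_simps)
  also have "\<dots> = (\<Sum>\<^sub>\<infinity>N. (- 1) powi (- N) * q powi tri (- N + 1) * z powi (- N))"
    by (rule infsum_int_uminus[symmetric])
  also have "\<dots> = (\<Sum>\<^sub>\<infinity>N. (- 1) powi N * q powi tri N * x powi N)"
    unfolding neg_one_powi_uminus tri_one_minus
    by (simp add: z_def power_int_minus power_int_divide_distrib)
  finally show ?thesis .
qed

lemma summable_on_jtheta:
  assumes "nome q" "x \<noteq> 0"
  shows "(\<lambda>n. (- 1) powi n * q powi tri n * x powi n) summable_on UNIV"
  by (rule summable_on_tri_bound[of q "norm x" _ 1])
     (use assms in \<open>auto simp: norm_mult norm_power_int\<close>)

lemma jtheta_has_sum: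
  assumes "nome q" "x \<noteq> 0"
  shows "((\<lambda>n. (- 1) powi n * q powi tri n * x powi n) has_sum jtheta x q) UNIV"
  using summable_on_jtheta[OF assms] by (simp add: jtheta_series[OF assms])

section \<open>Hecke coefficients and Bailey pairs\<close>

text \<open>Unrolled, the value at \<open>2 * m\<close> is the sum of \<open>q ^ (m^2 - j^2)\<close>
  over \<open>-m <= j <= m\<close>, and the value at \<open>2 * m + 1\<close> is the sum of
  \<open>q ^ (m * (m + 1) - j * (j + 1))\<close> over \<open>-m - 1 <= j <= m\<close>. These are the
  inner sums of an indefinite theta series.\<close>

fun hecke_nat :: "complex \<Rightarrow> nat \<Rightarrow> complex" where
  "hecke_nat q 0 = 1"
| "hecke_nat q (Suc 0) = 2"
| "hecke_nat q (Suc (Suc n)) = q ^ Suc n * hecke_nat q n + 2"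

text \<open>The values at negative indices are those obtained by running the recurrence backwards,
  so that \<open>hecke_add_2\<close> holds at every integer.\<close>

definition hecke :: "complex \<Rightarrow> int \<Rightarrow> complex" where
  "hecke q k = (if k \<ge> 0 then hecke_nat q (nat k) else 2 - hecke_nat q (nat (- k)))"

lemma hecke_uminus: "hecke q (- k) = 2 - hecke q k"
  by (cases "k = 0") (auto simp: hecke_def)

lemma hecke_add_2:
  assumes "q \<noteq> 0"
  shows "hecke q (k + 2) = q powi (k + 1) * hecke q k + 2"
proof -
  consider "k \<ge> 0" | "k = -1" | "k \<le> -2" by linarith
  then show ?thesis
  proof cases
    case 1
    then obtain n where k: "k = int n" by (metis nonneg_int_cases)
    have "nat (int n + 2) = Suc (Suc n)" "int n + 1 = int (Suc n)" by auto
    then show ?thesis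
      unfolding k by (simp only: hecke_def hecke_nat.simps power_int_of_nat nat_int) simp
  next
    case 2
    then show ?thesis
      by (simp add: hecke_def)
  next
    \<comment> \<open>With \<open>k = - (n + 2)\<close>, this is the recurrence at the mirrored
      index \<open>n\<close>, solved for its other end.\<close>
    case 3
    then obtain n where k: "k = - int (n + 2)"
      using that by (intro that[of "nat (- k) - 2"]) auto
    have "hecke q k = - (q ^ Suc n * hecke_nat q n)"
    proof -
      have "nat (- k) = Suc (Suc n)" "\<not> k \<ge> 0"
        using k by auto
      then show ?thesis
        by (simp add: hecke_def)
    qed
    moreover have "hecke q (k + 2) = 2 - hecke_nat q n"
      by (cases "n = 0") (auto simp: hecke_def k)
    moreover have "q powi (k + 1) * q ^ Suc n = 1"
    proof -
      have "k + 1 + int (Suc n) = 0" using k by simp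
      then show ?thesis
        using assms power_int_add[of q "k + 1" "int (Suc n)"] unfolding power_int_of_nat by simp
    qed
    ultimately show ?thesis
      by (simp add: mult.assoc[symmetric] del: power_Suc)
  qed
qed

lemma norm_hecke_nat_le:
  assumes "norm q < 1"
  shows "norm (hecke_nat q n) \<le> real n + 2"
proof (induction n rule: less_induct)
  case (less n)
  consider "n = 0" | "n = 1" | m where "n = Suc (Suc m)"
    by (metis One_nat_def not0_implies_Suc)
  then show ?case
  proof cases
    case 3
    have "norm (hecke_nat q n) \<le> norm (q ^ Suc m) * norm (hecke_nat q m) + 2"
      unfolding 3 by (simp only: hecke_nat.simps norm_mult[symmetric]) (rule order.trans[OF norm_triangle_ineq], simp)
    also have "\<dots> \<le> 1 * (real m + 2) + 2"
      using assms less[of m] 3 by (intro add_right_mono mult_mono) (auto simp: norm_power power_le_one simp del: power_Suc)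
    finally show ?thesis
      using 3 by simp
  qed auto
qed

lemma norm_hecke_le:
  assumes "norm q < 1"
  shows "norm (hecke q k) \<le> \<bar>real_of_int k\<bar> + 4"
proof (cases "k \<ge> 0")
  case True
  then show ?thesis
    using norm_hecke_nat_le[OF assms, of "nat k"] by (simp add: hecke_def)
next
  case False
  then have "norm (hecke q k) \<le> 2 + norm (hecke_nat q (nat (- k)))"
    by (simp add: hecke_def) (rule order.trans[OF norm_triangle_ineq4], simp)
  then show ?thesis
    using False norm_hecke_nat_le[OF assms, of "nat (- k)"] by simp
qed

lemma summable_on_tri_hecke:
  assumes "nome p" "x \<noteq> 0" "norm q < 1"
  shows "(\<lambda>n. p powi tri n * x powi n * hecke q (n + a)) summable_on UNIV"
proof -
  define A where "A = \<bar>real_of_int a\<bar> + 4"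
  have p: "p \<noteq> 0" "norm p < 1" using assms by (auto simp: nome_def)
  \<comment> \<open>The linear growth in \<open>n\<close> is traded for
    \<open>2 powi n + (1 / 2) powi n\<close>, which only rescales \<open>x\<close> in the
    majorant.\<close>
  have hb: "norm (hecke q (n + a)) \<le> A * (2 powi n + (1 / 2) powi n)" for n
  proof -
    have "real m + 1 \<le> 2 ^ m" for m
      by (induction m) auto
    from this[of "nat \<bar>n\<bar>"] have "real_of_int \<bar>n\<bar> + 1 \<le> 2 ^ nat \<bar>n\<bar>"
      by simp
    also have "2 ^ nat \<bar>n\<bar> \<le> (2 powi n + (1 / 2) powi n :: real)"
      by (cases "n \<ge> 0") (auto simp: power_int_def power_divide inverse_eq_divide)
    finally have *: "real_of_int \<bar>n\<bar> + 1 \<le> 2 powi n + (1 / 2) powi n" .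
    have "norm (hecke q (n + a)) \<le> \<bar>real_of_int (n + a)\<bar> + 4"
      by (rule norm_hecke_le[OF assms(3)])
    also have "\<dots> \<le> real_of_int \<bar>n\<bar> + A"
      by (simp add: A_def)
    also have "\<dots> \<le> A * (real_of_int \<bar>n\<bar> + 1)"
    proof -
      have "real_of_int \<bar>n\<bar> * 1 \<le> real_of_int \<bar>n\<bar> * A"
        by (intro mult_left_mono) (auto simp: A_def)
      then show ?thesis by (simp add: algebra_simps)
    qed
    also have "\<dots> \<le> A * (2 powi n + (1 / 2) powi n)"
      using * by (intro mult_left_mono) (auto simp: A_def)
    finally show ?thesis .
  qed
  have "(\<lambda>n. A * (norm p powi tri n * (2 * norm x) powi n) + A * (norm p powi tri n * (norm x / 2) powi n)) summable_on UNIV"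
    using p assms by (intro summable_on_add summable_on_cmult_right summable_on_tri_real) auto
  then have "(\<lambda>n. norm (p powi tri n * x powi n * hecke q (n + a))) summable_on UNIV"
  proof (rule Infinite_Sum.abs_summable_on_comparison_test')
    fix n
    have "norm (p powi tri n * x powi n * hecke q (n + a)) \<le>
        norm p powi tri n * norm x powi n * (A * (2 powi n + (1 / 2) powi n))"
      unfolding norm_mult norm_power_int by (intro mult_left_mono hb) auto
    also have "\<dots> = A * (norm p powi tri n * (2 * norm x) powi n) + A * (norm p powi tri n * (norm x / 2) powi n)"
      by (simp add: power_int_mult_distrib power_int_divide_distrib algebra_simps)
    finally show "norm (p powi tri n * x powi n * hecke q (n + a)) \<le> \<dots>" .
  qed
  then show ?thesis
    by (rule abs_summable_summable)
qed

text \<open>The beta side of a Bailey pair whose alpha side carries Hecke coefficients shifted by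
  \<open>a\<close>. The pairs \<open>(e, a)\<close> equal to \<open>(0, 0)\<close>,
  \<open>(1, 0)\<close> and \<open>(1, -1)\<close> yield X, phi and psi; the other shifts serve to
  close the recurrences.\<close>

definition bsum :: "complex \<Rightarrow> int \<Rightarrow> nat \<Rightarrow> int \<Rightarrow> complex" where
  "bsum q e n a = (\<Sum>\<^sub>\<infinity>N. jtc q e n N * hecke q (N + a))"

lemma jtc_uminus:
  assumes "q \<noteq> 0"
  shows "jtc q 0 n (- N) = q powi (- N) * jtc q 0 n N"
proof -
  have "tri (- N + 1) = tri (N + 1) - N"
    using tri_one_minus[of N] tri_Suc[of N] by simp
  then show ?thesis
    using assms unfolding jtc_def neg_one_powi_uminus by (simp add: power_int_diff power_int_minus divide_inverse mult_ac)
qed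

lemma jtc_step:
  assumes "nome q"
  shows "(1 - q ^ n * q powi (N + 1)) * jtc q 0 n (N + 1) = (q ^ Suc n - q powi (N + 1)) * jtc q 0 n N"
proof -
  have q: "q \<noteq> 0" using assms by (rule nome_nonzero)
  have "rqp q (int n + N) = (1 - q ^ n * q powi (N + 1)) * rqp q (int n + (N + 1))"
    using rqp_pred[OF assms, of "int n + N + 1"] q by (simp add: power_int_add mult_ac add_ac)
  moreover have "q powi N * rqp q (int n - (N + 1)) = (q powi N - q ^ n) * rqp q (int n - N)"
    using rqp_pred[OF assms, of "int n - N"] q by (simp add: power_int_diff field_simps diff_diff_eq)
  moreover have "q powi tri (N + 1 + 1) = q powi tri (N + 1) * (q powi N * q)"
    using q by (simp only: tri_Suc[of "N + 1"]) (simp add: power_int_add mult_ac)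
  moreover have "(- 1 :: complex) powi (N + 1) = - ((- 1) powi N)"
    by (simp add: power_int_add)
  moreover have "q powi (N + 1) = q powi N * q"
    using q by (simp add: power_int_add)
  moreover define A B x1 y m s where "A = rqp q (int n - N)" and "B = rqp q (int n + (N + 1))"
    and "x1 = rqp q (int n - (N + 1))" and "y = q powi N" and "m = q ^ n"
    and "s = (- 1) powi N * q powi tri (N + 1)"
  ultimately have *: "jtc q 0 n (N + 1) = - s * (y * q) * x1 * B" "jtc q 0 n N = s * A * ((1 - m * (y * q)) * B)"
      "y * x1 = (y - m) * A" "q powi (N + 1) = y * q"
    by (simp_all add: jtc_def)
  have "(1 - m * (y * q)) * (- s * (y * q) * x1 * B) = - ((1 - m * (y * q)) * s * q * B * (y * x1))"
    by (simp add: mult_ac)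
  also have "\<dots> = (m * q - y * q) * (s * A * ((1 - m * (y * q)) * B))"
    unfolding *(3) by (simp add: algebra_simps)
  finally show ?thesis
    unfolding * m_def by (simp add: mult_ac)
qed

text \<open>Each of the two reciprocals contributes one factor, and their product is a combination
  of \<open>1\<close>, \<open>q powi N\<close> and \<open>q powi (- N)\<close>: exactly the
  multipliers that the Hecke recurrence can absorb into a shift of \<open>a\<close> by 2.\<close>

lemma jtc_Suc_step:
  assumes "nome q"
  shows "jtc q 0 n N = (1 + q ^ (2 * Suc n) - q ^ Suc n * (q powi N + q powi (- N))) * jtc q 0 (Suc n) N"
proof -
  have q: "q \<noteq> 0" using assms by (rule nome_nonzero)
  have a: "rqp q (int n + N) = (1 - q ^ Suc n * q powi N) * rqp q (int (Suc n) + N)"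
    using rqp_pred[OF assms, of "int (Suc n) + N"] q by (simp add: power_int_add mult_ac add_ac)
  have b: "rqp q (int n - N) = (1 - q ^ Suc n * q powi (- N)) * rqp q (int (Suc n) - N)"
    using rqp_pred[OF assms, of "int (Suc n) - N"] q
    by (simp add: power_int_add power_int_diff power_int_minus divide_inverse mult_ac algebra_simps)
  have c: "q powi N * q powi (- N) = 1"
    using q by (simp add: power_int_minus)
  have "jtc q 0 n N = ((1 - q ^ Suc n * q powi N) * (1 - q ^ Suc n * q powi (- N))) * jtc q 0 (Suc n) N"
    by (simp only: jtc_def add_0_right a b mult_ac)
  also have "(1 - q ^ Suc n * q powi N) * (1 - q ^ Suc n * q powi (- N)) =
     1 + q ^ Suc n * q ^ Suc n * (q powi N * q powi (- N)) - q ^ Suc n * (q powi N + q powi (- N))"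
    by (simp add: algebra_simps)
  also have "\<dots> = 1 + q ^ (2 * Suc n) - q ^ Suc n * (q powi N + q powi (- N))"
    by (simp only: c mult_2 power_add mult_1_right)
  finally show ?thesis .
qed

text \<open>At \<open>z = 1\<close> the finite triple product contains the factor 0. This removes
  the constant 2 whenever the Hecke recurrence is applied under the sum.\<close>

lemma jtc_sum_0:
  assumes "nome q" "n > 0"
  shows "(\<Sum>\<^sub>\<infinity>N. jtc q 0 n N) = 0"
proof -
  have "qpoch 1 q n = 0"
    using assms(2) by (auto simp: qpoch_def intro!: bexI[of _ 0])
  then show ?thesis
    using finite_triple_product(1)[OF assms(1), of 1 n] qpoch_self_nonzero[OF assms(1)] by simp
qed

lemma summable_on_jtc_mult: "(\<lambda>N. f N * jtc q e n N) summable_on UNIV"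
  using summable_on_jtc[of q e n f] by (simp add: mult.commute)

lemma summable_on_jtc_self: "(\<lambda>N. jtc q e n N) summable_on UNIV"
  using summable_on_jtc[of q e n "\<lambda>_. 1"] by simp

text \<open>The next three relations come from the two symmetries of the weights and of the Hecke
  coefficients: the reflection \<open>N \<mapsto> - N\<close> and the shift \<open>N \<mapsto> N + 1\<close>.\<close>

lemma bsum_reflect:
  assumes "nome q"
  shows "bsum q 0 n a = - (q powi (- a - 1)) * bsum q 0 n (- a - 2)"
proof -
  have q: "q \<noteq> 0" using assms by (rule nome_nonzero)
  have "bsum q 0 n a = (\<Sum>\<^sub>\<infinity>N. jtc q 0 n (- N) * hecke q (- N + a))"
    unfolding bsum_def by (rule infsum_int_uminus[symmetric])
  also have "\<dots> = (\<Sum>\<^sub>\<infinity>N. - (q powi (- a - 1)) * (jtc q 0 n N * hecke q (N + (- a - 2))))"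
  proof (rule infsum_cong)
    fix N
    have idx: "N + (- a - 2) = N - a - 2"
      by simp
    have "hecke q (- N + a) = 2 - hecke q (N - a)"
      using hecke_uminus[of q "N - a"] by simp
    moreover have "hecke q (N - a) = q powi (N - a - 1) * hecke q (N - a - 2) + 2"
      using hecke_add_2[OF q, of "N - a - 2"] by simp
    moreover have "q powi (- a - 1) = q powi (- N) * q powi (N - a - 1)"
      using q by (simp flip: power_int_add)
    ultimately show "jtc q 0 n (- N) * hecke q (- N + a) = - (q powi (- a - 1)) * (jtc q 0 n N * hecke q (N + (- a - 2)))"
      unfolding idx using jtc_uminus[OF q, of n N] by (simp add: mult_ac)
  qed
  also have "\<dots> = - (q powi (- a - 1)) * bsum q 0 n (- a - 2)"
    unfolding bsum_def by (rule infsum_cmult_right')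
  finally show ?thesis .
qed

lemma bsum_powi:
  assumes "nome q" "n > 0"
  shows "(\<Sum>\<^sub>\<infinity>N. q powi N * (jtc q 0 n N * hecke q (N + a))) = q powi (- a - 1) * bsum q 0 n (a + 2)"
proof -
  have q: "q \<noteq> 0" using assms by (auto simp: nome_def)
  have "(\<Sum>\<^sub>\<infinity>N. q powi N * (jtc q 0 n N * hecke q (N + a))) =
    (\<Sum>\<^sub>\<infinity>N. q powi (- a - 1) * (jtc q 0 n N * hecke q (N + (a + 2))) - 2 * q powi (- a - 1) * jtc q 0 n N)"
  proof (rule infsum_cong)
    fix N
    have "q powi (- a - 1) * hecke q (N + (a + 2)) =
        q powi (- a - 1) * q powi (N + a + 1) * hecke q (N + a) + 2 * q powi (- a - 1)"
      using hecke_add_2[OF q, of "N + a"] by (simp add: algebra_simps)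
    also have "q powi (- a - 1) * q powi (N + a + 1) = q powi N"
      using q by (simp flip: power_int_add)
    finally show "q powi N * (jtc q 0 n N * hecke q (N + a)) =
       q powi (- a - 1) * (jtc q 0 n N * hecke q (N + (a + 2))) - 2 * q powi (- a - 1) * jtc q 0 n N"
      by (simp add: algebra_simps)
  qed
  also have "\<dots> = q powi (- a - 1) * bsum q 0 n (a + 2)"
    using jtc_sum_0[OF assms]
    by (subst infsum_diff; (intro summable_on_cmult_right summable_on_jtc summable_on_jtc_self)?)
       (simp add: infsum_cmult_right' bsum_def)
  finally show ?thesis .
qed

lemma bsum_shift:
  assumes "nome q" "n > 0"
  shows "bsum q 0 n a - q ^ n * (q powi (- a - 1) * bsum q 0 n (a + 2)) =
    q ^ Suc n * bsum q 0 n (a + 1) - q powi (- a - 1) * bsum q 0 n (a + 3)"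
proof -
  have q: "q \<noteq> 0" using assms by (auto simp: nome_def)
  have sm: "(\<lambda>N. q powi N * (jtc q 0 n N * hecke q (N + b))) summable_on UNIV" for b
    using summable_on_jtc_mult[of "\<lambda>N. q powi N * hecke q (N + b)" q 0 n] by (simp add: mult_ac)
  have "bsum q 0 n a - q ^ n * (q powi (- a - 1) * bsum q 0 n (a + 2)) =
     (\<Sum>\<^sub>\<infinity>N. jtc q 0 n N * hecke q (N + a) - q ^ n * (q powi N * (jtc q 0 n N * hecke q (N + a))))"
    unfolding bsum_powi[OF assms, symmetric]
    by (subst infsum_diff; (intro summable_on_cmult_right summable_on_jtc sm)?)
       (simp only: infsum_cmult_right' bsum_def)
  also have "\<dots> = (\<Sum>\<^sub>\<infinity>N. (1 - q ^ n * q powi (N + 1)) * jtc q 0 n (N + 1) * hecke q (N + 1 + a))"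
    by (subst infsum_int_shift[of _ 1, symmetric]) (simp add: algebra_simps)
  also have "\<dots> = (\<Sum>\<^sub>\<infinity>N. q ^ Suc n * (jtc q 0 n N * hecke q (N + (a + 1))) - q * (q powi N * (jtc q 0 n N * hecke q (N + (a + 1)))))"
    unfolding jtc_step[OF assms(1)] using q by (simp add: power_int_add algebra_simps)
  also have "\<dots> = q ^ Suc n * bsum q 0 n (a + 1) - q * (\<Sum>\<^sub>\<infinity>N. q powi N * (jtc q 0 n N * hecke q (N + (a + 1))))"
    by (subst infsum_diff; (intro summable_on_cmult_right summable_on_jtc sm)?)
       (simp only: infsum_cmult_right' bsum_def)
  also have "\<dots> = q ^ Suc n * bsum q 0 n (a + 1) - q powi (- a - 1) * bsum q 0 n (a + 3)"
  proof -
    have "q * q powi (- (a + 1) - 1) = q powi (- a - 1)"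
    proof -
      have "q powi (- (a + 1) - 1 + 1) = q powi (- (a + 1) - 1) * q"
        using q by (intro power_int_add_1) auto
      moreover have "- (a + 1) - 1 + 1 = - a - 1" by simp
      ultimately show ?thesis
        by (simp only: mult.commute)
    qed
    then show ?thesis
      unfolding bsum_powi[OF assms] by (simp add: mult.assoc[symmetric] add.assoc)
  qed
  finally show ?thesis .
qed

text \<open>The shift -1 is the fixed point of the reflection, which there reduces to a change of
  sign.\<close>

lemma bsum_minus_1:
  assumes "nome q"
  shows "bsum q 0 n (- 1) = 0"
  using bsum_reflect[OF assms, of n "-1"] by simp

lemma bsum_minus_2:
  assumes "nome q"
  shows "bsum q 0 n (- 2) = - q * bsum q 0 n 0"
  using bsum_reflect[OF assms, of n "-2"] by simp

text \<open>The shift relation at \<open>a = -2\<close>, once the values at -1 and -2 are inserted,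
  determines the value at 1; at \<open>a = -1\<close> it then gives the value at 2.\<close>

lemma bsum_1:
  assumes "nome q" "n > 0"
  shows "bsum q 0 n 1 = (1 + q ^ n) * bsum q 0 n 0"
proof -
  have "q * bsum q 0 n 1 = q * ((1 + q ^ n) * bsum q 0 n 0)"
    using bsum_shift[OF assms, of "-2"] bsum_minus_1[OF assms(1), of n] bsum_minus_2[OF assms(1), of n]
    by (simp add: algebra_simps)
  then show ?thesis
    using nome_nonzero[OF assms(1)] by simp
qed

lemma bsum_2:
  assumes "nome q" "n > 0"
  shows "bsum q 0 n 2 = q ^ n * bsum q 0 n 1 + q ^ Suc n * bsum q 0 n 0"
  using bsum_shift[OF assms, of "-1"] bsum_minus_1[OF assms(1), of n] by (simp add: algebra_simps)

text \<open>\<open>jtc_Suc_step\<close> expresses the sum at \<open>n\<close> through the sums at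
  \<open>n + 1\<close> with shifts 0, 2 and -2. All three are multiples of the one with shift 0, so
  a first-order recurrence in \<open>n\<close> results, and it is the one satisfied by the quotient
  of \<open>qpoch q q n\<close> and \<open>qpoch q q (2 * n)\<close>.\<close>

lemma bsum_0:
  assumes "nome q"
  shows "qpoch q q (2 * n) * bsum q 0 n 0 = qpoch q q n"
proof (induction n)
  case 0
  have "bsum q 0 0 0 = (\<Sum>\<^sub>\<infinity>N\<in>{0}. jtc q 0 0 N * hecke q N)"
    unfolding bsum_def using jtc_support[of _ 0 0 q] by (intro infsum_cong_neutral) auto
  then show ?case
    by (simp add: jtc_def rqp_def hecke_def)
next
  case (Suc n)
  have q: "q \<noteq> 0" using assms by (rule nome_nonzero)
  define m where "m = q ^ Suc n"
  define K where "K = bsum q 0 (Suc n)"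
  \<comment> \<open>The multiplier \<open>q powi (- N)\<close> is absorbed by the Hecke recurrence
    read from \<open>N - 2\<close> to \<open>N\<close>; the constant it leaves becomes a reflected
    sum of weights, which is 0.\<close>
  have sum_neg: "(\<Sum>\<^sub>\<infinity>N. q powi (- N) * (jtc q 0 (Suc n) N * hecke q N)) = q powi (- 1) * K (- 2)"
  proof -
    have "(\<Sum>\<^sub>\<infinity>N. q powi (- N) * (jtc q 0 (Suc n) N * hecke q N)) =
      (\<Sum>\<^sub>\<infinity>N. q powi (- 1) * (jtc q 0 (Suc n) N * hecke q (N + (- 2))) + 2 * jtc q 0 (Suc n) (- N))"
    proof (rule infsum_cong)
      fix N
      have "q powi (- N) * hecke q N = q powi (- N) * q powi (N - 1) * hecke q (N - 2) + 2 * q powi (- N)"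
        using hecke_add_2[OF q, of "N - 2"] by (simp add: algebra_simps)
      also have "q powi (- N) * q powi (N - 1) = q powi (- 1)"
        using q by (simp flip: power_int_add)
      finally have "jtc q 0 (Suc n) N * (q powi (- N) * hecke q N) =
          jtc q 0 (Suc n) N * (q powi (- 1) * hecke q (N - 2) + 2 * q powi (- N))"
        by (simp only:)
      then show "q powi (- N) * (jtc q 0 (Suc n) N * hecke q N) =
          q powi (- 1) * (jtc q 0 (Suc n) N * hecke q (N + (- 2))) + 2 * jtc q 0 (Suc n) (- N)"
        unfolding jtc_uminus[OF q] by (simp add: algebra_simps)
    qed
    also have "\<dots> = q powi (- 1) * K (- 2) + 2 * (\<Sum>\<^sub>\<infinity>N. jtc q 0 (Suc n) (- N))"
      unfolding K_def bsum_def
      using summable_on_int_uminus_iff[of "jtc q 0 (Suc n)"] summable_on_jtc_self[of q 0 "Suc n"]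
      by (subst infsum_add; (intro summable_on_cmult_right summable_on_jtc)?)
         (auto simp: infsum_cmult_right')
    also have "(\<Sum>\<^sub>\<infinity>N. jtc q 0 (Suc n) (- N)) = 0"
      using jtc_sum_0[OF assms, of "Suc n"] by (simp add: infsum_int_uminus)
    finally show ?thesis by simp
  qed
  have "bsum q 0 n 0 = (\<Sum>\<^sub>\<infinity>N. (1 + m ^ 2) * (jtc q 0 (Suc n) N * hecke q N) -
     m * (q powi N * (jtc q 0 (Suc n) N * hecke q N) + q powi (- N) * (jtc q 0 (Suc n) N * hecke q N)))"
  proof -
    have "q ^ (2 * Suc n) = m ^ 2"
      by (simp only: m_def power_mult[symmetric] mult.commute)
    then show ?thesis
      unfolding bsum_def jtc_Suc_step[OF assms, of n] m_def[symmetric] by (simp add: algebra_simps)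
  qed
  also have "\<dots> = (1 + m ^ 2) * K 0 - m * (q powi (- 1) * K 2 + q powi (- 1) * K (- 2))"
  proof -
    have 1: "(\<lambda>N. q powi N * (jtc q 0 (Suc n) N * hecke q N)) summable_on UNIV"
      using summable_on_jtc_mult[of "\<lambda>N. q powi N * hecke q N"] by (simp add: mult_ac)
    have 2: "(\<lambda>N. q powi (- N) * (jtc q 0 (Suc n) N * hecke q N)) summable_on UNIV"
      using summable_on_jtc_mult[of "\<lambda>N. q powi (- N) * hecke q N"] by (simp add: mult_ac)
    have 3: "(\<Sum>\<^sub>\<infinity>N. q powi N * (jtc q 0 (Suc n) N * hecke q N)) = q powi (- 1) * K 2"
      using bsum_powi[OF assms, of "Suc n" 0] by (simp add: K_def)
    show ?thesis
      using 1 2 unfolding 3[symmetric] sum_neg[symmetric]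
      by (subst infsum_diff; (intro summable_on_cmult_right summable_on_jtc summable_on_add)?)
         (simp_all add: infsum_cmult_right' infsum_add K_def bsum_def)
  qed
  finally have *: "q * bsum q 0 n 0 = q * (1 + m ^ 2) * K 0 - m * (K 2 + K (- 2))"
    using q by (simp add: power_int_minus field_simps)
  have "K 2 = m * ((1 + m) * K 0) + m * q * K 0" "K (- 2) = - q * K 0"
    using bsum_2[OF assms, of "Suc n"] bsum_1[OF assms, of "Suc n"] bsum_minus_2[OF assms, of "Suc n"]
    by (auto simp: K_def m_def algebra_simps)
  then have "q * bsum q 0 n 0 = (1 + m) * (q - m * m) * K 0"
    unfolding * by (simp add: algebra_simps power2_eq_square power3_eq_cube)
  also have "\<dots> = q * ((1 + m) * (1 - q ^ (2 * n + 1)) * K 0)"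
  proof -
    have "m * m = q * q ^ (2 * n + 1)"
      by (simp add: m_def mult_2 power_add)
    then show ?thesis
      by (simp only:) (simp add: algebra_simps)
  qed
  finally have rec: "q * bsum q 0 n 0 = q * ((1 + m) * (1 - q ^ (2 * n + 1)) * K 0)" .
  then have rec: "bsum q 0 n 0 = (1 + m) * (1 - q ^ (2 * n + 1)) * K 0"
    using q by simp
  have "qpoch q q (2 * Suc n) = qpoch q q (2 * n) * (1 - q ^ (2 * n + 1)) * (1 - m * m)"
  proof -
    have "2 * Suc n = Suc (Suc (2 * n))" "q ^ (2 * n) = q ^ n * q ^ n"
      by (simp_all add: mult_2 power_add)
    then show ?thesis
      by (simp only: qpoch_Suc m_def) (simp add: mult_2 power_add mult_ac)
  qed
  then have "qpoch q q (2 * Suc n) * K 0 = qpoch q q (2 * n) * (1 - m) * ((1 + m) * (1 - q ^ (2 * n + 1)) * K 0)"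
    by (simp only:) (simp add: algebra_simps)
  also have "\<dots> = (qpoch q q (2 * n) * bsum q 0 n 0) * (1 - m)"
    by (simp add: rec)
  also have "\<dots> = qpoch q q (Suc n)"
    unfolding Suc by (simp add: qpoch_Suc m_def mult_ac)
  finally show ?case by (simp add: K_def)
qed

lemma bsum_e1:
  assumes "nome q"
  shows "(1 - q ^ (2 * n + 1)) * bsum q 1 n a = bsum q 0 n a - q ^ n * bsum q 0 n (a - 1)"
proof -
  have "(1 - q ^ (2 * n + 1)) * bsum q 1 n a =
     (\<Sum>\<^sub>\<infinity>N. (1 - q ^ (2 * n + 1)) * jtc q 1 n N * hecke q (N + a))"
    unfolding bsum_def mult.assoc by (rule infsum_cmult_right'[symmetric])
  also have "\<dots> = (\<Sum>\<^sub>\<infinity>N. jtc q 0 n N * hecke q (N + a) - q ^ n * (jtc q 0 n (N + 1) * hecke q (N + a)))"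
    unfolding jtc_1_eq[OF assms] by (simp add: algebra_simps)
  also have "\<dots> = bsum q 0 n a - q ^ n * (\<Sum>\<^sub>\<infinity>N. jtc q 0 n (N + 1) * hecke q (N + a))"
    unfolding bsum_def
    by (subst infsum_diff; (intro summable_on_cmult_right summable_on_jtc summable_on_jtc_shift)?)
       (simp add: infsum_cmult_right')
  also have "(\<Sum>\<^sub>\<infinity>N. jtc q 0 n (N + 1) * hecke q (N + a)) = bsum q 0 n (a - 1)"
    using infsum_int_shift[of "\<lambda>N. jtc q 0 n N * hecke q (N + (a - 1))" 1] by (simp add: bsum_def algebra_simps)
  finally show ?thesis .
qed

lemma bsum_e1_0:
  assumes "nome q"
  shows "bsum q 1 n 0 = qpoch q q n / qpoch q q (2 * n + 1)"
proof -
  have "qpoch q q (2 * n + 1) * bsum q 1 n 0 = qpoch q q (2 * n) * ((1 - q ^ (2 * n + 1)) * bsum q 1 n 0)"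
    by (simp add: qpoch_Suc mult_ac)
  also have "\<dots> = qpoch q q n"
    unfolding bsum_e1[OF assms] using bsum_0[OF assms, of n] bsum_minus_1[OF assms, of n] by simp
  finally show ?thesis
    using qpoch_self_nonzero[OF assms, of "2 * n + 1"] by (simp add: field_simps)
qed

lemma bsum_e1_minus_1:
  assumes "nome q"
  shows "bsum q 1 n (- 1) = q ^ (n + 1) * qpoch q q n / qpoch q q (2 * n + 1)"
proof -
  have "qpoch q q (2 * n + 1) * bsum q 1 n (- 1) = qpoch q q (2 * n) * ((1 - q ^ (2 * n + 1)) * bsum q 1 n (- 1))"
    by (simp add: qpoch_Suc mult_ac)
  also have "\<dots> = q ^ (n + 1) * (qpoch q q (2 * n) * bsum q 0 n 0)"
    unfolding bsum_e1[OF assms] using bsum_minus_1[OF assms, of n] bsum_minus_2[OF assms, of n] by simp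
  also have "\<dots> = q ^ (n + 1) * qpoch q q n"
    using bsum_0[OF assms, of n] by simp
  finally show ?thesis
    using qpoch_self_nonzero[OF assms, of "2 * n + 1"] by (simp add: field_simps)
qed

section \<open>The Bailey transform\<close>

text \<open>The weights of Bailey's lemma for \<open>a = q powi e\<close> with the first parameter
  equal to \<open>r\<close> and the second tending to infinity, in the case
  \<open>a * q = r ^ 2\<close>, where the remaining power has base \<open>- r\<close> as
  well.\<close>

definition delta :: "complex \<Rightarrow> complex \<Rightarrow> nat \<Rightarrow> complex" where
  "delta q r n = qpoch r q n * (- r) ^ n * q powi tri (int n)"

definition conj_bailey :: "complex \<Rightarrow> int \<Rightarrow> complex \<Rightarrow> int \<Rightarrow> complex" where
  "conj_bailey q e r N = (\<Sum>\<^sub>\<infinity>n. delta q r n * rqp q (int n - N) * rqp q (int n + N + e))"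

lemma delta_Suc:
  assumes "q \<noteq> 0"
  shows "delta q r (Suc n) = - r * q ^ n * (1 - q ^ n * r) * delta q r n"
proof -
  have "tri (int (Suc n)) = tri (int n) + int n"
    using tri_Suc[of "int n"] by (simp add: add.commute)
  then show ?thesis
    using assms by (simp add: delta_def qpoch_Suc power_int_add mult_ac)
qed

lemma summable_on_nat_of_int:
  fixes f :: "int \<Rightarrow> 'a :: {uniform_topological_group_add, topological_comm_monoid_add, ab_group_add, complete_uniform_space}"
  assumes "f summable_on UNIV"
  shows "(\<lambda>n. f (int n)) summable_on UNIV"
proof -
  have "f summable_on range int"
    by (rule summable_on_subset[OF assms]) auto
  then show ?thesis
    by (subst (asm) summable_on_reindex) (auto simp: o_def inj_on_def)
qed

lemma qpoch_bounded:
  assumes "norm q < 1"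
  obtains D where "D > 0" "\<And>n. norm (qpoch x q n) \<le> D"
proof -
  have "Bseq (\<lambda>n. qpoch x q n)"
    using qpoch_tendsto[OF assms] convergent_imp_Bseq convergentI by blast
  then show ?thesis
    using that by (auto simp: Bseq_def)
qed

lemma delta_abs_summable:
  assumes "nome q" "r \<noteq> 0"
  shows "(\<lambda>n. norm (delta q r n)) summable_on UNIV"
proof -
  obtain D where D: "D > 0" "\<And>n. norm (qpoch r q n) \<le> D"
    using qpoch_bounded[OF nome_norm[OF assms(1)]] by blast
  have "(\<lambda>n. D * (norm q powi tri n * norm r powi n)) summable_on UNIV"
    using assms by (intro summable_on_cmult_right summable_on_tri_real) (auto simp: nome_def)
  from summable_on_nat_of_int[OF this] show ?thesis
  proof (rule Infinite_Sum.abs_summable_on_comparison_test')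
    fix n
    have "norm (delta q r n) = norm (qpoch r q n) * (norm q powi tri (int n) * norm r powi int n)"
      by (simp add: delta_def norm_mult norm_power norm_power_int mult_ac)
    also have "\<dots> \<le> D * (norm q powi tri (int n) * norm r powi int n)"
      using D by (intro mult_right_mono) auto
    finally show "norm (delta q r n) \<le> \<dots>" .
  qed
qed

lemma summable_on_bounded_mult:
  fixes f g :: "'a \<Rightarrow> complex"
  assumes "(\<lambda>n. norm (f n)) summable_on A" "\<And>n. norm (g n) \<le> C"
  shows "(\<lambda>n. f n * g n) summable_on A"
proof (rule abs_summable_summable, rule Infinite_Sum.abs_summable_on_comparison_test')
  show "(\<lambda>n. norm (f n) * C) summable_on A"
    by (rule summable_on_cmult_left[OF assms(1)])
  show "norm (f n * g n) \<le> norm (f n) * C" for n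
    unfolding norm_mult using assms(2) by (intro mult_left_mono) auto
qed

lemma conj_bailey_summable:
  assumes "nome q" "r \<noteq> 0"
  shows "(\<lambda>n. delta q r n * rqp q (int n - N) * rqp q (int n + N + e)) summable_on UNIV"
proof -
  obtain C where C: "C > 0" "\<And>k. norm (rqp q k) \<le> C"
    using rqp_bounded[OF assms(1)] by blast
  have "(\<lambda>n. delta q r n * (rqp q (int n - N) * rqp q (int n + N + e))) summable_on UNIV"
    by (rule summable_on_bounded_mult[OF delta_abs_summable[OF assms], of _ "C * C"])
       (use C in \<open>auto simp: norm_mult intro!: mult_mono\<close>)
  then show ?thesis by (simp add: mult.assoc)
qed

lemma infsum_nat_eq_suminf:
  fixes f :: "nat \<Rightarrow> complex"
  assumes "f summable_on UNIV"
  shows "(\<Sum>\<^sub>\<infinity>n. f n) = (\<Sum>n. f n)" "summable f"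
proof -
  have "f sums (\<Sum>\<^sub>\<infinity>n. f n)"
    using assms by (intro has_sum_imp_sums) simp
  then show "(\<Sum>\<^sub>\<infinity>n. f n) = (\<Sum>n. f n)" "summable f"
    by (auto simp: sums_iff)
qed

text \<open>The recurrence is proved by telescoping; the antidifference below was found with
  Zeilberger's algorithm.\<close>

lemma conj_bailey_Suc:
  assumes "nome q" "r \<noteq> 0" "q * q powi e = r ^ 2" "N \<ge> 0" "e \<ge> 0"
  shows "conj_bailey q e r (N + 1) = - r * q powi N * conj_bailey q e r N"
proof -
  have q: "q \<noteq> 0" "norm q < 1" using assms by (auto simp: nome_def)
  define y where "y = q powi N"
  define G where "G = (\<lambda>n. - (1 + r * y) * delta q r n * rqp q (int n - 1 - N) * rqp q (int n + N + e))"
  define F where "F = (\<lambda>n. delta q r n * rqp q (int n - (N + 1)) * rqp q (int n + (N + 1) + e) +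
     r * y * (delta q r n * rqp q (int n - N) * rqp q (int n + N + e)))"
  have y: "y \<noteq> 0" using q by (simp add: y_def)
  have step: "F n = G (Suc n) - G n" for n
  proof -
    define A B d m where "A = rqp q (int n - N)" and "B = rqp q (int n + (N + 1) + e)"
      and "d = delta q r n" and "m = q ^ n"
    have 1: "rqp q (int n - (N + 1)) = (1 - m / y) * A" "rqp q (int n - 1 - N) = (1 - m / y) * A"
      using rqp_pred[OF assms(1), of "int n - N"] q
      by (simp_all add: A_def m_def y_def power_int_diff algebra_simps)
    have 2: "rqp q (int n + N + e) = (1 - m * y * r ^ 2) * B"
      using rqp_pred[OF assms(1), of "int n + (N + 1) + e"] q
      by (simp add: B_def m_def y_def power_int_add assms(3)[symmetric] mult_ac add_ac)
    have 3: "rqp q (int (Suc n) - 1 - N) = A" "rqp q (int (Suc n) + N + e) = B"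
      by (simp_all add: A_def B_def add_ac)
    have 4: "delta q r (Suc n) = - r * m * (1 - m * r) * d"
      using delta_Suc[OF q(1)] by (simp add: d_def m_def)
    have "F n = d * ((1 - m / y) * A) * B + r * y * (d * A * ((1 - m * y * r ^ 2) * B))"
      unfolding F_def 1 2 by (simp add: A_def B_def d_def)
    moreover have "G (Suc n) - G n = - (1 + r * y) * (- r * m * (1 - m * r) * d) * A * B
        + (1 + r * y) * d * ((1 - m / y) * A) * ((1 - m * y * r ^ 2) * B)"
      unfolding G_def 1 2 3 4 d_def by (simp add: algebra_simps)
    ultimately have "y * (F n - (G (Suc n) - G n)) = 0"
      using y by (simp only:) (simp add: field_simps power2_eq_square)
    then show ?thesis
      using y by simp
  qed
  obtain C where C: "C > 0" "\<And>k. norm (rqp q k) \<le> C"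
    using rqp_bounded[OF assms(1)] by blast
  have "(\<lambda>n. delta q r n * (- (1 + r * y) * (rqp q (int n - 1 - N) * rqp q (int n + N + e)))) summable_on UNIV"
    by (rule summable_on_bounded_mult[OF delta_abs_summable[OF assms(1,2)], of _ "norm (1 + r * y) * (C * C)"])
       (use C in \<open>auto simp: norm_mult norm_minus_commute simp del: minus_add_distrib intro!: mult_mono\<close>)
  then have "summable G"
    by (intro infsum_nat_eq_suminf(2)) (simp add: G_def mult_ac)
  then have G0: "G \<longlonglongrightarrow> 0"
    by (rule summable_LIMSEQ_zero)
  have "F sums (0 - G 0)"
    using telescope_sums[OF G0] by (simp add: step[symmetric])
  \<comment> \<open>Here \<open>N \<ge> 0\<close> matters: the first reciprocal in
    \<open>G 0\<close> has the negative index \<open>- 1 - N\<close>.\<close>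
  moreover have "G 0 = 0"
    using assms by (simp add: G_def rqp_def)
  ultimately have "F sums 0" by simp
  moreover have "(\<lambda>n. r * y * (delta q r n * rqp q (int n - N) * rqp q (int n + N + e))) summable_on UNIV"
    by (intro summable_on_cmult_right conj_bailey_summable assms)
  with conj_bailey_summable[OF assms(1,2), of "N + 1" e]
  have "F summable_on UNIV" "(\<Sum>\<^sub>\<infinity>n. F n) = conj_bailey q e r (N + 1) + r * y * conj_bailey q e r N"
    unfolding F_def by (auto intro!: summable_on_add simp: infsum_add infsum_cmult_right' conj_bailey_def)
  ultimately have "conj_bailey q e r (N + 1) + r * y * conj_bailey q e r N = 0"
    using infsum_nat_eq_suminf(1)[of F] by (simp add: sums_iff)
  then show ?thesis
    by (simp add: y_def eq_neg_iff_add_eq_0)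
qed

text \<open>\<open>M\<close> steps of the recurrence and an index shift express the sum through the series \<open>a M\<close>,
  of which only the term \<open>k = 0\<close> survives as \<open>M\<close> tends to infinity.\<close>

lemma conj_bailey_0:
  assumes "nome q" "r \<noteq> 0" "q * q powi e = r ^ 2" "e \<ge> 0"
  shows "conj_bailey q e r 0 = qpoch_inf r q / qpoch_inf q q"
proof -
  have q: "q \<noteq> 0" "norm q < 1" using assms by (auto simp: nome_def)
  have rec: "conj_bailey q e r (int M) = (- r) ^ M * q powi tri (int M) * conj_bailey q e r 0" for M
  proof (induction M)
    case (Suc M)
    have "conj_bailey q e r (int (Suc M)) = - r * q powi int M * conj_bailey q e r (int M)"
      using conj_bailey_Suc[OF assms(1-3), of "int M"] assms(4) by (simp add: add.commute)
    moreover have "tri (int (Suc M)) = tri (int M) + int M"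
      using tri_Suc[of "int M"] by (simp add: add.commute)
    ultimately show ?case
      using q by (simp add: Suc power_int_add mult_ac)
  qed auto
  obtain C where C: "C > 0" "\<And>k. norm (rqp q k) \<le> C"
    using rqp_bounded[OF assms(1)] by blast
  obtain D where D: "D > 0" "\<And>n. norm (qpoch r q n) \<le> D"
    using qpoch_bounded[OF q(2)] by blast
  define a where "a = (\<lambda>M k. qpoch r q (M + k) * (- r) ^ k * q powi tri (int k) * q ^ (M * k) *
     rqp q (int k) * rqp q (2 * int M + int k + e))"
  have a_sum: "conj_bailey q e r 0 = (\<Sum>k. a M k)" for M
  proof -
    define u where "u = (- r) ^ M * q powi tri (int M)"
    have u: "u \<noteq> 0" using q assms by (simp add: u_def)
    define f where "f = (\<lambda>n. delta q r n * rqp q (int n - int M) * rqp q (int n + int M + e))"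
    have f: "f summable_on UNIV"
      unfolding f_def by (rule conj_bailey_summable[OF assms(1,2)])
    have "(\<Sum>n. f n) = u * conj_bailey q e r 0"
      using rec[of M] infsum_nat_eq_suminf[OF f] by (simp add: conj_bailey_def f_def u_def)
    moreover have "(\<Sum>n. f n) = (\<Sum>k. f (k + M)) + (\<Sum>n<M. f n)"
      by (rule suminf_split_initial_segment[OF infsum_nat_eq_suminf(2)[OF f]])
    moreover have "(\<Sum>n<M. f n) = 0"
      by (intro sum.neutral) (auto simp: f_def rqp_def)
    moreover have "f (k + M) = u * a M k" for k
    proof -
      have "tri (int (k + M)) = tri (int M) + tri (int k) + int (M * k)"
        using tri_add[of "int M" "int k"] by (simp add: add.commute)
      then have "q powi tri (int (k + M)) = q powi tri (int M) * q powi tri (int k) * q ^ (M * k)"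
        using q power_int_of_nat[of q "M * k"] by (simp only: power_int_add simp_thms)
      moreover have "int (k + M) - int M = int k" "int (k + M) + int M + e = 2 * int M + int k + e"
        by auto
      ultimately show ?thesis
        unfolding f_def a_def u_def delta_def using q
        by (simp only:) (simp add: power_add mult_ac add.commute)
    qed
    moreover have "summable (\<lambda>k. f (k + M))"
      using infsum_nat_eq_suminf(2)[OF f] by (simp add: summable_iff_shift)
    ultimately have "u * conj_bailey q e r 0 = u * (\<Sum>k. a M k)"
      using u by (simp add: suminf_mult2[of "\<lambda>k. a M k" u] summable_cmult_iff suminf_mult)
    then show "conj_bailey q e r 0 = (\<Sum>k. a M k)"
      using u by simp
  qed
  define b where "b = (\<lambda>k :: nat. if k = 0 then qpoch_inf r q * (1 / qpoch_inf q q) else (0 :: complex))"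
  have "(\<lambda>M. \<Sum>k. a M k) \<longlonglongrightarrow> (\<Sum>k. b k)"
  proof (intro conjunct2[OF conjunct2[OF tannerys_theorem]])
    fix k :: nat
    have rq: "(\<lambda>M. rqp q (2 * int M + int k + e)) \<longlonglongrightarrow> 1 / qpoch_inf q q"
      using LIMSEQ_subseq_LIMSEQ[OF rqp_tendsto[OF assms(1), of "int k + e"], of "\<lambda>M. 2 * M"]
      by (auto simp: strict_mono_def o_def add.assoc)
    have qr: "(\<lambda>M. qpoch r q (M + k)) \<longlonglongrightarrow> qpoch_inf r q"
      using LIMSEQ_ignore_initial_segment[OF qpoch_tendsto[OF q(2)]] .
    show "(\<lambda>M. a M k) \<longlonglongrightarrow> b k"
    proof (cases "k = 0")
      case True
      have "(\<lambda>M. qpoch r q (M + k) * rqp q (2 * int M + int k + e)) \<longlonglongrightarrow> qpoch_inf r q * (1 / qpoch_inf q q)"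
        by (intro tendsto_mult qr rq)
      moreover have "rqp q 0 = 1"
        by (simp add: rqp_def)
      ultimately show ?thesis
        using True by (simp add: a_def b_def)
    next
      case False
      have "(\<lambda>M. (q ^ k) ^ M) \<longlonglongrightarrow> 0"
        using q False by (intro LIMSEQ_power_zero) (simp add: norm_power power_less_one_iff)
      then have "(\<lambda>M. q ^ (M * k)) \<longlonglongrightarrow> 0"
        by (simp add: power_mult[symmetric] mult.commute)
      then have "(\<lambda>M. a M k) \<longlonglongrightarrow> qpoch_inf r q * (- r) ^ k * q powi tri (int k) * 0 * rqp q (int k) * (1 / qpoch_inf q q)"
        unfolding a_def by (intro tendsto_mult tendsto_const qr rq)
      then show ?thesis
        using False by (simp add: b_def)
    qed
  next
    have "norm (a M k) \<le> D * C * C * (norm q powi tri (int k) * norm r powi int k)" for M k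
    proof -
      have "norm (a M k) = norm (qpoch r q (M + k)) * norm (rqp q (int k)) * norm (rqp q (2 * int M + int k + e)) *
          (norm q powi tri (int k) * norm r ^ k) * norm q ^ (M * k)"
        by (simp add: a_def norm_mult norm_power norm_power_int mult_ac)
      also have "\<dots> \<le> D * C * C * (norm q powi tri (int k) * norm r ^ k) * 1"
        using C D q by (intro mult_mono) (auto intro!: power_le_one)
      finally show ?thesis by simp
    qed
    then show "\<forall>\<^sub>F (k, M) in sequentially \<times>\<^sub>F sequentially. norm (a M k) \<le> D * C * C * (norm q powi tri (int k) * norm r powi int k)"
      by (auto simp: case_prod_unfold)
    have "(\<lambda>n. D * C * C * (norm q powi tri n * norm r powi n)) summable_on UNIV"
      using q assms by (intro summable_on_cmult_right summable_on_tri_real) auto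
    from summable_on_nat_of_int[OF this]
    show "summable (\<lambda>k. D * C * C * (norm q powi tri (int k) * norm r powi int k))"
      by (rule summable_on_imp_summable)
  qed auto
  then have "(\<lambda>M :: nat. conj_bailey q e r 0) \<longlonglongrightarrow> (\<Sum>k. b k)"
    using a_sum by simp
  then have "conj_bailey q e r 0 = (\<Sum>k. b k)"
    by (simp add: LIMSEQ_const_iff)
  also have "\<dots> = b 0"
    using suminf_finite[of "{0}" b] by (simp add: b_def)
  finally show ?thesis by (simp add: b_def)
qed

lemma conj_bailey_eq:
  assumes "nome q" "e = 0 \<and> r ^ 2 = q \<or> e = 1 \<and> r = - q"
  shows "conj_bailey q e r N = (- r) powi N * q powi tri N * (qpoch_inf r q / qpoch_inf q q)"
proof -
  have q: "q \<noteq> 0" "norm q < 1" using assms by (auto simp: nome_def)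
  have r: "r \<noteq> 0" "q * q powi e = r ^ 2" "e \<ge> 0"
    using assms q by (auto simp: power2_eq_square)
  have pos: "conj_bailey q e r (int M) = (- r) powi int M * q powi tri (int M) * (qpoch_inf r q / qpoch_inf q q)" for M
  proof (induction M)
    case (Suc M)
    have "conj_bailey q e r (int (Suc M)) = - r * q powi int M * conj_bailey q e r (int M)"
      using conj_bailey_Suc[OF assms(1) r(1,2), of "int M"] r by (simp add: add.commute)
    moreover have "tri (int (Suc M)) = tri (int M) + int M"
      using tri_Suc[of "int M"] by (simp add: add.commute)
    ultimately show ?case
      using q by (simp add: Suc power_int_add mult_ac)
  qed (use conj_bailey_0[OF assms(1) r] in simp)
  show ?thesis
  proof (cases "N \<ge> 0")
    case True
    then show ?thesis using pos[of "nat N"] by simp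
  next
    case False
    have "conj_bailey q e r N = conj_bailey q e r (- N - e)"
      unfolding conj_bailey_def by (intro infsum_cong) (simp add: algebra_simps)
    also have "\<dots> = (- r) powi (- N - e) * q powi tri (- N - e) * (qpoch_inf r q / qpoch_inf q q)"
      using pos[of "nat (- N - e)"] False assms(2) by auto
    also have "(- r) powi (- N - e) * q powi tri (- N - e) = (- r) powi N * q powi tri N"
      using assms(2)
    proof (elim disjE conjE)
      assume e: "e = 0" "r ^ 2 = q"
      have "(- r) powi N * (- r) powi N = q powi N"
        using e by (simp flip: power_int_mult_distrib add: power2_eq_square)
      then have "(- r) powi (- N) * q powi N = (- r) powi N"
        using r by (simp add: power_int_minus field_simps)
      then show ?thesis
        using e q by (simp add: tri_uminus power_int_add mult_ac)
    next
      assume e: "e = 1" "r = - q"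
      have "tri (- (N + 1)) = tri N + N + (N + 1)"
        unfolding tri_uminus tri_Suc by simp
      then have "q powi (- N - 1) * q powi tri (- N - 1) = q powi N * q powi tri N"
        using q by (simp flip: power_int_add)
      then show ?thesis
        using e q by simp
    qed
    finally show ?thesis .
  qed
qed

text \<open>Exchange the sums over \<open>n\<close> and \<open>N\<close>: the inner sum becomes
  \<open>conj_bailey\<close>. As \<open>rqp\<close> is bounded, the double series is dominated by a
  product of two absolutely convergent series. The squares in the result come from
  \<open>N * N = tri (N + 1) + tri N\<close>.\<close>

lemma bailey_transform:
  assumes "nome q" "e = 0 \<and> r ^ 2 = q \<or> e = 1 \<and> r = - q"
    and f: "(\<lambda>N. q powi tri (N + 1) * f N) summable_on UNIV"
  shows "(\<Sum>n. delta q r n * (\<Sum>\<^sub>\<infinity>N. jtc q e n N * f N)) =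
    qpoch_inf r q / qpoch_inf q q * (\<Sum>\<^sub>\<infinity>N. r powi N * q powi (N * N) * f N)"
proof -
  have q: "q \<noteq> 0" "norm q < 1" using assms by (auto simp: nome_def)
  have r: "r \<noteq> 0" using assms q by auto
  obtain C where C: "C > 0" "\<And>k. norm (rqp q k) \<le> C"
    using rqp_bounded[OF assms(1)] by blast
  define c where "c = (\<lambda>N. (- 1) powi N * q powi tri (N + 1) * f N)"
  define F where "F = (\<lambda>n N. delta q r n * (jtc q e n N * f N))"
  have F: "F n N = c N * (delta q r n * rqp q (int n - N) * rqp q (int n + N + e))" for n N
    by (simp add: F_def c_def jtc_def)
  have summ: "(\<lambda>(n, N). F n N) summable_on UNIV \<times> UNIV"
  proof (rule abs_summable_summable)
    have "(\<lambda>N. norm (q powi tri (N + 1) * f N)) summable_on UNIV"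
      by (rule summable_on_iff_abs_summable_on_complex[THEN iffD1, OF f])
    then have cs: "(\<lambda>N. norm (c N)) summable_on UNIV"
      by (simp add: c_def norm_mult)
    have "(\<lambda>n. C * C * norm (delta q r n) * (\<Sum>\<^sub>\<infinity>N. norm (c N))) summable_on UNIV"
      using delta_abs_summable[OF assms(1) r] by (intro summable_on_cmult_left summable_on_cmult_right)
    then have "(\<lambda>(n, N). C * C * norm (delta q r n) * norm (c N)) summable_on UNIV \<times> UNIV"
      using cs C by (intro summable_on_SigmaI[where g = "\<lambda>n. C * C * norm (delta q r n) * (\<Sum>\<^sub>\<infinity>N. norm (c N))"])
        (auto intro!: has_sum_cmult_right)
    then show "(\<lambda>p. norm (case p of (n, N) \<Rightarrow> F n N)) summable_on UNIV \<times> UNIV"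
    proof (rule Infinite_Sum.abs_summable_on_comparison_test')
      fix p :: "nat \<times> int"
      obtain n N where p: "p = (n, N)" by fastforce
      have "norm (F n N) = norm (rqp q (int n - N)) * norm (rqp q (int n + N + e)) * norm (delta q r n) * norm (c N)"
        by (simp add: F norm_mult mult_ac)
      also have "\<dots> \<le> C * C * norm (delta q r n) * norm (c N)"
        using C by (intro mult_mono mult_right_mono) auto
      finally show "norm (case p of (n, N) \<Rightarrow> F n N) \<le> (case p of (n, N) \<Rightarrow> C * C * norm (delta q r n) * norm (c N))"
        by (simp add: p)
    qed
  qed
  have "(\<Sum>n. delta q r n * (\<Sum>\<^sub>\<infinity>N. jtc q e n N * f N)) = (\<Sum>n. \<Sum>\<^sub>\<infinity>N. F n N)"
    unfolding F_def by (simp add: infsum_cmult_right')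
  also have "\<dots> = (\<Sum>\<^sub>\<infinity>n. \<Sum>\<^sub>\<infinity>N. F n N)"
    using summable_on_Sigma_banach[OF summ] by (intro infsum_nat_eq_suminf(1)[symmetric]) auto
  also have "\<dots> = (\<Sum>\<^sub>\<infinity>N. \<Sum>\<^sub>\<infinity>n. F n N)"
    by (rule infsum_swap_banach[OF summ])
  also have "\<dots> = (\<Sum>\<^sub>\<infinity>N. c N * conj_bailey q e r N)"
    unfolding F conj_bailey_def by (simp add: infsum_cmult_right')
  also have "\<dots> = (\<Sum>\<^sub>\<infinity>N. (qpoch_inf r q / qpoch_inf q q) * (r powi N * q powi (N * N) * f N))"
  proof (rule infsum_cong)
    fix N
    have "N * N = tri (N + 1) + tri N"
      unfolding tri_Suc using two_tri[of N] by (simp add: algebra_simps)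
    then have "q powi (N * N) = q powi tri (N + 1) * q powi tri N"
      using q by (simp add: power_int_add)
    moreover have "(- r) powi N = (- 1) powi N * r powi N"
      using power_int_mult_distrib[of "- 1 :: complex" r N] by simp
    moreover have "(- 1 :: complex) powi N * (- 1) powi N = 1"
      by (simp flip: power_int_mult_distrib)
    ultimately show "c N * conj_bailey q e r N = (qpoch_inf r q / qpoch_inf q q) * (r powi N * q powi (N * N) * f N)"
      unfolding conj_bailey_eq[OF assms(1,2)] c_def by (simp add: mult_ac)
  qed
  also have "\<dots> = qpoch_inf r q / qpoch_inf q q * (\<Sum>\<^sub>\<infinity>N. r powi N * q powi (N * N) * f N)"
    by (rule infsum_cmult_right')
  finally show ?thesis .
qed

section \<open>The mock theta functions as Hecke-type sums\<close>

definition hecke_series :: "complex \<Rightarrow> complex \<Rightarrow> complex" where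
  "hecke_series x q = (\<Sum>\<^sub>\<infinity>N. q powi (N * N) * x powi N * hecke q N)"

lemma square_eq_tri: "N * N = 2 * tri N + N"
  using two_tri[of N] by (simp add: algebra_simps)

lemma powi_square:
  fixes q :: complex
  assumes "q \<noteq> 0"
  shows "q powi (N * N) = (q ^ 2) powi tri N * q powi N"
proof -
  have "(q ^ 2) powi tri N = q powi (2 * tri N)"
    using power_int_mult[of q 2 "tri N"] by simp
  then show ?thesis
    using assms by (simp add: square_eq_tri power_int_add)
qed

lemma hecke_series_summable:
  assumes "nome q" "x \<noteq> 0"
  shows "(\<lambda>N. q powi (N * N) * x powi N * hecke q (N + a)) summable_on UNIV"
proof -
  have q: "q \<noteq> 0" "norm q < 1" using assms by (auto simp: nome_def)
  have "(\<lambda>N. (q ^ 2) powi tri N * (q * x) powi N * hecke q (N + a)) summable_on UNIV"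
    using assms q by (intro summable_on_tri_hecke nome_power) auto
  then show ?thesis
    by (simp add: powi_square[OF q(1)] power_int_mult_distrib mult_ac)
qed

lemma tri_hecke_summable:
  assumes "nome q"
  shows "(\<lambda>N. q powi tri (N + 1) * hecke q (N + a)) summable_on UNIV"
proof -
  have q: "q \<noteq> 0" "norm q < 1" using assms by (auto simp: nome_def)
  have "(\<lambda>N. q powi tri N * q powi N * hecke q (N + a)) summable_on UNIV"
    using assms q by (intro summable_on_tri_hecke) auto
  then show ?thesis
    using q by (simp add: tri_Suc power_int_add)
qed

lemma choose_2_eq_tri: "int (n choose 2) = tri (int n)"
proof (induction n)
  case (Suc n)
  have "int (Suc n choose 2) = int n + int (n choose 2)"
    using binomial_Suc_Suc[of n 1] by (simp add: numeral_2_eq_2)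
  then show ?case
    using Suc tri_Suc[of "int n"] by (simp add: add.commute)
qed simp

lemma power_choose_2: "q ^ (n choose 2) = q powi tri (int n)"
  using power_int_of_nat[of q "n choose 2"] by (simp add: choose_2_eq_tri)

lemma qpoch_mult_neg: "qpoch x p n * qpoch (- x) p n = qpoch (x ^ 2) (p ^ 2) n"
  by (induction n) (auto simp: qpoch_Suc algebra_simps power2_eq_square power_mult_distrib)

lemma qpoch_odd_split: "qpoch q q (2 * n + 1) = qpoch q (q ^ 2) (n + 1) * qpoch (q ^ 2) (q ^ 2) n"
proof -
  have "qpoch q q (2 * n) = qpoch q (q ^ 2) n * qpoch (q ^ 2) (q ^ 2) n"
    using qpoch_section[of q q 2 n] by (simp add: numeral_2_eq_2 power2_eq_square)
  moreover have "q ^ (2 * n) = (q ^ 2) ^ n"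
    by (rule power_mult)
  ultimately show ?thesis
    by (simp only: Suc_eq_plus1[symmetric] qpoch_Suc) (simp only: mult_ac)
qed

text \<open>For \<open>r = - q\<close> the weight contains \<open>qpoch (- q) q n\<close>, which
  multiplies \<open>qpoch q q n\<close> to \<open>qpoch (q ^ 2) (q ^ 2) n\<close>, the even part of
  \<open>qpoch q q (2 * n + 1)\<close>. The odd part is the denominator of phi.\<close>

lemma delta_phi:
  assumes "nome q"
  shows "delta q (- q) n * (qpoch q q n / qpoch q q (2 * n + 1)) = q ^ ((n + 1) choose 2) / qpoch q (q ^ 2) (n + 1)"
proof -
  have q: "q \<noteq> 0" using assms by (rule nome_nonzero)
  have "qpoch (q ^ 2) (q ^ 2) n \<noteq> 0"
    by (rule qpoch_self_nonzero) (use assms in \<open>auto intro: nome_power\<close>)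
  moreover have "qpoch q q n * qpoch (- q) q n = qpoch (q ^ 2) (q ^ 2) n"
    by (rule qpoch_mult_neg)
  moreover have "q ^ ((n + 1) choose 2) = q ^ n * q powi tri (int n)"
  proof -
    have "tri (int (n + 1)) = int n + tri (int n)"
      using tri_Suc[of "int n"] by (simp add: add.commute)
    then show ?thesis
      unfolding power_choose_2 using q by (simp only: power_int_add power_int_of_nat simp_thms)
  qed
  moreover have "delta q (- q) n * (qpoch q q n / qpoch q q (2 * n + 1)) =
      (qpoch q q n * qpoch (- q) q n) * (q ^ n * q powi tri (int n)) / (qpoch q (q ^ 2) (n + 1) * qpoch (q ^ 2) (q ^ 2) n)"
    unfolding delta_def qpoch_odd_split by (simp add: mult_ac)
  ultimately show ?thesis
    by (simp only:) simp
qed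

theorem mock_phi_hecke:
  assumes "nome q"
  shows "mock_phi q = qpoch_inf (- q) q / qpoch_inf q q * hecke_series (- q) q"
proof -
  have "mock_phi q = (\<Sum>n. delta q (- q) n * (\<Sum>\<^sub>\<infinity>N. jtc q 1 n N * hecke q N))"
    unfolding mock_phi_def delta_phi[OF assms, symmetric] bsum_e1_0[OF assms, symmetric]
    by (simp add: bsum_def)
  also have "\<dots> = qpoch_inf (- q) q / qpoch_inf q q * hecke_series (- q) q"
    using bailey_transform[OF assms, of 1 "- q" "hecke q"] tri_hecke_summable[OF assms, of 0]
    by (simp add: hecke_series_def mult_ac)
  finally show ?thesis .
qed

text \<open>The terms of psi are those of phi times \<open>q ^ (n + 1)\<close>, and this is the
  factor that the shift \<open>a = -1\<close> puts into \<open>bsum\<close>. Moving the shift from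
  the Hecke coefficient to the index \<open>N\<close> produces \<open>- (q ^ 2)\<close> and the
  argument \<open>- (q ^ 3)\<close>.\<close>

theorem mock_psi_hecke:
  assumes "nome q"
  shows "mock_psi q = - (q ^ 2) * (qpoch_inf (- q) q / qpoch_inf q q) * hecke_series (- (q ^ 3)) q"
proof -
  have q: "q \<noteq> 0" using assms by (rule nome_nonzero)
  have "q ^ ((n + 2) choose 2) / qpoch q (q ^ 2) (n + 1) = delta q (- q) n * bsum q 1 n (- 1)" for n
  proof -
    have "q ^ ((n + 2) choose 2) = q ^ (n + 1) * q ^ ((n + 1) choose 2)"
      using binomial_Suc_Suc[of "Suc n" 1] by (simp add: numeral_2_eq_2 power_add)
    then have "q ^ ((n + 2) choose 2) / qpoch q (q ^ 2) (n + 1) =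
        q ^ (n + 1) * (q ^ ((n + 1) choose 2) / qpoch q (q ^ 2) (n + 1))"
      by simp
    then show ?thesis
      unfolding delta_phi[OF assms, symmetric] bsum_e1_minus_1[OF assms] by (simp add: mult_ac)
  qed
  then have "mock_psi q = (\<Sum>n. delta q (- q) n * (\<Sum>\<^sub>\<infinity>N. jtc q 1 n N * hecke q (N + (- 1))))"
    by (simp add: mock_psi_def bsum_def)
  also have "\<dots> = qpoch_inf (- q) q / qpoch_inf q q * (\<Sum>\<^sub>\<infinity>N. (- q) powi N * q powi (N * N) * hecke q (N + (- 1)))"
    using bailey_transform[OF assms, of 1 "- q" "\<lambda>N. hecke q (N + (- 1))"] tri_hecke_summable[OF assms, of "-1"]
    by simp
  also have "(\<Sum>\<^sub>\<infinity>N. (- q) powi N * q powi (N * N) * hecke q (N + (- 1))) =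
      (\<Sum>\<^sub>\<infinity>N. (- q) powi (N + 1) * q powi ((N + 1) * (N + 1)) * hecke q ((N + 1) + (- 1)))"
    by (rule infsum_int_shift[symmetric])
  also have "\<dots> = (\<Sum>\<^sub>\<infinity>N. - (q ^ 2) * (q powi (N * N) * (- (q ^ 3)) powi N * hecke q N))"
  proof (rule infsum_cong)
    fix N :: int
    have "(N + 1) * (N + 1) = N * N + (N + N + 1)"
      by (simp add: algebra_simps)
    then have "q powi ((N + 1) * (N + 1)) = q powi (N * N) * (q powi N * q powi N * q)"
      using q by (simp only: power_int_add power_int_1_right simp_thms)
    moreover have "(- q) powi (N + 1) = - q * (- q) powi N"
      using q by (simp add: power_int_add)
    moreover have "(- (q ^ 3)) powi N = (- q) powi N * (q powi N * q powi N)"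
    proof -
      have "- (q ^ 3) = - q * (q * q)"
        by (simp add: power3_eq_cube mult.assoc)
      then show ?thesis
        by (simp only: power_int_mult_distrib)
    qed
    ultimately show "(- q) powi (N + 1) * q powi ((N + 1) * (N + 1)) * hecke q (N + 1 + - 1) =
        - (q ^ 2) * (q powi (N * N) * (- (q ^ 3)) powi N * hecke q N)"
      by (simp add: power2_eq_square mult_ac)
  qed
  also have "\<dots> = - (q ^ 2) * hecke_series (- (q ^ 3)) q"
    unfolding hecke_series_def by (rule infsum_cmult_right')
  finally show ?thesis by (simp add: mult_ac)
qed

text \<open>The Bailey transform is used in base \<open>q ^ 2\<close> with \<open>e = 0\<close>,
  where \<open>r = q\<close> is the required square root of the base.\<close>

theorem mock_X_hecke:
  assumes "nome q"
  shows "mock_X q = qpoch_inf q (q ^ 2) / qpoch_inf (q ^ 2) (q ^ 2) * hecke_series q (q ^ 2)"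
proof -
  have q: "q \<noteq> 0" using assms by (rule nome_nonzero)
  have q2: "nome (q ^ 2)" using assms by (auto intro: nome_power)
  have "(- 1) ^ n * q ^ (n ^ 2) / qpoch (- q) q (2 * n) = delta (q ^ 2) q n * bsum (q ^ 2) 0 n 0" for n
  proof -
    have b: "bsum (q ^ 2) 0 n 0 = qpoch (q ^ 2) (q ^ 2) n / qpoch (q ^ 2) (q ^ 2) (2 * n)"
      using bsum_0[OF q2, of n] qpoch_self_nonzero[OF q2, of "2 * n"] by (simp add: field_simps)
    have "q ^ (n ^ 2) = q powi (int n * int n)"
      using power_int_of_nat[of q "n * n"] by (simp add: power2_eq_square)
    also have "\<dots> = (q ^ 2) powi tri (int n) * q ^ n"
      using powi_square[OF q, of "int n"] by simp
    finally have e: "q ^ (n ^ 2) = (q ^ 2) powi tri (int n) * q ^ n" .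
    have "qpoch q (q ^ 2) n * qpoch (q ^ 2) (q ^ 2) n = qpoch q q (2 * n)"
      using qpoch_section[of q q 2 n] by (simp add: numeral_2_eq_2 power2_eq_square)
    moreover have "qpoch q q (2 * n) * qpoch (- q) q (2 * n) = qpoch (q ^ 2) (q ^ 2) (2 * n)"
      by (rule qpoch_mult_neg)
    moreover have "qpoch (q ^ 2) (q ^ 2) (2 * n) \<noteq> 0"
      by (rule qpoch_self_nonzero[OF q2])
    moreover from calculation have "qpoch (- q) q (2 * n) \<noteq> 0"
      by auto
    ultimately have "qpoch q (q ^ 2) n * (qpoch (q ^ 2) (q ^ 2) n / qpoch (q ^ 2) (q ^ 2) (2 * n)) = 1 / qpoch (- q) q (2 * n)"
      by (auto simp: field_simps)
    then have "(- 1) ^ n * q ^ (n ^ 2) / qpoch (- q) q (2 * n) =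
        (- 1) ^ n * q ^ (n ^ 2) * (qpoch q (q ^ 2) n * (qpoch (q ^ 2) (q ^ 2) n / qpoch (q ^ 2) (q ^ 2) (2 * n)))"
      by simp
    also have "\<dots> = delta (q ^ 2) q n * bsum (q ^ 2) 0 n 0"
      unfolding b e delta_def by (simp add: power_minus[of q n] mult_ac)
    finally show ?thesis .
  qed
  then have "mock_X q = (\<Sum>n. delta (q ^ 2) q n * (\<Sum>\<^sub>\<infinity>N. jtc (q ^ 2) 0 n N * hecke (q ^ 2) N))"
    by (simp add: mock_X_def bsum_def)
  also have "\<dots> = qpoch_inf q (q ^ 2) / qpoch_inf (q ^ 2) (q ^ 2) * hecke_series q (q ^ 2)"
    using bailey_transform[OF q2, of 0 q "hecke (q ^ 2)"] tri_hecke_summable[OF q2, of 0]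
    by (simp add: hecke_series_def mult_ac)
  finally show ?thesis .
qed

section \<open>Functional equations of the Hecke-type series\<close>

lemma jtheta_gauss_series:
  assumes "nome q" "x \<noteq> 0"
  shows "((\<lambda>N. q powi (N * N) * x powi N) has_sum jtheta (- q * x) (q ^ 2)) UNIV"
proof -
  have q: "q \<noteq> 0" using assms by (auto simp: nome_def)
  have "(- 1) powi N * (q ^ 2) powi tri N * (- q * x) powi N = q powi (N * N) * x powi N" for N
  proof -
    have "(- q * x) powi N = (- 1) powi N * (q powi N * x powi N)"
      using power_int_mult_distrib[of "- 1 :: complex" "q * x" N] by (simp add: power_int_mult_distrib)
    moreover have "(- 1 :: complex) powi N * (- 1) powi N = 1"
      by (simp flip: power_int_mult_distrib)
    ultimately show ?thesis
      by (simp add: powi_square[OF q] mult_ac)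
  qed
  then show ?thesis
    using jtheta_has_sum[of "q ^ 2" "- q * x"] assms q by (simp add: nome_power)
qed

text \<open>Origin of the factor \<open>q ^ 5\<close>: the index shift by 2 contributes
  \<open>4 * N + 4\<close> to the exponent and the Hecke recurrence contributes
  \<open>N + 1\<close>, together \<open>5 * N + 5\<close>. The constant 2 of the recurrence becomes
  the theta function.\<close>

lemma hecke_series_shift:
  assumes "nome q" "x \<noteq> 0"
  shows "hecke_series x q = q ^ 5 * x ^ 2 * hecke_series (q ^ 5 * x) q + 2 * jtheta (- q * x) (q ^ 2)"
proof -
  have q: "q \<noteq> 0" using assms by (auto simp: nome_def)
  have "hecke_series x q = (\<Sum>\<^sub>\<infinity>N. q powi ((N + 2) * (N + 2)) * x powi (N + 2) * hecke q (N + 2))"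
    unfolding hecke_series_def by (rule infsum_int_shift[symmetric])
  also have "\<dots> = (\<Sum>\<^sub>\<infinity>N. q ^ 5 * x ^ 2 * (q powi (N * N) * (q ^ 5 * x) powi N * hecke q N) +
       2 * (q powi ((N + 2) * (N + 2)) * x powi (N + 2)))"
  proof (rule infsum_cong)
    fix N :: int
    have "(N + 2) * (N + 2) + (N + 1) = N * N + (5 * N + 5)"
      by (simp add: algebra_simps)
    then have "q powi ((N + 2) * (N + 2)) * q powi (N + 1) = q powi (N * N) * (q powi (5 * N) * q powi 5)"
      using q by (simp only: power_int_add[symmetric] simp_thms)
    moreover have "q powi (5 * N) = (q ^ 5) powi N"
      using power_int_mult[of q 5 N] by simp
    ultimately have "q powi ((N + 2) * (N + 2)) * q powi (N + 1) = q powi (N * N) * ((q ^ 5) powi N * q ^ 5)"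
      by simp
    then have "q powi ((N + 2) * (N + 2)) * x powi (N + 2) * (q powi (N + 1) * hecke q N) =
        (q powi (N * N) * ((q ^ 5) powi N * q ^ 5)) * x powi (N + 2) * hecke q N"
      by (simp add: mult_ac)
    moreover have "x powi (N + 2) = x powi N * x ^ 2"
      using assms by (simp add: power_int_add)
    ultimately show "q powi ((N + 2) * (N + 2)) * x powi (N + 2) * hecke q (N + 2) =
       q ^ 5 * x ^ 2 * (q powi (N * N) * (q ^ 5 * x) powi N * hecke q N) +
       2 * (q powi ((N + 2) * (N + 2)) * x powi (N + 2))"
      unfolding hecke_add_2[OF q] by (simp add: power_int_mult_distrib algebra_simps)
  qed
  also have "\<dots> = q ^ 5 * x ^ 2 * hecke_series (q ^ 5 * x) q +
      2 * (\<Sum>\<^sub>\<infinity>N. q powi ((N + 2) * (N + 2)) * x powi (N + 2))"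
    unfolding hecke_series_def
    using hecke_series_summable[OF assms(1), of "q ^ 5 * x" 0] assms q
      jtheta_gauss_series[OF assms]
      summable_on_int_shift_iff[of "\<lambda>N. q powi (N * N) * x powi N" 2]
    by (subst infsum_add; (intro summable_on_cmult_right)?)
       (auto simp: infsum_cmult_right' has_sum_imp_summable)
  also have "(\<Sum>\<^sub>\<infinity>N. q powi ((N + 2) * (N + 2)) * x powi (N + 2)) = (\<Sum>\<^sub>\<infinity>N. q powi (N * N) * x powi N)"
    by (rule infsum_int_shift)
  also have "\<dots> = jtheta (- q * x) (q ^ 2)"
    using jtheta_gauss_series[OF assms] by (rule infsumI)
  finally show ?thesis .
qed

lemma hecke_series_inverse:
  assumes "nome q" "x \<noteq> 0"
  shows "hecke_series (1 / x) q = 2 * jtheta (- q * x) (q ^ 2) - hecke_series x q"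
proof -
  have "hecke_series (1 / x) q = (\<Sum>\<^sub>\<infinity>N. q powi (- N * - N) * (1 / x) powi (- N) * hecke q (- N))"
    unfolding hecke_series_def by (rule infsum_int_uminus[symmetric])
  also have "\<dots> = (\<Sum>\<^sub>\<infinity>N. 2 * (q powi (N * N) * x powi N) - q powi (N * N) * x powi N * hecke q N)"
    unfolding hecke_uminus by (simp add: power_int_minus power_int_divide_distrib algebra_simps)
  also have "\<dots> = 2 * (\<Sum>\<^sub>\<infinity>N. q powi (N * N) * x powi N) - hecke_series x q"
    unfolding hecke_series_def
    using hecke_series_summable[OF assms, of 0] jtheta_gauss_series[OF assms]
    by (subst infsum_diff; (intro summable_on_cmult_right)?)
       (auto simp: infsum_cmult_right' has_sum_imp_summable)
  also have "(\<Sum>\<^sub>\<infinity>N. q powi (N * N) * x powi N) = jtheta (- q * x) (q ^ 2)"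
    using jtheta_gauss_series[OF assms] by (rule infsumI)
  finally show ?thesis .
qed

section \<open>Laurent series and elliptic functions on the punctured plane\<close>

lemma laurent_series_holomorphic:
  fixes a :: "int \<Rightarrow> complex"
  assumes "\<And>x. x \<noteq> 0 \<Longrightarrow> (\<lambda>n. a n * x powi n) summable_on UNIV"
  shows "(\<lambda>x. \<Sum>\<^sub>\<infinity>n. a n * x powi n) holomorphic_on (- {0})"
proof (rule holomorphic_uniform_sequence)
  define f where "f = (\<lambda>n x. \<Sum>i<n. a (int_decode i) * x powi int_decode i)"
  show "open (- {0 :: complex})" by auto
  show "(f n) holomorphic_on - {0}" for n
    unfolding f_def by (intro holomorphic_intros) auto
  fix x :: complex
  assume "x \<in> - {0}"
  then have x: "norm x > 0" by auto
  define d where "d = norm x / 2"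
  have bounds: "norm y \<le> 2 * norm x" "d \<le> norm y" "y \<noteq> 0" if "y \<in> cball x d" for y
  proof -
    have "dist x y \<le> d" using that by simp
    moreover have "norm y - norm x \<le> dist x y" "norm x - norm y \<le> dist x y"
      using norm_triangle_ineq2[of y x] norm_triangle_ineq2[of x y] by (simp_all add: dist_norm norm_minus_commute)
    ultimately show "norm y \<le> 2 * norm x" "d \<le> norm y"
      using x unfolding d_def by linarith+
    then show "y \<noteq> 0" using x by (auto simp: d_def)
  qed
  \<comment> \<open>On the closed ball, \<open>norm y\<close> lies between \<open>d\<close> and
    \<open>2 * norm x\<close>. Whatever the sign of \<open>n\<close>, its \<open>n\<close>-th power
    is at most the sum of the powers at these two radii.\<close>
  define M where "M = (\<lambda>n. norm (a n * (2 * x) powi n) + norm (a n * of_real d powi n))"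
  have M: "M summable_on UNIV"
    unfolding M_def using x
    by (intro summable_on_add summable_on_iff_abs_summable_on_complex[THEN iffD1] assms) (auto simp: d_def)
  have bound: "norm (a n * y powi n) \<le> M n" if "y \<in> cball x d" for n y
  proof -
    have "norm y powi n \<le> (2 * norm x) powi n + d powi n"
    proof (cases "n \<ge> 0")
      case True
      then have "norm y powi n \<le> (2 * norm x) powi n"
        using bounds[OF that] by (intro power_int_mono) auto
      then show ?thesis
        using x by (simp add: d_def add_increasing2)
    next
      case False
      then have "norm y powi n \<le> d powi n"
        using bounds[OF that] x by (intro power_int_antimono) (auto simp: d_def)
      then show ?thesis
        using x by (simp add: add_increasing)
    qed
    then have "norm (a n) * norm y powi n \<le> norm (a n) * ((2 * norm x) powi n + d powi n)"
      by (intro mult_left_mono) auto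
    then show ?thesis
      using x by (simp add: M_def norm_mult norm_power_int algebra_simps d_def)
  qed
  have eq: "(\<Sum>\<^sub>\<infinity>n. a n * y powi n) = (\<Sum>i. a (int_decode i) * y powi int_decode i)" if "y \<in> cball x d" for y
  proof -
    have "((\<lambda>i. a (int_decode i) * y powi int_decode i) has_sum (\<Sum>\<^sub>\<infinity>n. a n * y powi n)) UNIV"
      using has_sum_reindex_bij_betw[OF bij_int_decode, of "\<lambda>n. a n * y powi n"] assms[of y] bounds[OF that]
      by simp
    then show ?thesis
      using has_sum_imp_sums sums_unique by blast
  qed
  have "summable (\<lambda>i. M (int_decode i))"
    using M summable_on_reindex_bij_betw[OF bij_int_decode, of M] summable_on_imp_summable by blast
  then have "uniform_limit (cball x d) f (\<lambda>y. \<Sum>i. a (int_decode i) * y powi int_decode i) sequentially"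
    unfolding f_def using bound by (intro Weierstrass_m_test) auto
  then have "uniform_limit (cball x d) f (\<lambda>y. \<Sum>\<^sub>\<infinity>n. a n * y powi n) sequentially"
    using eq by (subst uniform_limit_cong'[of _ f f "\<lambda>y. \<Sum>\<^sub>\<infinity>n. a n * y powi n"]) auto
  moreover have "cball x d \<subseteq> - {0}"
    using bounds by blast
  ultimately show "\<exists>d>0. cball x d \<subseteq> - {0} \<and> uniform_limit (cball x d) f (\<lambda>y. \<Sum>\<^sub>\<infinity>n. a n * y powi n) sequentially"
    using x by (intro exI[of _ d]) (auto simp: d_def)
qed

lemma hecke_series_holomorphic:
  assumes "nome q"
  shows "(\<lambda>x. hecke_series x q) holomorphic_on (- {0})"
proof -
  have "(\<lambda>x. \<Sum>\<^sub>\<infinity>N. (q powi (N * N) * hecke q N) * x powi N) holomorphic_on (- {0})"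
    using hecke_series_summable[OF assms, of _ 0]
    by (intro laurent_series_holomorphic) (simp add: mult_ac)
  then show ?thesis
    by (simp add: hecke_series_def mult_ac)
qed

text \<open>Periodicity carries every point into the closed annulus between radius
  \<open>norm p\<close> and 1, where compactness bounds \<open>f\<close>; Liouville's theorem then
  applies to the entire function obtained by composing with \<open>exp\<close>.\<close>

lemma elliptic_constant:
  assumes hol: "f holomorphic_on (- {0})" and p: "nome p"
    and per: "\<And>x. x \<noteq> 0 \<Longrightarrow> f (p * x) = f x"
  shows "\<exists>c. \<forall>x. x \<noteq> 0 \<longrightarrow> f x = c"
proof -
  define K :: "complex set" where "K = cball 0 1 - ball 0 (norm p)"
  have p': "0 < norm p" "norm p < 1" using p by (auto simp: nome_def)
  have "compact K"
    unfolding K_def by (intro compact_diff compact_cball) auto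
  moreover have "continuous_on K f"
    using p' by (intro continuous_on_subset[OF holomorphic_on_imp_continuous_on[OF hol]]) (auto simp: K_def)
  ultimately have "bounded (f ` K)"
    using compact_continuous_image compact_imp_bounded by blast
  then obtain B where B: "\<And>x. x \<in> K \<Longrightarrow> norm (f x) \<le> B"
    by (auto simp: bounded_iff)
  have per': "f (p powi n * x) = f x" if "x \<noteq> 0" for n x
  proof -
    have nat: "f (p ^ m * x) = f x" if "x \<noteq> 0" for m x
      using that p' by (induction m) (auto simp: per mult.assoc)
    show ?thesis
    proof (cases "n \<ge> 0")
      case True
      then show ?thesis using nat[OF that, of "nat n"] by (simp add: power_int_def)
    next
      case False
      define y where "y = p powi n * x"
      have "y \<noteq> 0" "x = p ^ nat (- n) * y"
        using that p' False by (auto simp: y_def power_int_def field_simps)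
      then have "f x = f y" using nat[of y "nat (- n)"] by metis
      then show ?thesis by (simp add: y_def)
    qed
  qed
  have bnd: "norm (f x) \<le> B" if x: "x \<noteq> 0" for x
  proof -
    \<comment> \<open>The number of periods separating \<open>x\<close> from the fundamental
      annulus.\<close>
    define n where "n = \<lfloor>log (norm p) (norm x)\<rfloor>"
    have lp: "ln (norm p) < 0" using p' by simp
    have "norm p powr (real_of_int n + 1) \<le> norm p powr (log (norm p) (norm x))"
      using p' by (intro powr_mono') (auto simp: n_def)
    moreover have "norm p powr (log (norm p) (norm x)) \<le> norm p powr (real_of_int n)"
      using p' by (intro powr_mono') (auto simp: n_def)
    moreover have "norm p powr (log (norm p) (norm x)) = norm x"
      using p' x by (intro powr_log_cancel) auto
    ultimately have "norm p * norm p powi n \<le> norm x" "norm x \<le> norm p powi n"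
      using p' by (auto simp: powr_add powr_real_of_int' mult.commute)
    then have "p powi (- n) * x \<in> K"
      using p' by (auto simp: K_def norm_mult norm_divide norm_power_int power_int_minus field_simps)
    then have "norm (f (p powi (- n) * x)) \<le> B" by (rule B)
    then show ?thesis using per'[OF x, of "- n"] by simp
  qed
  have "(f \<circ> exp) holomorphic_on UNIV"
    by (rule holomorphic_on_compose_gen[OF _ hol]) (auto intro!: holomorphic_intros)
  moreover have "bounded (range (f \<circ> exp))"
    unfolding bounded_iff using bnd by (intro exI[of _ B]) auto
  ultimately have "(f \<circ> exp) constant_on UNIV"
    by (rule Liouville_theorem)
  then obtain c where c: "\<And>z. f (exp z) = c"
    by (auto simp: constant_on_def)
  have "f x = c" if "x \<noteq> 0" for x
    using c[of "Ln x"] that by simp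
  then show ?thesis by blast
qed

text \<open>Near a common zero \<open>x\<close>, both functions are divided by \<open>y - x\<close>.
  The two quotients are holomorphic, and the second does not vanish at \<open>x\<close> because the
  zero of \<open>g\<close> is simple.\<close>

lemma holomorphic_quotient_simple_zeros:
  assumes f: "f holomorphic_on S" and g: "g holomorphic_on S" and S: "open S"
    and zeros: "\<And>x. x \<in> S \<Longrightarrow> g x = 0 \<Longrightarrow> f x = 0 \<and> deriv g x \<noteq> 0"
  obtains h where "h holomorphic_on S" "\<And>x. x \<in> S \<Longrightarrow> f x = h x * g x"
proof -
  define h where "h = (\<lambda>x. if g x = 0 then deriv f x / deriv g x else f x / g x)"
  have "h holomorphic_on S"
  proof (subst holomorphic_on_open[OF S], intro ballI)
    fix x assume x: "x \<in> S"
    obtain r where r: "r > 0" "ball x r \<subseteq> S"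
      using S x open_contains_ball by blast
    show "\<exists>h'. (h has_field_derivative h') (at x)"
    proof (cases "g x = 0")
      case False
      define T where "T = {y \<in> S. g y \<noteq> 0}"
      have "continuous_on S g" using g by (rule holomorphic_on_imp_continuous_on)
      then have "open (S \<inter> g -` (- {0}))"
        using S by (intro continuous_open_preimage) auto
      also have "S \<inter> g -` (- {0}) = T"
        by (auto simp: T_def)
      finally have op: "open T" .
      have x': "x \<in> T" using False x by (simp add: T_def)
      have "(\<lambda>y. f y / g y) holomorphic_on T"
        by (intro holomorphic_on_divide holomorphic_on_subset[OF f] holomorphic_on_subset[OF g])
           (auto simp: T_def)
      then obtain h' where h': "((\<lambda>y. f y / g y) has_field_derivative h') (at x)"
        using holomorphic_on_open[OF op] x' by blast
      have "(h has_field_derivative h') (at x)"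
        by (rule has_field_derivative_transform_within_open[OF h' op x']) (auto simp: h_def T_def)
      then show ?thesis ..
    next
      case True
      define F where "F = (\<lambda>y. if y = x then deriv f x else (f y - f x) / (y - x))"
      define G where "G = (\<lambda>y. if y = x then deriv g x else (g y - g x) / (y - x))"
      have F: "F holomorphic_on ball x r" and G: "G holomorphic_on ball x r"
        unfolding F_def G_def
        by (intro pole_lemma_open holomorphic_on_subset[OF f r(2)] holomorphic_on_subset[OF g r(2)] open_ball)+
      have "G x \<noteq> 0" using zeros[OF x True] by (simp add: G_def)
      define T where "T = {y \<in> ball x r. G y \<noteq> 0}"
      have "continuous_on (ball x r) G" using G by (rule holomorphic_on_imp_continuous_on)
      then have "open (ball x r \<inter> G -` (- {0}))"
        by (intro continuous_open_preimage) auto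
      also have "ball x r \<inter> G -` (- {0}) = T"
        by (auto simp: T_def)
      finally have op: "open T" .
      have x': "x \<in> T" using \<open>G x \<noteq> 0\<close> r by (simp add: T_def)
      have "(\<lambda>y. F y / G y) holomorphic_on T"
        by (intro holomorphic_on_divide holomorphic_on_subset[OF F] holomorphic_on_subset[OF G])
           (auto simp: T_def)
      then obtain h' where h': "((\<lambda>y. F y / G y) has_field_derivative h') (at x)"
        using holomorphic_on_open[OF op] x' by blast
      have "(h has_field_derivative h') (at x)"
      proof (rule has_field_derivative_transform_within_open[OF h' op x'])
        fix y assume "y \<in> T"
        then show "F y / G y = h y"
          using zeros[OF x True] True by (auto simp: h_def F_def G_def T_def split: if_splits)
      qed
      then show ?thesis ..
    qed
  qed
  moreover have "f x = h x * g x" if "x \<in> S" for x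
    using zeros[OF that] by (auto simp: h_def)
  ultimately show ?thesis using that by blast
qed

text \<open>This is how zeros are counted: the quotient of \<open>f\<close> and \<open>g\<close> is
  elliptic without poles, hence constant. Its periodicity is clear off the zeros of
  \<open>g\<close>; these are isolated, and continuity settles them.\<close>

lemma same_multiplier_proportional:
  assumes f: "f holomorphic_on (- {0})" and g: "g holomorphic_on (- {0})" and p: "nome p"
    and fp: "\<And>x. x \<noteq> 0 \<Longrightarrow> f x = m x * f (p * x)"
    and gp: "\<And>x. x \<noteq> 0 \<Longrightarrow> g x = m x * g (p * x)"
    and zeros: "\<And>x. x \<noteq> 0 \<Longrightarrow> g x = 0 \<Longrightarrow> f x = 0 \<and> deriv g x \<noteq> 0"
  obtains c where "\<And>x. x \<noteq> 0 \<Longrightarrow> f x = c * g x"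
proof -
  obtain h where h: "h holomorphic_on (- {0})" "\<And>x. x \<in> - {0} \<Longrightarrow> f x = h x * g x"
    by (rule holomorphic_quotient_simple_zeros[OF f g]) (use zeros in auto)
  have p0: "p \<noteq> 0" using p by (rule nome_nonzero)
  have per: "h (p * x) = h x" if x: "x \<noteq> 0" for x
  proof -
    have per_nz: "h (p * y) = h y" if y: "y \<noteq> 0" "g y \<noteq> 0" for y
    proof -
      have "h y * g y = m y * (h (p * y) * g (p * y))"
        using h(2)[of y] h(2)[of "p * y"] fp[OF y(1)] y p0 by simp
      also have "\<dots> = h (p * y) * g y"
        using gp[OF y(1)] by simp
      finally show ?thesis using y by simp
    qed
    show ?thesis
    proof (cases "g x = 0")
      case False
      then show ?thesis using per_nz x by blast
    next
      case True
      have gx: "(g has_field_derivative deriv g x) (at x)"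
        using holomorphic_derivI[OF g, of x] x by auto
      have "deriv g x \<noteq> 0" using zeros x True by blast
      then have "eventually (\<lambda>y. g y \<noteq> 0) (at x)"
      proof -
        have "((\<lambda>y. (g y - g x) / (y - x)) \<longlongrightarrow> deriv g x) (at x)"
          using gx by (simp add: has_field_derivative_iff)
        then have "eventually (\<lambda>y. (g y - g x) / (y - x) \<noteq> 0) (at x)"
          by (rule tendsto_imp_eventually_ne) fact
        then show ?thesis
          by eventually_elim (use True in auto)
      qed
      moreover have "eventually (\<lambda>y. y \<noteq> 0) (at x)"
        using x by (metis eventually_neq_at_within)
      ultimately have ev: "eventually (\<lambda>y. h (p * y) = h y) (at x)"
        by eventually_elim (use per_nz in auto)
      have hc: "isCont h y" if "y \<noteq> 0" for y
        using h(1) that continuous_on_eq_continuous_at[of "- {0}" h] holomorphic_on_imp_continuous_on by auto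
      have "((\<lambda>y. h (p * y)) \<longlongrightarrow> h (p * x)) (at x)"
        using hc[of "p * x"] x p0 by (intro isCont_tendsto_compose[of _ h] tendsto_intros) auto
      moreover have "(h \<longlongrightarrow> h x) (at x)"
        using hc[OF x] by (simp add: isCont_def)
      ultimately show ?thesis
        using tendsto_unique[OF trivial_limit_at] tendsto_cong[OF ev] by blast
    qed
  qed
  obtain c where "\<And>x. x \<noteq> 0 \<Longrightarrow> h x = c"
    using elliptic_constant[OF h(1) p per] by blast
  then show ?thesis
    using that h(2) by auto
qed

lemma has_sum_times_banach:
  fixes f :: "'a \<Rightarrow> complex" and g :: "'b \<Rightarrow> complex"
  assumes "(f has_sum a) A" "(g has_sum b) B"
  shows "((\<lambda>(x, y). f x * g y) has_sum (a * b)) (A \<times> B)"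
proof -
  have fa: "(\<lambda>x. norm (f x)) summable_on A" and ga: "(\<lambda>y. norm (g y)) summable_on B"
    using assms summable_on_iff_abs_summable_on_complex has_sum_imp_summable by blast+
  have "(\<lambda>(x, y). norm (f x) * norm (g y)) summable_on A \<times> B"
    using fa ga
    by (intro summable_on_SigmaI[where g = "\<lambda>x. norm (f x) * (\<Sum>\<^sub>\<infinity>y\<in>B. norm (g y))"])
       (auto intro!: has_sum_cmult_right summable_on_cmult_left)
  then have "(\<lambda>p. norm (case p of (x, y) \<Rightarrow> f x * g y)) summable_on A \<times> B"
    by (simp add: case_prod_unfold norm_mult)
  then have s: "(\<lambda>(x, y). f x * g y) summable_on A \<times> B"
    by (rule abs_summable_summable)
  show ?thesis
  proof (rule has_sum_SigmaI[where g = "\<lambda>x. f x * b"])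
    show "((\<lambda>y. case (x, y) of (x, y) \<Rightarrow> f x * g y) has_sum f x * b) B" for x
      using has_sum_cmult_right[OF assms(2), of "f x"] by simp
    show "((\<lambda>x. f x * b) has_sum a * b) A"
      by (rule has_sum_cmult_left[OF assms(1)])
  qed (rule s)
qed

section \<open>Appell functions\<close>

text \<open>Partial sums of the series of \<open>j(1;q) = 0\<close>. They are the Laurent
  coefficients of \<open>j(v;q) / (1 - v)\<close>, and since the total is 0 they decay at both ends,
  so that the expansion is valid for all \<open>v \<noteq> 0\<close>.\<close>

definition theta_partial :: "complex \<Rightarrow> int \<Rightarrow> complex" where
  "theta_partial q n = (\<Sum>\<^sub>\<infinity>m\<in>{..n}. (- 1) powi m * q powi tri m)"

lemma theta_coeff_summable:
  assumes "nome q"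
  shows "(\<lambda>m. (- 1) powi m * q powi tri m) summable_on A"
proof -
  have "(\<lambda>m. (- 1) powi m * q powi tri m) summable_on UNIV"
    using summable_on_jtheta[OF assms, of 1] by simp
  then show ?thesis
    by (rule summable_on_subset) auto
qed

lemma theta_partial_Suc:
  assumes "nome q"
  shows "theta_partial q (n + 1) = theta_partial q n + (- 1) powi (n + 1) * q powi tri (n + 1)"
proof -
  have "{..n + 1} = insert (n + 1) {..n}" by auto
  then have "theta_partial q (n + 1) = (\<Sum>\<^sub>\<infinity>m\<in>insert (n + 1) {..n}. (- 1) powi m * q powi tri m)"
    by (simp only: theta_partial_def)
  also have "\<dots> = (- 1) powi (n + 1) * q powi tri (n + 1) + theta_partial q n"
    unfolding theta_partial_def by (rule infsum_insert[OF theta_coeff_summable[OF assms]]) auto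
  finally show ?thesis by simp
qed

text \<open>The full sum is \<open>j(1;q) = 0\<close>, so a partial sum is minus the complementary one.\<close>

lemma theta_partial_uminus:
  assumes "nome q"
  shows "theta_partial q (- n) = theta_partial q n"
proof -
  let ?f = "\<lambda>m. (- 1) powi m * q powi tri m"
  have "infsum ?f ({..n} \<union> {n<..}) = infsum ?f {..n} + infsum ?f {n<..}"
    by (intro infsum_Un_disjoint theta_coeff_summable assms) auto
  moreover have "{..n} \<union> {n<..} = UNIV" by auto
  moreover have "infsum ?f UNIV = 0"
    using jtheta_series[OF assms, of 1] assms by simp
  ultimately have "theta_partial q n = - infsum ?f {n<..}"
    by (simp add: theta_partial_def eq_neg_iff_add_eq_0)
  also have "infsum ?f {n<..} = infsum (\<lambda>m. - ?f m) {..- n}"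
  proof (rule infsum_reindex_bij_witness[of _ "\<lambda>m. 1 - m" "\<lambda>m. 1 - m"])
    fix m :: int assume "m \<in> {n<..}"
    have "tri (1 - m) = tri m"
      using tri_one_minus[of m] by (simp add: algebra_simps)
    moreover have "(- 1 :: complex) powi (1 - m) = - ((- 1) powi m)"
      using neg_one_powi_uminus[of "m - 1"] by (simp add: power_int_diff)
    ultimately show "- ?f (1 - m) = ?f m" by simp
  qed auto
  finally show ?thesis
    by (simp add: theta_partial_def infsum_uminus)
qed

text \<open>For \<open>n \<le> 0\<close> the first term dominates the tail:
  \<open>(m - n) * n \<ge> 0\<close> for \<open>m \<le> n\<close> gives
  \<open>tri m \<ge> tri (m - n) + tri n\<close>. Positive \<open>n\<close> follow from the symmetry
  of the partial sums.\<close>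

lemma norm_theta_partial_le:
  assumes "nome q"
  obtains C where "\<And>n. norm (theta_partial q n) \<le> C * norm q powi tri n"
proof -
  have q: "q \<noteq> 0" "norm q < 1" using assms by (auto simp: nome_def)
  define C where "C = (\<Sum>\<^sub>\<infinity>m. norm q powi tri m)"
  have cs: "(\<lambda>m. norm q powi tri m) summable_on A" for A
    using summable_on_subset[OF summable_on_tri_real[of "norm q" 1], of A] q by simp
  have C0: "C \<ge> 0"
    unfolding C_def by (intro infsum_nonneg) auto
  have neg: "norm (theta_partial q n) \<le> C * norm q powi tri n" if n: "n \<le> 0" for n
  proof -
    have summ: "(\<lambda>m. norm ((- 1) powi m * q powi tri m)) summable_on {..n}"
      using cs[of "{..n}"] by (simp add: norm_mult norm_power_int)
    have "norm (theta_partial q n) \<le> (\<Sum>\<^sub>\<infinity>m\<in>{..n}. norm ((- 1) powi m * q powi tri m))"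
      unfolding theta_partial_def using summ by (rule norm_infsum_bound)
    also have "\<dots> \<le> (\<Sum>\<^sub>\<infinity>m\<in>{..n}. norm q powi tri (m - n) * norm q powi tri n)"
    proof (rule infsum_mono[OF summ])
      show "(\<lambda>m. norm q powi tri (m - n) * norm q powi tri n) summable_on {..n}"
        using summable_on_subset[OF summable_on_int_shift_iff[of "\<lambda>m. norm q powi tri m" "- n", THEN iffD2, OF cs], of "{..n}"]
        by (intro summable_on_cmult_left) simp
      fix m assume "m \<in> {..n}"
      then have "(m - n) * n \<ge> 0"
        using n by (intro mult_nonpos_nonpos) auto
      then have "tri (m - n) + tri n \<le> tri m"
        using tri_add[of "m - n" n] by simp
      then have "norm q powi tri m \<le> norm q powi (tri (m - n) + tri n)"
        using q by (intro power_int_decreasing) auto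
      then show "norm ((- 1) powi m * q powi tri m) \<le> norm q powi tri (m - n) * norm q powi tri n"
        using q by (simp add: norm_mult norm_power_int power_int_add)
    qed
    also have "\<dots> = (\<Sum>\<^sub>\<infinity>m\<in>{..n}. norm q powi tri (m - n)) * norm q powi tri n"
      by (rule infsum_cmult_left')
    also have "(\<Sum>\<^sub>\<infinity>m\<in>{..n}. norm q powi tri (m - n)) = (\<Sum>\<^sub>\<infinity>m\<in>{..0}. norm q powi tri m)"
      by (rule infsum_reindex_bij_witness[of _ "\<lambda>m. m + n" "\<lambda>m. m - n"]) auto
    also have "\<dots> \<le> C"
      unfolding C_def by (intro infsum_mono_neutral cs) auto
    finally show ?thesis
      using q by (simp add: mult_right_mono)
  qed
  have "norm (theta_partial q n) \<le> C * norm q powi tri n" for n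
  proof (cases "n \<le> 0")
    case False
    have "norm (theta_partial q n) \<le> C * norm q powi tri (- n)"
      using neg[of "- n"] False theta_partial_uminus[OF assms, of n] by simp
    also have "\<dots> \<le> C * norm q powi tri n"
      using False C0 q by (intro mult_left_mono power_int_decreasing) (auto simp: tri_uminus)
    finally show ?thesis .
  qed (rule neg)
  then show ?thesis using that by blast
qed

text \<open>The term of the double series that defines the numerator of the Appell function; it is
  invariant under exchanging \<open>(r, u)\<close> with \<open>(s, z)\<close>.\<close>

definition appell_term :: "complex \<Rightarrow> complex \<Rightarrow> complex \<Rightarrow> int \<Rightarrow> int \<Rightarrow> complex" where
  "appell_term u z q r s = theta_partial q (s - r) * q powi (r * s) * u powi s * z powi r"

text \<open>By \<open>appell_series\<close> this is \<open>j(u;q)\<close> times an Appell series in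
  \<open>z\<close>; in the present form the poles in \<open>u\<close> have been cleared and the
  symmetry between \<open>u\<close> and \<open>z\<close> is visible.\<close>

definition appell_num :: "complex \<Rightarrow> complex \<Rightarrow> complex \<Rightarrow> complex" where
  "appell_num u z q = (\<Sum>\<^sub>\<infinity>(r, s). appell_term u z q r s)"

text \<open>The power \<open>q powi (r * s)\<close> alone is unbounded, but the decay of the partial
  theta sums compensates: \<open>tri (s - r) + r * s = tri s + tri r + r\<close>, so the majorant
  factors into a series in \<open>r\<close> and one in \<open>s\<close>.\<close>

lemma appell_term_summable:
  assumes "nome q" "u \<noteq> 0" "z \<noteq> 0"
  shows "(\<lambda>(r, s). appell_term u z q r s) summable_on UNIV \<times> UNIV"
proof -
  have q: "q \<noteq> 0" "norm q < 1" using assms by (auto simp: nome_def)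
  obtain C where C: "\<And>n. norm (theta_partial q n) \<le> C * norm q powi tri n"
    using norm_theta_partial_le[OF assms(1)] by blast
  define f where "f = (\<lambda>r. of_real (C * (norm q powi tri r * norm (q * z) powi r)) :: complex)"
  define g where "g = (\<lambda>s. of_real (norm q powi tri s * norm u powi s) :: complex)"
  have "f summable_on UNIV" "g summable_on UNIV"
    unfolding f_def g_def using q assms
    by (intro summable_on_of_real summable_on_cmult_right summable_on_tri_real; simp)+
  then have "((\<lambda>(r, s). f r * g s) has_sum (infsum f UNIV * infsum g UNIV)) (UNIV \<times> UNIV)"
    by (intro has_sum_times_banach) auto
  then have "(\<lambda>p. norm (case p of (r, s) \<Rightarrow> f r * g s)) summable_on UNIV \<times> UNIV"
    using has_sum_imp_summable summable_on_iff_abs_summable_on_complex by blast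
  then have "(\<lambda>p. norm (case p of (r, s) \<Rightarrow> appell_term u z q r s)) summable_on UNIV \<times> UNIV"
  proof (rule Infinite_Sum.abs_summable_on_comparison_test')
    fix p :: "int \<times> int"
    obtain r s where p: "p = (r, s)" by fastforce
    have C0: "C \<ge> 0"
      using order.trans[OF norm_ge_zero C[of 0]] by simp
    have "tri (s - r) = tri s + tri r + r - r * s"
      using tri_add[of s "- r"] tri_uminus[of r] by (simp add: mult.commute)
    then have e: "norm q powi tri (s - r) * norm q powi (r * s) = norm q powi tri s * (norm q powi tri r * norm q powi r)"
      using q by (simp add: add.assoc flip: power_int_add)
    have "norm (appell_term u z q r s) = norm (theta_partial q (s - r)) * (norm q powi (r * s) * norm u powi s * norm z powi r)"
      by (simp add: appell_term_def norm_mult norm_power_int mult_ac)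
    also have "\<dots> \<le> (C * norm q powi tri (s - r)) * (norm q powi (r * s) * norm u powi s * norm z powi r)"
      by (intro mult_right_mono C) auto
    also have "\<dots> = C * (norm q powi tri (s - r) * norm q powi (r * s)) * norm u powi s * norm z powi r"
      by (simp add: mult_ac)
    also have "\<dots> = norm (f r * g s)"
    proof -
      have "norm (f r * g s) = \<bar>C * (norm q powi tri r * norm (q * z) powi r)\<bar> * \<bar>norm q powi tri s * norm u powi s\<bar>"
        unfolding f_def g_def by (simp only: norm_mult[of "of_real _"] norm_of_real)
      then show ?thesis
        unfolding e using C0 by (simp add: norm_mult abs_mult power_int_mult_distrib mult_ac)
    qed
    finally show "norm (case p of (r, s) \<Rightarrow> appell_term u z q r s) \<le> norm (case p of (r, s) \<Rightarrow> f r * g s)"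
      by (simp add: p)
  qed
  then show ?thesis by (rule abs_summable_summable)
qed

lemma appell_num_commute:
  assumes "nome q"
  shows "appell_num u z q = appell_num z u q"
  unfolding appell_num_def
proof (rule infsum_reindex_bij_witness[of _ prod.swap prod.swap])
  fix p :: "int \<times> int"
  have "theta_partial q (fst p - snd p) = theta_partial q (snd p - fst p)"
    using theta_partial_uminus[OF assms, of "snd p - fst p"] by simp
  then show "(case prod.swap p of (r, s) \<Rightarrow> appell_term z u q r s) = (case p of (r, s) \<Rightarrow> appell_term u z q r s)"
    by (cases p) (simp add: appell_term_def mult_ac)
qed auto

lemma appell_num_inverse:
  assumes "nome q"
  shows "appell_num (1 / u) (1 / z) q = appell_num u z q"
  unfolding appell_num_def
proof (rule infsum_reindex_bij_witness[of _ "\<lambda>(r, s). (- r, - s)" "\<lambda>(r, s). (- r, - s)"])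
  fix p :: "int \<times> int"
  obtain r s where p: "p = (r, s)" by fastforce
  have "theta_partial q (- s - - r) = theta_partial q (s - r)"
    using theta_partial_uminus[OF assms, of "s - r"] by simp
  then show "(case case p of (r, s) \<Rightarrow> (- r, - s) of (r, s) \<Rightarrow> appell_term u z q r s) =
     (case p of (r, s) \<Rightarrow> appell_term (1 / u) (1 / z) q r s)"
    by (simp add: p appell_term_def power_int_minus power_int_divide_distrib field_simps)
qed auto

lemma appell_num_iterated:
  assumes "nome q" "u \<noteq> 0" "z \<noteq> 0"
  shows "((\<lambda>r. \<Sum>\<^sub>\<infinity>s. appell_term u z q r s) has_sum appell_num u z q) UNIV"
    and "(\<lambda>s. appell_term u z q r s) summable_on UNIV"
proof -
  note s = appell_term_summable[OF assms]
  show "(\<lambda>s. appell_term u z q r s) summable_on UNIV"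
    using summable_on_SigmaD1[OF s, of r] by simp
  have "((\<lambda>(r, s). appell_term u z q r s) has_sum appell_num u z q) (UNIV \<times> UNIV)"
    unfolding appell_num_def using s by simp
  then show "((\<lambda>r. \<Sum>\<^sub>\<infinity>s. appell_term u z q r s) has_sum appell_num u z q) UNIV"
    by (rule has_sum_SigmaD) (use summable_on_SigmaD1[OF s] in auto)
qed

text \<open>Exchanging the two arguments makes the exponent of \<open>u\<close> the outer index, so
  that the iterated sum is a Laurent series in \<open>u\<close>.\<close>

lemma appell_num_holomorphic:
  assumes "nome q" "z \<noteq> 0"
  shows "(\<lambda>u. appell_num u z q) holomorphic_on (- {0})"
proof -
  define a where "a = (\<lambda>r. \<Sum>\<^sub>\<infinity>s. theta_partial q (s - r) * q powi (r * s) * z powi s)"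
  have eq: "(\<Sum>\<^sub>\<infinity>s. appell_term z u q r s) = a r * u powi r" for u r
    unfolding a_def appell_term_def by (rule infsum_cmult_left')
  have hs: "((\<lambda>r. a r * u powi r) has_sum appell_num u z q) UNIV" if "u \<noteq> 0" for u
    using appell_num_iterated(1)[OF assms(1,2) that] by (simp add: eq appell_num_commute[OF assms(1), of u])
  have "(\<lambda>u. \<Sum>\<^sub>\<infinity>r. a r * u powi r) holomorphic_on (- {0})"
    using hs by (intro laurent_series_holomorphic) (auto intro: has_sum_imp_summable)
  then show ?thesis
    by (rule holomorphic_transform) (use hs in \<open>auto intro!: infsumI\<close>)
qed

text \<open>Lowering \<open>r\<close> by 1 lengthens the partial theta sum by one term. That term
  splits into an \<open>r\<close> part and an \<open>s\<close> part, and these sum to a product of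
  two theta functions.\<close>

lemma appell_num_shift:
  assumes "nome q" "u \<noteq> 0" "z \<noteq> 0"
  shows "z * appell_num (q * u) z q = appell_num u z q + jtheta u q * jtheta z q / u"
proof -
  have q: "q \<noteq> 0" using assms by (auto simp: nome_def)
  let ?T = "\<lambda>r s. ((- 1) powi r * q powi tri r * z powi r) * ((- 1) powi s * q powi tri s * (q * u) powi s)"
  have term_eq: "z * appell_term (q * u) z q (r - 1) s = appell_term u z q r s - ?T r s" for r s
  proof -
    have g: "theta_partial q (s - (r - 1)) = theta_partial q (s - r) + (- 1) powi (s - r + 1) * q powi tri (s - r + 1)"
      using theta_partial_Suc[OF assms(1), of "s - r"] by (simp add: algebra_simps)
    have a: "q powi ((r - 1) * s) * (q * u) powi s = q powi (r * s) * u powi s"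
      using q by (simp add: power_int_mult_distrib left_diff_distrib power_int_diff)
    have b: "z * z powi (r - 1) = z powi r"
      using assms by (simp add: power_int_diff)
    have "tri (s - r + 1) = tri s + tri r + s - r * s"
      using tri_Suc[of "s - r"] tri_add[of s "- r"] tri_uminus[of r] by (simp add: mult.commute)
    then have c: "q powi tri (s - r + 1) * q powi (r * s) = q powi tri s * q powi tri r * q powi s"
      using q by (simp flip: power_int_add)
    have d: "(- 1 :: complex) powi (s - r + 1) = - ((- 1) powi s * (- 1) powi r)"
      using neg_one_powi_uminus[of r] power_int_add[of "- 1 :: complex" s "- r"]
      by (simp add: power_int_add)
    have "z * appell_term (q * u) z q (r - 1) s =
        theta_partial q (s - (r - 1)) * (q powi ((r - 1) * s) * (q * u) powi s) * (z * z powi (r - 1))"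
      by (simp add: appell_term_def mult_ac)
    also have "\<dots> = theta_partial q (s - r) * (q powi (r * s) * u powi s) * z powi r +
       (- 1) powi (s - r + 1) * (q powi tri (s - r + 1) * q powi (r * s)) * u powi s * z powi r"
      unfolding a b g by (simp add: algebra_simps)
    also have "\<dots> = appell_term u z q r s - ?T r s"
      unfolding c d by (simp add: appell_term_def power_int_mult_distrib algebra_simps)
    finally show ?thesis .
  qed
  have "appell_num (q * u) z q = (\<Sum>\<^sub>\<infinity>(r, s). appell_term (q * u) z q (r - 1) s)"
    unfolding appell_num_def
    by (rule infsum_reindex_bij_witness[of _ "\<lambda>(r, s). (r - 1, s)" "\<lambda>(r, s). (r + 1, s)"]) auto
  then have "z * appell_num (q * u) z q = (\<Sum>\<^sub>\<infinity>p. z * (case p of (r, s) \<Rightarrow> appell_term (q * u) z q (r - 1) s))"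
    by (simp add: infsum_cmult_right')
  also have "\<dots> = (\<Sum>\<^sub>\<infinity>p. (case p of (r, s) \<Rightarrow> appell_term u z q r s) - (case p of (r, s) \<Rightarrow> ?T r s))"
    by (intro infsum_cong) (auto simp: term_eq split: prod.split)
  also have "\<dots> = appell_num u z q - jtheta z q * jtheta (q * u) q"
  proof -
    have "((\<lambda>(r, s). ?T r s) has_sum (jtheta z q * jtheta (q * u) q)) (UNIV \<times> UNIV)"
      using assms q by (intro has_sum_times_banach jtheta_has_sum) auto
    then show ?thesis
      unfolding appell_num_def using appell_term_summable[OF assms]
      by (subst infsum_diff) (auto simp: has_sum_iff)
  qed
  finally show ?thesis
    using jtheta_shift[OF assms(1,2)] by simp
qed

text \<open>\<open>j(v;q) / (1 - v)\<close> with the singularity at \<open>v = 1\<close> filled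
  in.\<close>

definition jtheta_quot :: "complex \<Rightarrow> complex \<Rightarrow> complex" where
  "jtheta_quot v q = qpoch_inf (q * v) q * qpoch_inf (q / v) q * qpoch_inf q q"

lemma jtheta_eq_quot:
  assumes "nome q"
  shows "jtheta v q = (1 - v) * jtheta_quot v q"
  using qpoch_inf_step[OF nome_norm[OF assms], of v] by (simp add: jtheta_def jtheta_quot_def mult_ac)

lemma jtheta_quot_1: "jtheta_quot 1 q = qpoch_inf q q ^ 3"
  by (simp add: jtheta_quot_def power3_eq_cube)

lemma jtheta_quot_holomorphic:
  assumes "nome q"
  shows "(\<lambda>v. jtheta_quot v q) holomorphic_on (- {0})"
  unfolding jtheta_quot_def using nome_norm[OF assms] by (intro holomorphic_intros) auto

text \<open>Multiplication by \<open>1 - v\<close> takes differences of the partial sums and returns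
  the theta series. The point \<open>v = 1\<close>, where this says nothing, follows by
  continuity.\<close>

lemma theta_partial_has_sum:
  assumes "nome q" "v \<noteq> 0"
  shows "((\<lambda>n. theta_partial q n * v powi n) has_sum jtheta_quot v q) UNIV"
proof -
  define G where "G = (\<lambda>v. \<Sum>\<^sub>\<infinity>n. theta_partial q n * v powi n)"
  have summ: "(\<lambda>n. theta_partial q n * v powi n) summable_on UNIV" if "v \<noteq> 0" for v
    using appell_num_iterated(2)[OF assms(1) that, of 1 0] by (simp add: appell_term_def)
  have G: "(1 - v) * G v = jtheta v q" if v: "v \<noteq> 0" for v
  proof -
    have "v * G v = (\<Sum>\<^sub>\<infinity>n. theta_partial q n * v powi (n + 1))"
      using v by (simp add: G_def power_int_add mult_ac flip: infsum_cmult_right')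
    also have "\<dots> = (\<Sum>\<^sub>\<infinity>n. theta_partial q (n - 1) * v powi n)"
      using infsum_int_shift[of "\<lambda>n. theta_partial q (n - 1) * v powi n" 1] by simp
    finally have 1: "v * G v = \<dots>" .
    have s1: "(\<lambda>n. theta_partial q (n - 1) * v powi n) summable_on UNIV"
      using summable_on_int_shift_iff[of "\<lambda>n. theta_partial q (n - 1) * v powi n" 1]
        summable_on_cmult_left[OF summ[OF v], of v] v
      by (simp add: power_int_add mult_ac)
    have "(1 - v) * G v = (\<Sum>\<^sub>\<infinity>n. theta_partial q n * v powi n - theta_partial q (n - 1) * v powi n)"
      using infsum_diff[OF summ[OF v] s1] 1 by (simp add: G_def algebra_simps)
    also have "\<dots> = (\<Sum>\<^sub>\<infinity>n. (- 1) powi n * q powi tri n * v powi n)"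
    proof (rule infsum_cong)
      fix n
      have "theta_partial q n = theta_partial q (n - 1) + (- 1) powi n * q powi tri n"
        using theta_partial_Suc[OF assms(1), of "n - 1"] by simp
      then show "theta_partial q n * v powi n - theta_partial q (n - 1) * v powi n =
          (- 1) powi n * q powi tri n * v powi n"
        by (simp only: distrib_right) simp
    qed
    also have "\<dots> = jtheta v q"
      by (rule jtheta_series[OF assms(1) v, symmetric])
    finally show ?thesis .
  qed
  have neq: "G v = jtheta_quot v q" if "v \<noteq> 0" "v \<noteq> 1" for v
    using G[OF that(1)] jtheta_eq_quot[OF assms(1), of v] that(2) by simp
  have "G v = jtheta_quot v q"
  proof (cases "v = 1")
    case True
    have "G holomorphic_on (- {0})"
      unfolding G_def by (rule laurent_series_holomorphic[OF summ])
    moreover have "isCont f 1" if "f holomorphic_on (- {0})" for f :: "complex \<Rightarrow> complex"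
    proof -
      have "open (- {0 :: complex})" by auto
      then show ?thesis
        using that continuous_on_eq_continuous_at[of "- {0}" f] holomorphic_on_imp_continuous_on by auto
    qed
    ultimately have "isCont G 1" "isCont (\<lambda>v. jtheta_quot v q) 1"
      using jtheta_quot_holomorphic[OF assms(1)] by blast+
    then have "G \<midarrow>1\<rightarrow> G 1" "(\<lambda>v. jtheta_quot v q) \<midarrow>1\<rightarrow> jtheta_quot 1 q"
      by (auto simp: isCont_def)
    moreover have "eventually (\<lambda>v. v \<noteq> 0) (at (1 :: complex))"
      by (rule eventually_neq_at_within)
    then have "eventually (\<lambda>v. G v = jtheta_quot v q) (at 1)"
      using eventually_neq_at_within[of 1 1 UNIV]
      by eventually_elim (use neq in auto)
    ultimately have "G 1 = jtheta_quot 1 q"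
      using tendsto_cong[of G "\<lambda>v. jtheta_quot v q" "at 1"] tendsto_unique[OF trivial_limit_at] by blast
    then show ?thesis using True by simp
  qed (use neq assms in auto)
  then show ?thesis
    using summ[OF assms(2)] by (simp add: G_def has_sum_iff)
qed

lemma appell_num_row:
  assumes "nome q" "u \<noteq> 0" "z \<noteq> 0"
  shows "((\<lambda>r. q powi (r * r) * (u * z) powi r * jtheta_quot (q powi r * u) q) has_sum appell_num u z q) UNIV"
proof -
  have q: "q \<noteq> 0" using assms by (auto simp: nome_def)
  have "(\<Sum>\<^sub>\<infinity>s. appell_term u z q r s) = q powi (r * r) * (u * z) powi r * jtheta_quot (q powi r * u) q" for r
  proof -
    have "(\<Sum>\<^sub>\<infinity>s. appell_term u z q r s) = (\<Sum>\<^sub>\<infinity>s. appell_term u z q r (s + r))"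
      by (rule infsum_int_shift[symmetric])
    also have "\<dots> = (\<Sum>\<^sub>\<infinity>s. q powi (r * r) * (u * z) powi r * (theta_partial q s * (q powi r * u) powi s))"
      using assms q
      by (intro infsum_cong)
         (simp add: appell_term_def distrib_left power_int_add power_int_mult_distrib mult_ac flip: power_int_mult)
    also have "\<dots> = q powi (r * r) * (u * z) powi r * (\<Sum>\<^sub>\<infinity>s. theta_partial q s * (q powi r * u) powi s)"
      by (rule infsum_cmult_right')
    also have "(\<Sum>\<^sub>\<infinity>s. theta_partial q s * (q powi r * u) powi s) = jtheta_quot (q powi r * u) q"
      using theta_partial_has_sum[OF assms(1), of "q powi r * u"] assms q by (intro infsumI) auto
    finally show ?thesis .
  qed
  then show ?thesis
    using appell_num_iterated(1)[OF assms] by simp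
qed

lemma jtheta_powi_shift:
  assumes "nome q" "x \<noteq> 0"
  shows "jtheta (q powi n * x) q * (q powi tri n * x powi n) = (- 1) powi n * jtheta x q"
proof -
  have q: "q \<noteq> 0" using assms by (auto simp: nome_def)
  let ?P = "\<lambda>n. jtheta (q powi n * x) q * (q powi tri n * x powi n) = (- 1) powi n * jtheta x q"
  have step: "?P (n + 1) \<longleftrightarrow> ?P n" for n
  proof -
    have 1: "jtheta (q powi (n + 1) * x) q = - jtheta (q powi n * x) q / (q powi n * x)"
      using jtheta_shift[OF assms(1), of "q powi n * x"] assms q by (simp add: power_int_add mult_ac)
    have 2: "q powi tri (n + 1) = q powi tri n * q powi n" "x powi (n + 1) = x powi n * x"
        "(- 1 :: complex) powi (n + 1) = - ((- 1) powi n)"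
      using assms q by (simp_all add: tri_Suc power_int_add)
    show ?thesis
      unfolding 1 2 using assms q by (simp add: field_simps)
  qed
  show ?thesis
  proof (induction n rule: int_induct[of _ 0])
    case (step2 i)
    then show ?case using step[of "i - 1"] by simp
  qed (use step in auto)
qed

text \<open>In the expansion by rows, quasi-periodicity reduces
  \<open>jtheta_quot (q powi r * u) q\<close> to a multiple of
  \<open>j(u;q) / (1 - q powi r * u)\<close>; dividing by \<open>j(u;q)\<close> leaves the usual
  Appell denominators.\<close>

lemma appell_series:
  assumes "nome q" "u \<noteq> 0" "z \<noteq> 0" "jtheta u q \<noteq> 0"
  shows "((\<lambda>r. (- 1) powi r * q powi tri (r + 1) * z powi r / (1 - q powi r * u)) has_sum
    (appell_num u z q / jtheta u q)) UNIV"
proof -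
  have q: "q \<noteq> 0" using assms by (auto simp: nome_def)
  have "q powi (r * r) * (u * z) powi r * jtheta_quot (q powi r * u) q / jtheta u q =
    (- 1) powi r * q powi tri (r + 1) * z powi r / (1 - q powi r * u)" for r
  proof -
    have nz: "q powi r * u \<noteq> 1"
    proof
      assume "q powi r * u = 1"
      then have "u = q powi (- r)" using q by (simp add: power_int_minus field_simps)
      then show False using jtheta_eq_0_iff[OF assms(1,2)] assms(4) by blast
    qed
    define t where "t = q powi tri r"
    have t: "t \<noteq> 0" using q by (simp add: t_def)
    have "jtheta (q powi r * u) q * (t * u powi r) = (- 1) powi r * jtheta u q"
      using jtheta_powi_shift[OF assms(1,2)] by (simp add: t_def)
    then have "(1 - q powi r * u) * jtheta_quot (q powi r * u) q * (t * u powi r) = (- 1) powi r * jtheta u q"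
      using jtheta_eq_quot[OF assms(1), of "q powi r * u"] by simp
    then have "u powi r * jtheta_quot (q powi r * u) q / jtheta u q = (- 1) powi r / (t * (1 - q powi r * u))"
      using nz t assms(4) by (simp add: field_simps)
    moreover have "r * r = tri (r + 1) + tri r"
      unfolding tri_Suc using square_eq_tri[of r] by simp
    then have "q powi (r * r) = q powi tri (r + 1) * t"
      using q by (simp add: t_def power_int_add)
    ultimately have "q powi (r * r) * z powi r * (u powi r * jtheta_quot (q powi r * u) q / jtheta u q) =
       q powi tri (r + 1) * t * z powi r * ((- 1) powi r / (t * (1 - q powi r * u)))"
      by simp
    then show ?thesis
      using t by (simp add: power_int_mult_distrib mult_ac)
  qed
  then show ?thesis
    using has_sum_divide_const[OF appell_num_row[OF assms(1-3)], of "jtheta u q"] by simp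
qed

text \<open>At \<open>u = 1\<close> every row except \<open>r = 0\<close> contains a zero of the
  theta function. The value does not depend on \<open>z\<close> and fixes the constant in
  \<open>appell_m_change_z\<close>.\<close>

lemma appell_num_1:
  assumes "nome q" "z \<noteq> 0"
  shows "appell_num 1 z q = qpoch_inf q q ^ 3"
proof -
  have q: "q \<noteq> 0" using assms by (auto simp: nome_def)
  have "jtheta_quot (q powi r) q = 0" if "r \<noteq> 0" for r
  proof -
    have "jtheta (q powi r) q = 0"
      using jtheta_eq_0_iff[OF assms(1), of "q powi r"] q by auto
    moreover have "q powi r \<noteq> 1"
      using nome_powi_eq_1_iff[OF assms(1), of r] that by simp
    ultimately show ?thesis
      using jtheta_eq_quot[OF assms(1), of "q powi r"] by simp
  qed
  then have "((\<lambda>r. q powi (r * r) * z powi r * jtheta_quot (q powi r) q) has_sum (qpoch_inf q q ^ 3)) UNIV"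
    by (intro has_sum_finite_neutralI[of "{0}"]) (auto simp: jtheta_quot_1)
  moreover have "((\<lambda>r. q powi (r * r) * z powi r * jtheta_quot (q powi r) q) has_sum appell_num 1 z q) UNIV"
    using appell_num_row[OF assms(1), of 1 z] assms(2) by simp
  ultimately show ?thesis
    using has_sum_unique by blast
qed

text \<open>The derivative at 1 is read off from \<open>j(v;q) = (1 - v) * jtheta_quot v q\<close>;
  differentiating the quasi-periodicity relation at a zero carries the nonvanishing to all other
  powers of \<open>q\<close>.\<close>

lemma jtheta_deriv_nonzero:
  assumes "nome q" "v \<noteq> 0" "jtheta v q = 0"
  obtains d where "((\<lambda>v. jtheta v q) has_field_derivative d) (at v)" "d \<noteq> 0"
proof -
  have q: "q \<noteq> 0" using assms by (auto simp: nome_def)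
  have hol: "(\<lambda>v. jtheta v q) holomorphic_on (- {0})"
    using nome_norm[OF assms(1)] by (intro holomorphic_intros) auto
  have der: "((\<lambda>v. jtheta v q) has_field_derivative deriv (\<lambda>v. jtheta v q) v) (at v)" if "v \<noteq> 0" for v
    using holomorphic_derivI[OF hol, of v] that by auto
  have one: "((\<lambda>v. (1 - v) * jtheta_quot v q) has_field_derivative - jtheta_quot 1 q) (at 1)"
    using holomorphic_derivI[OF jtheta_quot_holomorphic[OF assms(1)], of 1]
    by (auto intro!: derivative_eq_intros)
  have "deriv (\<lambda>v. jtheta v q) 1 = - (qpoch_inf q q ^ 3)"
    using DERIV_imp_deriv[OF one] by (simp add: jtheta_eq_quot[OF assms(1)] jtheta_quot_1)
  then have base: "deriv (\<lambda>v. jtheta v q) 1 \<noteq> 0"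
    using qpoch_inf_self_nonzero[OF assms(1)] by simp
  have step: "deriv (\<lambda>v. jtheta v q) (q * v) = - deriv (\<lambda>v. jtheta v q) v / (q * v)"
    if v: "v \<noteq> 0" "jtheta v q = 0" for v
  proof -
    let ?j = "\<lambda>v. jtheta v q"
    have "(?j has_field_derivative deriv ?j (q * v)) (at (q * v))"
      using der[of "q * v"] v q by simp
    then have "((\<lambda>v. ?j (q * v)) has_field_derivative deriv ?j (q * v) * q) (at v)"
      by (rule DERIV_chain2[where f = ?j and g = "\<lambda>v. q * v"]) (auto intro!: derivative_eq_intros)
    moreover have "((\<lambda>v. ?j (q * v)) has_field_derivative - deriv ?j v / v) (at v)"
    proof (rule has_field_derivative_transform_within_open[of "\<lambda>v. - ?j v / v" _ _ "- {0}"])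
      show "((\<lambda>v. - ?j v / v) has_field_derivative - deriv ?j v / v) (at v)"
        using v by (auto intro!: derivative_eq_intros der simp: field_simps)
    qed (use v jtheta_shift[OF assms(1)] in auto)
    ultimately have "deriv ?j (q * v) * q = - deriv ?j v / v"
      by (rule DERIV_unique)
    then show ?thesis using q v by (simp add: field_simps)
  qed
  have zero: "jtheta (q powi n) q = 0" for n
    using jtheta_eq_0_iff[OF assms(1), of "q powi n"] q by auto
  have "deriv (\<lambda>v. jtheta v q) (q powi n) \<noteq> 0" for n
  proof (induction n rule: int_induct[of _ 0])
    case (step1 i)
    then show ?case
      using step[of "q powi i"] zero[of i] q by (simp add: power_int_add mult.commute)
  next
    case (step2 i)
    then show ?case
      using step[of "q powi (i - 1)"] zero[of "i - 1"] q by (simp add: power_int_diff)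
  qed (use base in simp)
  then show ?thesis
    using that der[OF assms(2)] jtheta_eq_0_iff[OF assms(1,2)] assms(3) by blast
qed

lemma multiplier_zero_iff:
  assumes "nome p" "\<And>x. x \<noteq> 0 \<Longrightarrow> m x \<noteq> (0 :: complex)" "\<And>x. x \<noteq> 0 \<Longrightarrow> f x = m x * f (p * x)" "x \<noteq> 0"
  shows "f (p powi n * x) = 0 \<longleftrightarrow> f x = 0"
proof -
  have p: "p \<noteq> 0" using assms by (auto simp: nome_def)
  have step: "f (p powi (i + 1) * x) = 0 \<longleftrightarrow> f (p powi i * x) = 0" for i
  proof -
    have "f (p powi i * x) = m (p powi i * x) * f (p powi (i + 1) * x)"
      using assms(3)[of "p powi i * x"] p assms(4) by (simp add: power_int_add mult_ac)
    then show ?thesis using assms(2)[of "p powi i * x"] p assms(4) by auto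
  qed
  show ?thesis
  proof (induction n rule: int_induct[of _ 0])
    case (step2 i)
    then show ?case using step[of "i - 1"] by simp
  qed (use step in auto)
qed

text \<open>By \<open>appell_series\<close> and \<open>r \<mapsto> r - 1\<close>, this is the usual
  \<open>m(x,q,z) = j(z;q)\<^sup>-\<^sup>1 \<Sum>\<^sub>r (- 1)\<^sup>r q\<^bsup>r(r-1)/2\<^esup> z\<^sup>r / (1 - q\<^bsup>r-1\<^esup> x z)\<close>.\<close>

definition appell_m :: "complex \<Rightarrow> complex \<Rightarrow> complex \<Rightarrow> complex" where
  "appell_m x q z = - z * appell_num (x * z) z q / (jtheta z q * jtheta (x * z) q)"

lemma appell_m_inverse:
  assumes "nome q" "x \<noteq> 0" "z \<noteq> 0"
  shows "appell_m (1 / x) q (1 / z) = x * appell_m x q z"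
proof -
  have "appell_num (1 / x * (1 / z)) (1 / z) q = appell_num (x * z) z q"
    using appell_num_inverse[OF assms(1), of "x * z" z] by simp
  moreover have "jtheta (1 / z) q = - jtheta z q / z" "jtheta (1 / x * (1 / z)) q = - jtheta (x * z) q / (x * z)"
    using jtheta_inverse[OF assms(1), of z] jtheta_inverse[OF assms(1), of "x * z"] assms by auto
  ultimately show ?thesis
    using assms by (simp add: appell_m_def)
qed

text \<open>With denominators cleared, the difference is a function \<open>D\<close> of
  \<open>x\<close> having the multiplier of \<open>j(z0 * z1 * x; q)\<close>. The inhomogeneous
  terms of the two shift equations cancel in \<open>D\<close>, so a single zero and a single value
  determine it.\<close>

theorem appell_m_change_z:
  assumes q: "nome q" and nz: "x \<noteq> 0" "z0 \<noteq> 0" "z1 \<noteq> 0"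
    and j: "jtheta z0 q \<noteq> 0" "jtheta z1 q \<noteq> 0" "jtheta (x * z0) q \<noteq> 0" "jtheta (x * z1) q \<noteq> 0"
  shows "appell_m x q z1 - appell_m x q z0 =
    z0 * qpoch_inf q q ^ 3 * jtheta (z1 / z0) q * jtheta (x * z0 * z1) q /
    (jtheta z0 q * jtheta z1 q * jtheta (x * z0) q * jtheta (x * z1) q)"
proof -
  have q0: "q \<noteq> 0" "norm q < 1" using q by (auto simp: nome_def)
  define D where "D = (\<lambda>x. z0 * appell_num (x * z0) z0 q * jtheta z1 q * jtheta (x * z1) q -
     z1 * appell_num (x * z1) z1 q * jtheta z0 q * jtheta (x * z0) q)"
  define g where "g = (\<lambda>x. jtheta (z0 * z1 * x) q)"
  have num_hol: "(\<lambda>x. appell_num (x * z) z q) holomorphic_on (- {0})" if "z \<noteq> 0" for z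
  proof -
    have "(\<lambda>x. x * z) holomorphic_on (- {0})"
      by (intro holomorphic_intros)
    moreover have "(\<lambda>x. x * z) ` (- {0}) \<subseteq> - {0}"
      using that by auto
    ultimately show ?thesis
      using holomorphic_on_compose_gen[OF _ appell_num_holomorphic[OF q that], of "\<lambda>x. x * z" "- {0}"]
      unfolding o_def by blast
  qed
  have Dh: "D holomorphic_on (- {0})"
    unfolding D_def using q0 nz by (intro holomorphic_intros num_hol) auto
  have gh: "g holomorphic_on (- {0})"
    unfolding g_def using q0 nz by (intro holomorphic_intros) auto
  have Dm: "D x = - (z0 * z1 * x) * D (q * x)" if x: "x \<noteq> 0" for x
  proof -
    have 1: "z * appell_num (q * x * z) z q = appell_num (x * z) z q + jtheta (x * z) q * jtheta z q / (x * z)"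
      if "z \<noteq> 0" for z
      using appell_num_shift[OF q, of "x * z" z] x that by (simp add: mult_ac)
    have 2: "jtheta (q * x * z) q = - jtheta (x * z) q / (x * z)" if "z \<noteq> 0" for z
      using jtheta_shift[OF q, of "x * z"] x that by (simp add: mult_ac)
    have *: "D (q * x) = (appell_num (x * z0) z0 q + jtheta (x * z0) q * jtheta z0 q / (x * z0)) * jtheta z1 q * (- jtheta (x * z1) q / (x * z1))
       - (appell_num (x * z1) z1 q + jtheta (x * z1) q * jtheta z1 q / (x * z1)) * jtheta z0 q * (- jtheta (x * z0) q / (x * z0))"
      unfolding D_def 1[OF nz(2)] 1[OF nz(3)] 2[OF nz(2)] 2[OF nz(3)] ..
    show ?thesis
      unfolding * unfolding D_def using x nz by (simp add: field_simps)
  qed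
  have gm: "g x = - (z0 * z1 * x) * g (q * x)" if x: "x \<noteq> 0" for x
    using jtheta_shift[OF q, of "z0 * z1 * x"] x nz by (simp add: g_def mult_ac)
  \<comment> \<open>At this point the two numerators coincide by inversion and exchange of the
    arguments.\<close>
  have D0: "D (1 / (z0 * z1)) = 0"
  proof -
    have "appell_num (1 / z1) z0 q = appell_num (1 / z0) z1 q"
      using appell_num_inverse[OF q, of z1 "1 / z0"] appell_num_commute[OF q, of z1 "1 / z0"] by simp
    then show ?thesis
      unfolding D_def using nz jtheta_inverse[OF q, of z0] jtheta_inverse[OF q, of z1] by simp
  qed
  have zeros: "D x = 0 \<and> deriv g x \<noteq> 0" if x: "x \<noteq> 0" and gx: "g x = 0" for x
  proof
    obtain n where "z0 * z1 * x = q powi n"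
      using jtheta_eq_0_iff[OF q, of "z0 * z1 * x"] gx x nz by (auto simp: g_def)
    then have "x = q powi n * (1 / (z0 * z1))"
      using nz by (simp add: field_simps)
    then show "D x = 0"
      using multiplier_zero_iff[where p = q and f = D and m = "\<lambda>x. - (z0 * z1 * x)" and x = "1 / (z0 * z1)" and n = n]
        q Dm D0 nz by simp
    obtain d where d: "((\<lambda>v. jtheta v q) has_field_derivative d) (at (z0 * z1 * x))" "d \<noteq> 0"
      using jtheta_deriv_nonzero[OF q, of "z0 * z1 * x"] gx x nz by (auto simp: g_def)
    have "(g has_field_derivative d * (z0 * z1)) (at x)"
      unfolding g_def
      by (rule DERIV_chain2[where f = "\<lambda>v. jtheta v q" and g = "\<lambda>x. z0 * z1 * x"], rule d(1))
         (auto intro!: derivative_eq_intros)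
    then show "deriv g x \<noteq> 0"
      using DERIV_imp_deriv d(2) nz by fastforce
  qed
  obtain c where c: "\<And>x. x \<noteq> 0 \<Longrightarrow> D x = c * g x"
    using same_multiplier_proportional[where m = "\<lambda>x. - (z0 * z1 * x)", OF Dh gh q Dm gm zeros] by blast
  \<comment> \<open>At \<open>x = 1 / z0\<close> the second term of \<open>D\<close> contains
    \<open>j(1;q) = 0\<close>, and the numerator in the first is \<open>appell_num 1 z0 q\<close>,
    which is explicit.\<close>
  have "D (1 / z0) = c * jtheta z1 q"
    using c[of "1 / z0"] nz by (simp add: g_def)
  moreover have "D (1 / z0) = z0 * qpoch_inf q q ^ 3 * jtheta z1 q * jtheta (z1 / z0) q"
    using nz jtheta_1[OF q] appell_num_1[OF q nz(2)] by (simp add: D_def)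
  ultimately have "c = z0 * qpoch_inf q q ^ 3 * jtheta (z1 / z0) q"
    using j by auto
  then have D: "D x = z0 * qpoch_inf q q ^ 3 * jtheta (z1 / z0) q * jtheta (x * z0 * z1) q"
    using c[OF nz(1)] by (simp add: g_def mult_ac)
  have "appell_m x q z1 - appell_m x q z0 = D x / (jtheta z0 q * jtheta z1 q * jtheta (x * z0) q * jtheta (x * z1) q)"
    unfolding appell_m_def D_def using j by (simp add: field_simps)
  then show ?thesis by (simp add: D)
qed

section \<open>Hecke-type sums in terms of Appell functions\<close>

lemma has_sum_even_odd:
  fixes f :: "int \<Rightarrow> complex"
  assumes "((\<lambda>n. f (2 * n)) has_sum a) UNIV" "((\<lambda>n. f (2 * n + 1)) has_sum b) UNIV"
  shows "(f has_sum (a + b)) UNIV"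
proof -
  have "(f has_sum a) (range (\<lambda>n. 2 * n))" "(f has_sum b) (range (\<lambda>n. 2 * n + 1))"
    using assms by (subst has_sum_reindex; auto simp: o_def inj_on_def)+
  moreover have "range (\<lambda>n :: int. 2 * n) \<inter> range (\<lambda>n. 2 * n + 1) = {}"
    by (auto; presburger)
  ultimately have "(f has_sum (a + b)) (range (\<lambda>n. 2 * n) \<union> range (\<lambda>n. 2 * n + 1))"
    by (rule has_sum_Un_disjoint)
  moreover have "k \<in> range (\<lambda>n. 2 * n) \<union> range (\<lambda>n. 2 * n + 1)" for k :: int
    by (cases "even k") (auto elim!: evenE oddE)
  then have "range (\<lambda>n. 2 * n) \<union> range (\<lambda>n. 2 * n + 1) = (UNIV :: int set)"
    by blast
  ultimately show ?thesis by simp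
qed

lemma neg_one_powi_uminus_mult: "(- 1) powi n * (- x) powi n = (x :: complex) powi n"
  using power_int_mult_distrib[of "- 1" "- x" n] by simp

lemma tri_double: "tri (2 * n) = 4 * tri n + n"
  using two_tri[of "2 * n"] two_tri[of n] by (simp add: algebra_simps)

lemma jtheta_even_odd:
  assumes "nome q" "x \<noteq> 0"
  shows "jtheta x q = jtheta (- (q * x ^ 2)) (q ^ 4) - x * jtheta (- (q ^ 3 * x ^ 2)) (q ^ 4)"
proof -
  have q: "q \<noteq> 0" using assms by (auto simp: nome_def)
  have q4: "nome (q ^ 4)" using assms by (auto intro: nome_power)
  let ?f = "\<lambda>n. (- 1) powi n * q powi tri n * x powi n"
  have series: "((\<lambda>n. (q ^ 4) powi tri n * c powi n) has_sum jtheta (- c) (q ^ 4)) UNIV" if "c \<noteq> 0" for c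
    using jtheta_has_sum[OF q4, of "- c"] that
    by (simp add: mult.assoc mult.left_commute[of _ "(q ^ 4) powi _"] neg_one_powi_uminus_mult)
  have p4: "q powi (4 * k) = (q ^ 4) powi k" and p2: "x powi (2 * k) = (x ^ 2) powi k" for k
    using power_int_mult[of q 4 k] power_int_mult[of x 2 k] by simp_all
  have "(- 1 :: complex) powi (2 * k) = 1" for k
    using power_int_mult[of "- 1 :: complex" 2 k] by simp
  then have even: "?f (2 * n) = (q ^ 4) powi tri n * (q * x ^ 2) powi n"
    and odd: "?f (2 * n + 1) = - x * ((q ^ 4) powi tri n * (q ^ 3 * x ^ 2) powi n)" for n
  proof -
    assume m: "\<And>k. (- 1 :: complex) powi (2 * k) = 1"
    show "?f (2 * n) = (q ^ 4) powi tri n * (q * x ^ 2) powi n"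
      unfolding m tri_double using q by (simp add: power_int_add p4 p2 power_int_mult_distrib)
    have "tri (2 * n + 1) = 4 * tri n + 3 * n"
      unfolding tri_Suc tri_double by simp
    moreover have "q powi (3 * n) = (q ^ 3) powi n"
      using power_int_mult[of q 3 n] by simp
    moreover have "(- 1 :: complex) powi (2 * n + 1) = - 1"
      using m[of n] by (simp add: power_int_add)
    ultimately show "?f (2 * n + 1) = - x * ((q ^ 4) powi tri n * (q ^ 3 * x ^ 2) powi n)"
      using q assms by (simp add: power_int_add p4 p2 power_int_mult_distrib)
  qed
  have "(?f has_sum (jtheta (- (q * x ^ 2)) (q ^ 4) + - x * jtheta (- (q ^ 3 * x ^ 2)) (q ^ 4))) UNIV"
  proof (rule has_sum_even_odd)
    show "((\<lambda>n. ?f (2 * n)) has_sum jtheta (- (q * x ^ 2)) (q ^ 4)) UNIV"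
      unfolding even using assms q by (intro series) auto
    show "((\<lambda>n. ?f (2 * n + 1)) has_sum - x * jtheta (- (q ^ 3 * x ^ 2)) (q ^ 4)) UNIV"
      unfolding odd using assms q by (intro has_sum_cmult_right series) auto
  qed
  then show ?thesis
    using jtheta_has_sum[OF assms] has_sum_unique by fastforce
qed

lemma jtheta_powi_nonzero:
  assumes "nome q" "m > 0" "\<not> int m dvd k"
  shows "jtheta (q powi k) (q ^ m) \<noteq> 0"
proof
  have q: "q \<noteq> 0" using assms by (auto simp: nome_def)
  assume "jtheta (q powi k) (q ^ m) = 0"
  then obtain n where "q powi k = (q ^ m) powi n"
    using jtheta_eq_0_iff[OF nome_power[OF assms(1,2)], of "q powi k"] q by auto
  also have "\<dots> = q powi (int m * n)"
    using power_int_mult[of q "int m" n] by simp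
  finally have "q powi (k - int m * n) = 1"
    using q by (simp add: power_int_diff)
  then show False
    using nome_powi_eq_1_iff[OF assms(1), of "k - int m * n"] assms(3) by auto
qed

lemma jtheta_minus_powi_nonzero:
  assumes "nome q" "m > 0"
  shows "jtheta (- (q powi k)) (q ^ m) \<noteq> 0"
proof
  have q: "q \<noteq> 0" using assms by (auto simp: nome_def)
  assume "jtheta (- (q powi k)) (q ^ m) = 0"
  then obtain n where "- (q powi k) = (q ^ m) powi n"
    using jtheta_eq_0_iff[OF nome_power[OF assms(1,2)], of "- (q powi k)"] q by auto
  also have "\<dots> = q powi (int m * n)"
    using power_int_mult[of q "int m" n] by simp
  finally have "q powi k = - (q powi (int m * n))"
    by (metis minus_minus)
  then have *: "q powi (k - int m * n) = - 1"
    using q by (simp add: power_int_diff)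
  then have "q powi ((k - int m * n) * 2) = 1"
    by (simp only: power_int_mult) simp
  then have "k - int m * n = 0"
    using nome_powi_eq_1_iff[OF assms(1), of "(k - int m * n) * 2"] by simp
  then show False using * by simp
qed

text \<open>For \<open>i < 5\<close> this is \<open>j(x;q) / j(q^i x; q^5)\<close>, written as the
  product over the other four residues so that it makes sense at the zeros of the denominator
  too.\<close>

definition theta_cofactor :: "complex \<Rightarrow> nat \<Rightarrow> complex \<Rightarrow> complex" where
  "theta_cofactor q i x = qpoch_inf q q / qpoch_inf (q ^ 5) (q ^ 5) ^ 5 *
    (\<Prod>l\<in>{..<5} - {i}. jtheta (q ^ l * x) (q ^ 5))"

lemma theta_cofactor_mult:
  assumes "nome q" "x \<noteq> 0" "i < 5"
  shows "theta_cofactor q i x * jtheta (q ^ i * x) (q ^ 5) = jtheta x q"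
proof -
  have "(\<Prod>l<5. jtheta (q ^ l * x) (q ^ 5)) =
      jtheta (q ^ i * x) (q ^ 5) * (\<Prod>l\<in>{..<5} - {i}. jtheta (q ^ l * x) (q ^ 5))"
    using assms(3) by (intro prod.remove) auto
  moreover have "jtheta x q * qpoch_inf (q ^ 5) (q ^ 5) ^ 5 = (\<Prod>l<5. jtheta (q ^ l * x) (q ^ 5)) * qpoch_inf q q"
    using assms by (intro jtheta_section) auto
  moreover have "qpoch_inf (q ^ 5) (q ^ 5) \<noteq> 0"
    using assms by (intro qpoch_inf_self_nonzero nome_power) auto
  ultimately show ?thesis
    by (simp add: theta_cofactor_def field_simps)
qed

lemma theta_cofactor_shift:
  assumes "nome q" "x \<noteq> 0" "i < 5"
  shows "q ^ 10 * x ^ 4 * theta_cofactor q i (q ^ 5 * x) = q ^ i * theta_cofactor q i x"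
proof -
  have q: "q \<noteq> 0" using assms by (auto simp: nome_def)
  have q5: "nome (q ^ 5)" using assms by (auto intro: nome_power)
  define P where "P = (\<Prod>l\<in>{..<5} - {i}. - (q ^ l * x))"
  have "(\<Prod>l<5. - (q ^ l * x)) = - (q ^ i * x) * P"
    unfolding P_def using assms(3) by (intro prod.remove) auto
  \<comment> \<open>The exponent is \<open>0 + 1 + 2 + 3 + 4 = 10\<close>.\<close>
  moreover have "(\<Prod>l<5. - (q ^ l * x)) = - (q ^ 10 * x ^ 5)"
    by (simp add: numeral_eq_Suc algebra_simps)
  ultimately have "x * (q ^ 10 * x ^ 4) = x * (q ^ i * P)"
    by (simp add: numeral_eq_Suc algebra_simps)
  then have P: "q ^ 10 * x ^ 4 = q ^ i * P"
    using assms(2) by simp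
  have "P * (\<Prod>l\<in>{..<5} - {i}. jtheta (q ^ l * (q ^ 5 * x)) (q ^ 5)) =
      (\<Prod>l\<in>{..<5} - {i}. jtheta (q ^ l * x) (q ^ 5))"
    unfolding P_def prod.distrib[symmetric]
  proof (rule prod.cong[OF refl])
    fix l
    have "jtheta (q ^ 5 * (q ^ l * x)) (q ^ 5) = - jtheta (q ^ l * x) (q ^ 5) / (q ^ l * x)"
      using jtheta_shift[OF q5, of "q ^ l * x"] q assms(2) by simp
    then show "- (q ^ l * x) * jtheta (q ^ l * (q ^ 5 * x)) (q ^ 5) = jtheta (q ^ l * x) (q ^ 5)"
      using q assms(2) by (simp add: mult_ac)
  qed
  then have "P * theta_cofactor q i (q ^ 5 * x) = theta_cofactor q i x"
    by (simp add: theta_cofactor_def mult_ac)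
  then show ?thesis
    unfolding P by (simp add: mult.assoc)
qed

lemma theta_cofactor_reflect:
  assumes "nome q" "x \<noteq> 0" "i < 5"
  shows "theta_cofactor q i (q / x) = theta_cofactor q (4 - i) x"
proof -
  have q: "q \<noteq> 0" using assms by (auto simp: nome_def)
  have q5: "nome (q ^ 5)" using assms by (auto intro: nome_power)
  have "(\<Prod>l\<in>{..<5} - {i}. jtheta (q ^ l * (q / x)) (q ^ 5)) =
    (\<Prod>l\<in>{..<5} - {4 - i}. jtheta (q ^ l * x) (q ^ 5))"
  proof (rule prod.reindex_bij_witness[of _ "\<lambda>l. 4 - l" "\<lambda>l. 4 - l"])
    fix l assume l: "l \<in> {..<5} - {i}"
    have "5 = (4 - l) + Suc l"
      using l by auto
    then have "q ^ 5 = q ^ (4 - l) * q ^ Suc l"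
      by (metis power_add)
    then have "q ^ 5 / (q ^ (4 - l) * x) = q ^ l * (q / x)"
      using q by simp
    then show "jtheta (q ^ (4 - l) * x) (q ^ 5) = jtheta (q ^ l * (q / x)) (q ^ 5)"
      using jtheta_reflect[OF q5, of "q ^ (4 - l) * x"] q assms(2) by simp
  qed (use assms(3) in auto)
  then show ?thesis
    by (simp add: theta_cofactor_def)
qed

lemma theta_cofactor_holomorphic:
  assumes "nome q"
  shows "theta_cofactor q i holomorphic_on (- {0})"
proof -
  have "norm (q ^ 5) < 1" "q \<noteq> 0"
    using nome_norm[OF nome_power[OF assms, of 5]] nome_nonzero[OF assms] by auto
  then have "(\<lambda>x. theta_cofactor q i x) holomorphic_on (- {0})"
    unfolding theta_cofactor_def by (intro holomorphic_intros) auto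
  then show ?thesis by simp
qed

text \<open>Since \<open>j(x;q)\<close> vanishes at all poles of \<open>m(q\<^sup>3/x, q\<^sup>5, q\<^bsup>2-i\<^esup>)\<close>, the product of
  the two extends holomorphically to all \<open>x \<noteq> 0\<close>; this is the extension.\<close>

definition theta_appell :: "complex \<Rightarrow> nat \<Rightarrow> complex \<Rightarrow> complex" where
  "theta_appell q i x = - (q powi (2 - int i)) / jtheta (q powi (2 - int i)) (q ^ 5) *
    appell_num (q ^ 5 / (q ^ i * x)) (q powi (2 - int i)) (q ^ 5) * theta_cofactor q i x"

lemma jtheta_offset_nonzero:
  assumes "nome q" "i < 5" "i \<noteq> 2"
  shows "jtheta (q powi (2 - int i)) (q ^ 5) \<noteq> 0"
proof (rule jtheta_powi_nonzero[OF assms(1)])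
  have "i \<in> {0, 1, 3, 4}" using assms by auto
  then show "\<not> int 5 dvd (2 - int i)" by auto
qed simp

lemma powi_offset: "q \<noteq> 0 \<Longrightarrow> q powi (2 - int i) * q ^ i = (q :: complex) ^ 2"
  by (simp add: power_int_diff)

lemma theta_appell_eq:
  assumes "nome q" "x \<noteq> 0" "i < 5" "jtheta (q ^ i * x) (q ^ 5) \<noteq> 0"
  shows "theta_appell q i x = jtheta x q * appell_m (q ^ 3 / x) (q ^ 5) (q powi (2 - int i))"
proof -
  have q: "q \<noteq> 0" using assms by (auto simp: nome_def)
  have q5: "nome (q ^ 5)" using assms by (auto intro: nome_power)
  have "q ^ 3 * (q powi (2 - int i) * q ^ i) = q ^ 5"
    unfolding powi_offset[OF q] by (simp flip: power_add)
  then have arg: "q ^ 3 / x * q powi (2 - int i) = q ^ 5 / (q ^ i * x)"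
    using q assms(2) by (simp add: field_simps)
  have "jtheta (q ^ 5 / (q ^ i * x)) (q ^ 5) = jtheta (q ^ i * x) (q ^ 5)"
    using jtheta_reflect[OF q5] q assms(2) by simp
  then show ?thesis
    unfolding theta_appell_def appell_m_def arg theta_cofactor_mult[OF assms(1-3), symmetric]
    using assms(4) by simp
qed

lemma appell_num_unshift:
  assumes "nome q" "y \<noteq> 0" "z \<noteq> 0"
  shows "appell_num (1 / y) z q = z * appell_num (q / y) z q + jtheta y q * jtheta z q"
  using appell_num_shift[OF assms(1), of "1 / y" z] jtheta_inverse[OF assms(1,2)] assms(2,3)
  by (simp add: field_simps)

text \<open>The argument of the numerator moves by one period. The extra theta term this creates
  meets the cofactor and becomes \<open>j(x;q)\<close>, the same for every \<open>i\<close>, as the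
  comparison with the Hecke series demands.\<close>

lemma theta_appell_shift:
  assumes "nome q" "x \<noteq> 0" "i < 5" "i \<noteq> 2"
  shows "theta_appell q i x = jtheta x q + q ^ 8 * x ^ 4 * theta_appell q i (q ^ 5 * x)"
proof -
  have q: "q \<noteq> 0" using assms by (auto simp: nome_def)
  have q5: "nome (q ^ 5)" using assms by (auto intro: nome_power)
  define z where "z = q powi (2 - int i)"
  define N where "N = appell_num (q ^ 5 / (q ^ i * x)) z (q ^ 5)"
  have z: "z \<noteq> 0" "jtheta z (q ^ 5) \<noteq> 0"
    using jtheta_offset_nonzero[OF assms(1,3,4)] q by (auto simp: z_def)
  have zi: "z * q ^ i = q ^ 2"
    unfolding z_def by (rule powi_offset[OF q])
  have "q ^ 5 / (q ^ i * (q ^ 5 * x)) = 1 / (q ^ i * x)"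
    using q by simp
  then have "q ^ 10 * x ^ 4 * theta_appell q i (q ^ 5 * x) =
      - z / jtheta z (q ^ 5) * appell_num (1 / (q ^ i * x)) z (q ^ 5) * (q ^ 10 * x ^ 4 * theta_cofactor q i (q ^ 5 * x))"
    by (simp add: theta_appell_def z_def mult_ac)
  also have "\<dots> = - (z * q ^ i) / jtheta z (q ^ 5) * (z * N + jtheta (q ^ i * x) (q ^ 5) * jtheta z (q ^ 5)) * theta_cofactor q i x"
    unfolding theta_cofactor_shift[OF assms(1-3)] N_def
    using appell_num_unshift[OF q5, of "q ^ i * x" z] q assms(2) z by simp
  also have "\<dots> = q ^ 2 * (theta_appell q i x - theta_cofactor q i x * jtheta (q ^ i * x) (q ^ 5))"
    unfolding zi using z by (simp add: theta_appell_def N_def z_def[symmetric] field_simps)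
  also have "theta_cofactor q i x * jtheta (q ^ i * x) (q ^ 5) = jtheta x q"
    by (rule theta_cofactor_mult[OF assms(1-3)])
  finally have "q ^ 2 * (q ^ 8 * x ^ 4 * theta_appell q i (q ^ 5 * x)) = q ^ 2 * (theta_appell q i x - jtheta x q)"
    by (simp add: mult.assoc[symmetric] power_add[symmetric])
  then show ?thesis
    using q by simp
qed

text \<open>Inverting both arguments of the numerator replaces \<open>z\<close> by
  \<open>1 / z\<close>, that is, \<open>i\<close> by \<open>4 - i\<close>; one step of the shift
  equation then restores the argument and contributes the theta term.\<close>

lemma theta_appell_reflect:
  assumes "nome q" "x \<noteq> 0" "i < 5" "i \<noteq> 2"
  shows "theta_appell q i (q / x) = jtheta x q - theta_appell q (4 - i) x"
proof -
  have q: "q \<noteq> 0" using assms by (auto simp: nome_def)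
  have q5: "nome (q ^ 5)" using assms by (auto intro: nome_power)
  define z where "z = q powi (2 - int i)"
  define k where "k = 4 - i"
  define N where "N = appell_num (q ^ 5 / (q ^ k * x)) (1 / z) (q ^ 5)"
  have k: "k < 5" "2 - int k = - (2 - int i)" using assms(3) by (auto simp: k_def)
  have z: "z \<noteq> 0" "jtheta z (q ^ 5) \<noteq> 0"
    using jtheta_offset_nonzero[OF assms(1,3,4)] q by (auto simp: z_def)
  have zk: "q powi (2 - int k) = 1 / z"
    unfolding k z_def power_int_minus by (rule inverse_eq_divide)
  have "5 = k + Suc i"
    using assms(3) by (auto simp: k_def)
  then have "q ^ 5 = q ^ k * q ^ Suc i"
    by (metis power_add)
  then have "q ^ 5 / (q ^ i * (q / x)) = q ^ k * x"
    using q by (simp add: field_simps)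
  then have "theta_appell q i (q / x) = - z / jtheta z (q ^ 5) * appell_num (q ^ k * x) z (q ^ 5) * theta_cofactor q k x"
    using theta_cofactor_reflect[OF assms(1-3)] by (simp add: theta_appell_def z_def k_def)
  also have "appell_num (q ^ k * x) z (q ^ 5) = appell_num (1 / (q ^ k * x)) (1 / z) (q ^ 5)"
    by (rule appell_num_inverse[OF q5, symmetric])
  also have "\<dots> = 1 / z * N + jtheta (q ^ k * x) (q ^ 5) * jtheta (1 / z) (q ^ 5)"
    unfolding N_def using q assms(2) z by (intro appell_num_unshift q5) auto
  also have "- z / jtheta z (q ^ 5) * \<dots> * theta_cofactor q k x =
      theta_cofactor q k x * jtheta (q ^ k * x) (q ^ 5) - N / jtheta z (q ^ 5) * theta_cofactor q k x"
    unfolding jtheta_inverse[OF q5 z(1)] using z by (simp add: field_simps)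
  also have "N / jtheta z (q ^ 5) * theta_cofactor q k x = theta_appell q k x"
    unfolding theta_appell_def zk N_def jtheta_inverse[OF q5 z(1)] using z by (simp add: field_simps)
  also have "theta_cofactor q k x * jtheta (q ^ k * x) (q ^ 5) = jtheta x q"
    by (rule theta_cofactor_mult[OF assms(1,2) k(1)])
  finally show ?thesis
    by (simp add: k_def)
qed

lemma theta_appell_holomorphic:
  assumes "nome q"
  shows "theta_appell q i holomorphic_on (- {0})"
proof -
  have q: "q \<noteq> 0" using assms by (auto simp: nome_def)
  have q5: "nome (q ^ 5)" using assms by (auto intro: nome_power)
  have z: "q powi (2 - int i) \<noteq> 0" using q by simp
  have "(\<lambda>x. q ^ 5 / (q ^ i * x)) holomorphic_on (- {0})"
    using q by (intro holomorphic_intros) auto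
  moreover have "(\<lambda>x. q ^ 5 / (q ^ i * x)) ` (- {0}) \<subseteq> - {0}"
    using q by auto
  ultimately have "(\<lambda>x. appell_num (q ^ 5 / (q ^ i * x)) (q powi (2 - int i)) (q ^ 5)) holomorphic_on (- {0})"
    using holomorphic_on_compose_gen[OF _ appell_num_holomorphic[OF q5 z], of "\<lambda>x. q ^ 5 / (q ^ i * x)" "- {0}"]
    unfolding o_def by blast
  then have "(\<lambda>x. theta_appell q i x) holomorphic_on (- {0})"
    unfolding theta_appell_def using theta_cofactor_holomorphic[OF assms]
    by (intro holomorphic_on_mult holomorphic_on_const) auto
  then show ?thesis by simp
qed

text \<open>Reflection exchanges \<open>i\<close> and \<open>4 - i\<close>, so only the sum of the
  two satisfies a reflection equation by itself. With \<open>k = 2 - i\<close> these are the Appell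
  functions with \<open>z\<close> equal to \<open>q ^ k\<close> and its inverse.\<close>

definition theta_appell_sym :: "complex \<Rightarrow> nat \<Rightarrow> complex \<Rightarrow> complex" where
  "theta_appell_sym q i x = theta_appell q i x + theta_appell q (4 - i) x"

lemma theta_appell_sym_shift:
  assumes "nome q" "x \<noteq> 0" "i < 2"
  shows "theta_appell_sym q i x = 2 * jtheta x q + q ^ 8 * x ^ 4 * theta_appell_sym q i (q ^ 5 * x)"
  using theta_appell_shift[OF assms(1,2), of i] theta_appell_shift[OF assms(1,2), of "4 - i"] assms(3)
  by (simp add: theta_appell_sym_def algebra_simps)

lemma theta_appell_sym_reflect:
  assumes "nome q" "x \<noteq> 0" "i < 2"
  shows "theta_appell_sym q i (q / x) = 2 * jtheta x q - theta_appell_sym q i x"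
  using theta_appell_reflect[OF assms(1,2), of i] theta_appell_reflect[OF assms(1,2), of "4 - i"] assms(3)
  by (simp add: theta_appell_sym_def)

lemma theta_appell_sym_holomorphic:
  assumes "nome q" "f holomorphic_on A" "\<And>x. x \<in> A \<Longrightarrow> f x \<noteq> 0"
  shows "(\<lambda>x. theta_appell_sym q i (f x)) holomorphic_on A"
proof -
  have *: "(\<lambda>x. theta_appell q k (f x)) holomorphic_on A" for k
  proof -
    have "f ` A \<subseteq> - {0}" using assms(3) by auto
    from holomorphic_on_compose_gen[OF assms(2) theta_appell_holomorphic[OF assms(1), of k] this]
    show ?thesis by (simp add: o_def)
  qed
  show ?thesis
    unfolding theta_appell_sym_def by (intro holomorphic_on_add *)
qed

text \<open>The symmetry \<open>s \<mapsto> q/s\<close> forces \<open>D\<close> to vanish wherever \<open>s\<^sup>4 = q\<^sup>2\<close>, hence at all zeros of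
  \<open>j(s\<^sup>4/q\<^sup>2; q\<^bsup>20\<^esup>)\<close>; but the multipliers of the two under \<open>s \<mapsto> q\<^sup>5 s\<close> do not match.\<close>

lemma theta_symmetric_eq_0:
  assumes q: "nome q" and hol: "D holomorphic_on (- {0})"
    and even: "\<And>s. s \<noteq> 0 \<Longrightarrow> D (- s) = D s"
    and shift: "\<And>s. s \<noteq> 0 \<Longrightarrow> D s = q ^ 8 * s ^ 4 * D (q ^ 5 * s)"
    and reflect: "\<And>s. s \<noteq> 0 \<Longrightarrow> D (q / s) = - D s"
    and "s \<noteq> 0"
  shows "D s = 0"
proof -
  have q0: "q \<noteq> 0" "norm q < 1" using q by (auto simp: nome_def)
  have q5: "nome (q ^ 5)" and q10: "nome (q ^ 10)" and q20: "nome (q ^ 20)"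
    using q by (auto intro: nome_power)
  \<comment> \<open>Division by \<open>s ^ 2\<close> gives the comparison function the multiplier of
    \<open>D\<close> up to sign.\<close>
  define g where "g = (\<lambda>s. jtheta (s ^ 4 / q ^ 2) (q ^ 20) / s ^ 2)"
  have gh: "g holomorphic_on (- {0})"
    unfolding g_def using q0 nome_norm[OF q20] by (intro holomorphic_intros) auto
  have gm: "g s = - (q ^ 8 * s ^ 4) * g (q ^ 5 * s)" if s: "s \<noteq> 0" for s
  proof -
    have "(q ^ 5 * s) ^ 4 / q ^ 2 = q ^ 20 * (s ^ 4 / q ^ 2)"
      by (simp add: power_mult_distrib power_mult[symmetric])
    then have "jtheta ((q ^ 5 * s) ^ 4 / q ^ 2) (q ^ 20) = - jtheta (s ^ 4 / q ^ 2) (q ^ 20) / (s ^ 4 / q ^ 2)"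
      using jtheta_shift[OF q20, of "s ^ 4 / q ^ 2"] s q0 by simp
    then have "g (q ^ 5 * s) = - jtheta (s ^ 4 / q ^ 2) (q ^ 20) / (s ^ 4 / q ^ 2) / (q ^ 5 * s) ^ 2"
      by (simp add: g_def)
    also have "\<dots> = - (g s) / (q ^ 8 * s ^ 4)"
    proof -
      have *: "(q ^ 5 * s) ^ 2 = q ^ 2 * q ^ 8 * s ^ 2"
        by (simp add: power_mult_distrib power_mult[symmetric] power_add[symmetric])
      show ?thesis
        unfolding * using q0 s by (simp add: g_def field_simps)
    qed
    finally show ?thesis
      using q0 s by simp
  qed
  \<comment> \<open>Over two steps, from \<open>s\<close> to \<open>q ^ 10 * s\<close>, the opposite
    signs cancel and the multipliers of \<open>D\<close> and \<open>g\<close> agree. Proportionality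
    is therefore proved with period \<open>q ^ 10\<close>.\<close>
  define m where "m = (\<lambda>s. q ^ 8 * s ^ 4 * (q ^ 8 * (q ^ 5 * s) ^ 4))"
  have q55: "q ^ 10 * s = q ^ 5 * (q ^ 5 * s)" for s
    by (simp add: mult.assoc[symmetric] power_add[symmetric])
  have Dm2: "D s = m s * D (q ^ 10 * s)" if "s \<noteq> 0" for s
  proof -
    have "q ^ 5 * s \<noteq> 0" using that q0 by simp
    from shift[OF this] have "D (q ^ 5 * s) = q ^ 8 * (q ^ 5 * s) ^ 4 * D (q ^ 10 * s)"
      by (simp only: q55)
    then show ?thesis
      by (simp only: shift[OF that] m_def mult.assoc)
  qed
  have gm2: "g s = m s * g (q ^ 10 * s)" if "s \<noteq> 0" for s
  proof -
    have "q ^ 5 * s \<noteq> 0" using that q0 by simp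
    from gm[OF this] have "g (q ^ 5 * s) = - (q ^ 8 * (q ^ 5 * s) ^ 4) * g (q ^ 10 * s)"
      by (simp only: q55)
    then show ?thesis
      by (simp only: gm[OF that] m_def) simp
  qed
  have zeros: "D s = 0 \<and> deriv g s \<noteq> 0" if s: "s \<noteq> 0" and gs: "g s = 0" for s
  proof
    have j0: "jtheta (s ^ 4 / q ^ 2) (q ^ 20) = 0"
      using gs s by (simp add: g_def)
    then obtain n where n: "s ^ 4 / q ^ 2 = (q ^ 20) powi n"
      using jtheta_eq_0_iff[OF q20, of "s ^ 4 / q ^ 2"] s q0 by auto
    define t where "t = s / (q ^ 5) powi n"
    have t: "t \<noteq> 0" "s = (q ^ 5) powi n * t" using s q0 by (auto simp: t_def)
    have "((q ^ 5) powi n) ^ 4 = (q ^ 20) powi n"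
    proof -
      have "((q ^ 5) powi n) ^ 4 = ((q ^ 5) ^ 4) powi n"
        by (simp add: power_int_power power_int_power' mult.commute)
      then show ?thesis by (simp flip: power_mult)
    qed
    then have "t ^ 4 = q ^ 2"
      using n q0 by (simp add: t_def power_divide field_simps)
    then have "(t ^ 2) ^ 2 = q ^ 2"
      by simp
    then consider "q = t * t" | "q = - (t * t)"
      unfolding power2_eq_iff by (auto simp: power2_eq_square)
    then have "q / t = t \<or> q / t = - t"
      using t by cases (auto simp: field_simps)
    then have "D t = - D t"
      using reflect[OF t(1)] even[OF t(1)] by auto
    then have "D t = 0" by simp
    moreover have "D ((q ^ 5) powi n * t) = 0 \<longleftrightarrow> D t = 0"
      by (rule multiplier_zero_iff[where m = "\<lambda>s. q ^ 8 * s ^ 4", OF q5 _ shift t(1)]) (use q0 in auto)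
    ultimately show "D s = 0"
      by (simp only: t(2))
    obtain d where d: "((\<lambda>v. jtheta v (q ^ 20)) has_field_derivative d) (at (s ^ 4 / q ^ 2))" "d \<noteq> 0"
      using jtheta_deriv_nonzero[OF q20 _ j0] s q0 by auto
    have "((\<lambda>s. jtheta (s ^ 4 / q ^ 2) (q ^ 20)) has_field_derivative d * (4 * s ^ 3 / q ^ 2)) (at s)"
      by (rule DERIV_chain2[where f = "\<lambda>v. jtheta v (q ^ 20)" and g = "\<lambda>s. s ^ 4 / q ^ 2"], rule d(1))
         (intro DERIV_cdivide, auto intro!: derivative_eq_intros)
    then have "(g has_field_derivative d * (4 * s ^ 3 / q ^ 2) / s ^ 2) (at s)"
      unfolding g_def using s j0
      by (auto intro!: derivative_eq_intros simp: field_simps power2_eq_square)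
    then show "deriv g s \<noteq> 0"
      using DERIV_imp_deriv d(2) s q0 by fastforce
  qed
  obtain c where c: "\<And>x. x \<noteq> 0 \<Longrightarrow> D x = c * g x"
    using same_multiplier_proportional[where m = m, OF hol gh q10 Dm2 gm2 zeros] by blast
  \<comment> \<open>Back to a single step: the sign mismatch now gives
    \<open>c * g s = - (c * g s)\<close>.\<close>
  have "D s = q ^ 8 * s ^ 4 * (c * g (q ^ 5 * s))"
    using shift[OF assms(6)] c[of "q ^ 5 * s"] assms(6) q0 by simp
  also have "\<dots> = - (c * g s)"
    using gm[OF assms(6)] by (simp add: mult_ac)
  finally show ?thesis
    using c[OF assms(6)] by simp
qed

text \<open>The inhomogeneous terms agree because \<open>j(s;q) + j(- s;q)\<close> is twice the even
  part of the theta series, a theta function of base \<open>q ^ 4\<close> in \<open>s ^ 2\<close>.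
  Adding the value at \<open>- s\<close> also makes the difference even, as
  \<open>theta_symmetric_eq_0\<close> requires.\<close>

theorem hecke_series_square_appell:
  assumes "nome q" "s \<noteq> 0" "i < 2"
  shows "2 * hecke_series (s ^ 2 / q) (q ^ 2) = theta_appell_sym q i s + theta_appell_sym q i (- s)"
proof -
  have q0: "q \<noteq> 0" using assms by (auto simp: nome_def)
  have q2: "nome (q ^ 2)" using assms by (auto intro: nome_power)
  define D where "D = (\<lambda>s. 2 * hecke_series (s ^ 2 / q) (q ^ 2) - (theta_appell_sym q i s + theta_appell_sym q i (- s)))"
  have th: "2 * jtheta (- (q ^ 2) * (s ^ 2 / q)) ((q ^ 2) ^ 2) = jtheta s q + jtheta (- s) q" if "s \<noteq> 0" for s
  proof -
    have "- (q ^ 2) * (s ^ 2 / q) = - (q * s ^ 2)"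
      using q0 by (simp add: power2_eq_square)
    moreover have "(q ^ 2) ^ 2 = q ^ 4"
      by (simp flip: power_mult)
    ultimately show ?thesis
      using jtheta_even_odd[OF assms(1) that] jtheta_even_odd[OF assms(1), of "- s"] that by simp
  qed
  have "D s = 0"
  proof (rule theta_symmetric_eq_0[OF assms(1), of D])
    have "(\<lambda>s. s ^ 2 / q) holomorphic_on (- {0})"
      using q0 by (intro holomorphic_intros) auto
    moreover have "(\<lambda>s. s ^ 2 / q) ` (- {0}) \<subseteq> - {0}"
      using q0 by auto
    ultimately have "(\<lambda>s. hecke_series (s ^ 2 / q) (q ^ 2)) holomorphic_on (- {0})"
      using holomorphic_on_compose_gen[OF _ hecke_series_holomorphic[OF q2], of "\<lambda>s. s ^ 2 / q" "- {0}"]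
      unfolding o_def by blast
    then show "D holomorphic_on (- {0})"
      unfolding D_def
      by (intro holomorphic_intros theta_appell_sym_holomorphic assms(1)) auto
  next
    fix s :: complex assume s: "s \<noteq> 0"
    show "D (- s) = D s"
      by (simp add: D_def add.commute)
    have "hecke_series (s ^ 2 / q) (q ^ 2) = q ^ 8 * s ^ 4 * hecke_series ((q ^ 5 * s) ^ 2 / q) (q ^ 2) +
       (jtheta s q + jtheta (- s) q)"
    proof -
      have "(q ^ 2) ^ 5 * (s ^ 2 / q) ^ 2 = q ^ 8 * s ^ 4"
      proof -
        have "q ^ 10 / q ^ 2 = q ^ 8"
          using q0 by (subst power_diff[symmetric]) auto
        moreover have "(q ^ 2) ^ 5 * (s ^ 2 / q) ^ 2 = (q ^ 10 / q ^ 2) * s ^ 4"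
          by (simp add: power_divide flip: power_mult)
        ultimately show ?thesis by (simp only:)
      qed
      moreover have "(q ^ 2) ^ 5 * (s ^ 2 / q) = (q ^ 5 * s) ^ 2 / q"
        by (simp add: power_mult_distrib flip: power_mult)
      ultimately show ?thesis
        using hecke_series_shift[OF q2, of "s ^ 2 / q"] th[OF s] s q0 by simp
    qed
    then show "D s = q ^ 8 * s ^ 4 * D (q ^ 5 * s)"
      unfolding D_def
      using theta_appell_sym_shift[OF assms(1) s assms(3)] theta_appell_sym_shift[OF assms(1), of "- s", OF _ assms(3)] s
      by (simp add: algebra_simps)
    have "hecke_series ((q / s) ^ 2 / q) (q ^ 2) = jtheta s q + jtheta (- s) q - hecke_series (s ^ 2 / q) (q ^ 2)"
    proof -
      have "(q / s) ^ 2 / q = 1 / (s ^ 2 / q)"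
        using s q0 by (simp add: field_simps power2_eq_square)
      then show ?thesis
        using hecke_series_inverse[OF q2, of "s ^ 2 / q"] th[OF s] s q0 by simp
    qed
    moreover have "theta_appell_sym q i (- (q / s)) = 2 * jtheta (- s) q - theta_appell_sym q i (- s)"
      using theta_appell_sym_reflect[OF assms(1), of "- s", OF _ assms(3)] s by simp
    ultimately show "D (q / s) = - D s"
      by (simp add: D_def theta_appell_sym_reflect[OF assms(1) s assms(3)])
  qed (rule assms(2))
  then show ?thesis
    by (simp add: D_def)
qed

text \<open>The theta term in base \<open>q\<close> has nome \<open>q ^ 2\<close>, which calls for
  Appell functions of base \<open>q ^ 10\<close>, with shift \<open>q ^ 10\<close> instead of
  \<open>q ^ 5\<close>. Adding the value at half a period, with the multiplier of
  \<open>hecke_series\<close> as weight, yields a function with the shift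
  \<open>q ^ 5\<close>.\<close>

theorem hecke_series_appell:
  assumes "nome q" "y \<noteq> 0" "i < 2"
  shows "hecke_series y q = theta_appell_sym (q ^ 2) i (- q * y) +
    q ^ 5 * y ^ 2 * theta_appell_sym (q ^ 2) i (- (q ^ 6) * y)"
proof -
  have q0: "q \<noteq> 0" using assms by (auto simp: nome_def)
  have q2: "nome (q ^ 2)" using assms by (auto intro: nome_power)
  let ?L = "theta_appell_sym (q ^ 2) i"
  define D where "D = (\<lambda>y. hecke_series y q - (?L (- q * y) + q ^ 5 * y ^ 2 * ?L (- (q ^ 6) * y)))"
  have sh: "?L (- q * y) = 2 * jtheta (- q * y) (q ^ 2) + q ^ 20 * y ^ 4 * ?L (- (q ^ 11) * y)" if "y \<noteq> 0" for y
  proof -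
    have 1: "(q ^ 2) ^ 8 * (- q * y) ^ 4 = q ^ 20 * y ^ 4"
    proof -
      have "q ^ 20 = (q ^ 2) ^ 8 * q ^ 4" by (simp flip: power_mult power_add)
      then show ?thesis by (simp only:) (simp add: power_mult_distrib)
    qed
    have 2: "(q ^ 2) ^ 5 * (- q * y) = - (q ^ 11) * y"
    proof -
      have "q ^ 11 = (q ^ 2) ^ 5 * q" by (simp flip: power_mult power_Suc2)
      then show ?thesis by (simp only:) (simp add: mult_ac)
    qed
    have "- q * y \<noteq> 0" using that q0 by simp
    from theta_appell_sym_shift[OF q2 this assms(3)] show ?thesis
      unfolding 1 2 .
  qed
  have Dshift: "D y = q ^ 5 * y ^ 2 * D (q ^ 5 * y)" if y: "y \<noteq> 0" for y
  proof -
    have a: "- q * (q ^ 5 * y) = - (q ^ 6) * y" "- (q ^ 6) * (q ^ 5 * y) = - (q ^ 11) * y"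
      by (simp_all flip: power_Suc mult.assoc power_add)
    have b: "q ^ 5 * y ^ 2 * (q ^ 5 * (q ^ 5 * y) ^ 2 * w) = q ^ 20 * y ^ 4 * w" for w
    proof -
      have "q ^ 5 * q ^ 5 * (q ^ 5) ^ 2 = q ^ 20" by (simp flip: power_mult power_add)
      then have "q ^ 20 * y ^ 4 * w = q ^ 5 * q ^ 5 * (q ^ 5) ^ 2 * (y ^ 2 * y ^ 2) * w"
        by (simp flip: power_add)
      then show ?thesis by (simp add: power_mult_distrib mult_ac)
    qed
    have "q ^ 5 * y ^ 2 * D (q ^ 5 * y) = q ^ 5 * y ^ 2 * hecke_series (q ^ 5 * y) q -
       q ^ 5 * y ^ 2 * ?L (- (q ^ 6) * y) - q ^ 5 * y ^ 2 * (q ^ 5 * (q ^ 5 * y) ^ 2 * ?L (- (q ^ 11) * y))"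
      unfolding D_def a by (simp add: algebra_simps)
    also have "\<dots> = D y"
      unfolding b D_def using hecke_series_shift[OF assms(1) y] sh[OF y] by simp
    finally show ?thesis ..
  qed
  have Dinv: "D (1 / y) = - D y" if y: "y \<noteq> 0" for y
  proof -
    have 1: "?L (- q * (1 / y)) = 2 * jtheta (- q * y) (q ^ 2) - ?L (- q * y)"
    proof -
      have "q ^ 2 / (- q * y) = - q * (1 / y)"
        using q0 by (simp add: power2_eq_square)
      then show ?thesis
        using theta_appell_sym_reflect[OF q2, of "- q * y" i] y q0 assms(3) by simp
    qed
    have 2: "?L (- (q ^ 6) * (1 / y)) = - (y ^ 4 * ?L (- (q ^ 6) * y))"
    proof -
      \<comment> \<open>Chosen so that reflection takes \<open>w\<close> to
        \<open>- (q ^ 6) * (1 / y)\<close> while the shift takes it to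
        \<open>- (q ^ 6) * y\<close>.\<close>
      define w where "w = - y / q ^ 4"
      have w: "w \<noteq> 0" using y q0 by (simp add: w_def)
      have "q ^ 2 / w = - (q ^ 6) * (1 / y)"
        using q0 y by (simp add: w_def field_simps flip: power_add)
      moreover have "(q ^ 2) ^ 8 * w ^ 4 = y ^ 4"
        using q0 by (simp add: w_def power_divide flip: power_mult)
      moreover have "(q ^ 2) ^ 5 * w = - (q ^ 6) * y"
      proof -
        have "q ^ 10 / q ^ 4 = q ^ 6"
          using q0 by (subst power_diff[symmetric]) auto
        moreover have "(q ^ 2) ^ 5 * w = - (q ^ 10 / q ^ 4) * y"
          by (simp add: w_def flip: power_mult)
        ultimately show ?thesis by (simp only:)
      qed
      ultimately show ?thesis
        using theta_appell_sym_reflect[OF q2 w assms(3)] theta_appell_sym_shift[OF q2 w assms(3)] by simp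
    qed
    have "(1 / y) ^ 2 * y ^ 4 = y ^ 2"
      using y by (simp add: power2_eq_square power4_eq_xxxx)
    then have "q ^ 5 * (1 / y) ^ 2 * (y ^ 4 * ?L (- (q ^ 6) * y)) = q ^ 5 * y ^ 2 * ?L (- (q ^ 6) * y)"
      by (metis mult.assoc)
    then show ?thesis
      unfolding D_def 1 2 hecke_series_inverse[OF assms(1) y] mult_minus_right by simp
  qed
  \<comment> \<open>Square roots of \<open>q\<close> and of \<open>r * y\<close> bring
    \<open>D\<close> into the form \<open>D (s ^ 2 / r)\<close>, which is even in \<open>s\<close>
    and has the multiplier expected by \<open>theta_symmetric_eq_0\<close> in base
    \<open>r\<close>.\<close>
  define r where "r = csqrt q"
  have r: "r ^ 2 = q" by (simp add: r_def)
  have r0: "r \<noteq> 0" using r q0 by auto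
  have "norm r < 1"
  proof -
    have "norm r ^ 2 < 1"
      using nome_norm[OF assms(1)] r by (metis norm_power)
    then show ?thesis by (simp add: power_less_one_iff)
  qed
  then have rn: "nome r" using r0 by (simp add: nome_def)
  have rq: "r ^ 10 = q ^ 5"
    unfolding r[symmetric] by (simp flip: power_mult)
  define s where "s = csqrt (r * y)"
  have s: "s ^ 2 / r = y" "s \<noteq> 0"
    using r0 assms(2) by (auto simp: s_def)
  have "D (s ^ 2 / r) = 0"
  proof (rule theta_symmetric_eq_0[OF rn, of "\<lambda>s. D (s ^ 2 / r)"])
    have inner: "(\<lambda>s. s ^ 2 / r) holomorphic_on (- {0})" "(\<lambda>s. s ^ 2 / r) ` (- {0}) \<subseteq> - {0}"
      using r0 by (auto intro!: holomorphic_intros)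
    have "D holomorphic_on (- {0})"
      unfolding D_def using q0
      by (intro holomorphic_intros theta_appell_sym_holomorphic q2 hecke_series_holomorphic assms(1)) auto
    then show "(\<lambda>s. D (s ^ 2 / r)) holomorphic_on (- {0})"
      using holomorphic_on_compose_gen[OF inner(1) _ inner(2), of D] unfolding o_def by blast
  next
    fix s :: complex assume s: "s \<noteq> 0"
    show "D ((- s) ^ 2 / r) = D (s ^ 2 / r)" by simp
    have "q ^ 5 * (s ^ 2 / r) ^ 2 = r ^ 8 * s ^ 4"
    proof -
      have "r ^ 10 / r ^ 2 = r ^ 8"
        using r0 by (subst power_diff[symmetric]) auto
      moreover have "q ^ 5 * (s ^ 2 / r) ^ 2 = (r ^ 10 / r ^ 2) * s ^ 4"
        by (simp add: rq power_divide flip: power_mult)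
      ultimately show ?thesis by (simp only:)
    qed
    moreover have "q ^ 5 * (s ^ 2 / r) = (r ^ 5 * s) ^ 2 / r"
      by (simp add: power_mult_distrib rq[symmetric] flip: power_mult)
    ultimately show "D (s ^ 2 / r) = r ^ 8 * s ^ 4 * D ((r ^ 5 * s) ^ 2 / r)"
      using Dshift[of "s ^ 2 / r"] s r0 by simp
    have "(r / s) ^ 2 / r = 1 / (s ^ 2 / r)"
      using s r0 by (simp add: field_simps power2_eq_square)
    then show "D ((r / s) ^ 2 / r) = - D (s ^ 2 / r)"
      using Dinv[of "s ^ 2 / r"] s r0 by simp
  qed (rule s(2))
  then show ?thesis
    unfolding s(1) by (simp add: D_def)
qed

section \<open>Specialisation to phi, psi and X\<close>

lemma jtheta_power_nonzero:
  assumes "nome q" "m > 0" "\<not> m dvd k"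
  shows "jtheta (q ^ k) (q ^ m) \<noteq> 0"
  using jtheta_powi_nonzero[OF assms(1,2), of "int k"] assms(3) by simp

lemma jtheta_minus_power_nonzero:
  assumes "nome q" "m > 0"
  shows "jtheta (- (q ^ k)) (q ^ m) \<noteq> 0"
  using jtheta_minus_powi_nonzero[OF assms, of "int k"] by simp

lemma jtheta_nome [simp]: "nome q \<Longrightarrow> jtheta q q = 0"
  using jtheta_reflect[of q 1] by simp

lemma theta_appell_sym_eq:
  assumes "nome q" "x \<noteq> 0" "i < 2" "z = q ^ (2 - i)"
    and "jtheta (q ^ i * x) (q ^ 5) \<noteq> 0" "jtheta (q ^ (4 - i) * x) (q ^ 5) \<noteq> 0"
  shows "theta_appell_sym q i x =
    jtheta x q * (appell_m (q ^ 3 / x) (q ^ 5) z + appell_m (q ^ 3 / x) (q ^ 5) (1 / z))"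
proof -
  have "2 - int i = int (2 - i)" "2 - int (4 - i) = - int (2 - i)"
    using assms(3) by auto
  then have "q powi (2 - int i) = z" "q powi (2 - int (4 - i)) = 1 / z"
    using assms(4) by (simp_all only: power_int_minus power_int_of_nat inverse_eq_divide)
  then show ?thesis
    using theta_appell_eq[OF assms(1,2) _ assms(5)] theta_appell_eq[OF assms(1,2) _ assms(6)] assms(3)
    by (simp add: theta_appell_sym_def algebra_simps)
qed

lemma jtheta_odd_power:
  assumes "nome q"
  shows "jtheta (q ^ (2 * n + 1)) (q ^ 2) * q ^ (n * n) = (- 1) ^ n * jtheta q (q ^ 2)"
proof -
  have q0: "q \<noteq> 0" using assms by (rule nome_nonzero)
  have q2: "nome (q ^ 2)" using assms by (auto intro: nome_power)
  have "jtheta ((q ^ 2) ^ n * q) (q ^ 2) * ((q ^ 2) powi tri (int n) * q ^ n) = (- 1) ^ n * jtheta q (q ^ 2)"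
    using jtheta_powi_shift[OF q2 q0, of "int n"] by simp
  moreover have "(q ^ 2) powi tri (int n) * q ^ n = q ^ (n * n)"
    using powi_square[OF q0, of "int n"] power_int_of_nat[of q "n * n"] by simp
  moreover have "(q ^ 2) ^ n * q = q ^ (2 * n + 1)"
    by (simp only: power_add power_mult power_one_right)
  ultimately show ?thesis by simp
qed

lemma qpoch_inf_even_odd:
  assumes "norm q < 1"
  shows "qpoch_inf x q = qpoch_inf x (q ^ 2) * qpoch_inf (q * x) (q ^ 2)"
  using qpoch_inf_section[OF assms, of 2 x] by (simp add: numeral_2_eq_2)

lemma qpoch_inf_euler:
  assumes "nome q"
  shows "qpoch_inf q (q ^ 2) * qpoch_inf (- q) q = 1"
proof -
  have "qpoch_inf (q ^ 2) (q ^ 2) \<noteq> 0"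
    using assms by (intro qpoch_inf_self_nonzero nome_power) auto
  moreover have "qpoch_inf q q = qpoch_inf q (q ^ 2) * qpoch_inf (q ^ 2) (q ^ 2)"
    using qpoch_inf_even_odd[OF nome_norm[OF assms], of q] by (simp add: power2_eq_square)
  moreover have "qpoch_inf q q * qpoch_inf (- q) q = qpoch_inf (q ^ 2) (q ^ 2)"
    by (rule qpoch_inf_mult_neg[OF nome_norm[OF assms]])
  ultimately show ?thesis
    by simp
qed

text \<open>The prefactor from the Bailey transform is the reciprocal of the theta value left by the
  Appell representation, so phi and psi contain Appell functions without theta coefficients.\<close>

lemma jtheta_prefactor:
  assumes "nome q"
  shows "qpoch_inf (- q) q / qpoch_inf q q * jtheta q (q ^ 2) = 1"
proof -
  have q0: "q \<noteq> 0" using assms by (rule nome_nonzero)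
  have "qpoch_inf q q = qpoch_inf q (q ^ 2) * qpoch_inf (q ^ 2) (q ^ 2)"
    using qpoch_inf_even_odd[OF nome_norm[OF assms], of q] by (simp add: power2_eq_square)
  moreover have "q ^ 2 / q = q" using q0 by (simp add: power2_eq_square)
  ultimately have "jtheta q (q ^ 2) = qpoch_inf q (q ^ 2) * qpoch_inf q q"
    by (simp add: jtheta_def)
  then show ?thesis
    using qpoch_inf_euler[OF assms] qpoch_inf_self_nonzero[OF assms] by (simp add: mult.commute)
qed

text \<open>At \<open>y = - q\<close> the two arguments are \<open>q ^ 2\<close> and
  \<open>q ^ 7\<close> in base \<open>q ^ 2\<close>. The first contributes nothing since
  \<open>j(q^2; q^2) = 0\<close>; the second gives Appell functions at \<open>1 / q\<close>, which
  inversion takes to \<open>q\<close>.\<close>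

theorem mock_phi_appell:
  assumes "nome q"
  shows "q * mock_phi q = - (appell_m q (q ^ 10) (q ^ 2) + appell_m q (q ^ 10) (1 / q ^ 2))"
proof -
  have q0: "q \<noteq> 0" using assms by (rule nome_nonzero)
  have q2: "nome (q ^ 2)" and q10: "nome (q ^ 10)" using assms by (auto intro: nome_power)
  let ?L = "theta_appell_sym (q ^ 2) 1"
  have "?L (q ^ 2) = 0"
    using theta_appell_sym_eq[OF q2, of "q ^ 2" 1 "q ^ 2"] q0 q2
      jtheta_power_nonzero[OF assms, of 10 4] jtheta_power_nonzero[OF assms, of 10 8]
    by (simp flip: power_mult power_add)
  moreover have "?L (q ^ 7) = jtheta (q ^ 7) (q ^ 2) * (appell_m (1 / q) (q ^ 10) (q ^ 2) + appell_m (1 / q) (q ^ 10) (1 / q ^ 2))"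
  proof -
    have "(q ^ 2) ^ 3 / q ^ 7 = 1 / q"
      using q0 by (simp add: field_simps flip: power_mult power_Suc)
    then show ?thesis
      using theta_appell_sym_eq[OF q2, of "q ^ 7" 1 "q ^ 2"] q0
        jtheta_power_nonzero[OF assms, of 10 9] jtheta_power_nonzero[OF assms, of 10 13]
      by (simp flip: power_mult power_add)
  qed
  moreover have "appell_m (1 / q) (q ^ 10) (q ^ 2) = q * appell_m q (q ^ 10) (1 / q ^ 2)"
    "appell_m (1 / q) (q ^ 10) (1 / q ^ 2) = q * appell_m q (q ^ 10) (q ^ 2)"
    using appell_m_inverse[OF q10, of q "1 / q ^ 2"] appell_m_inverse[OF q10, of q "q ^ 2"] q0 by simp_all
  moreover have "jtheta (q ^ 7) (q ^ 2) * q ^ 9 = - jtheta q (q ^ 2)"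
    using jtheta_odd_power[OF assms, of 3] by simp
  moreover have "hecke_series (- q) q = ?L (q ^ 2) + q ^ 7 * ?L (q ^ 7)"
    using hecke_series_appell[OF assms, of "- q" 1] q0 by (simp flip: power_add power_Suc2 power2_eq_square)
  moreover have "q * (0 + q ^ 7 * (j * (q * b + q * a))) = j * q ^ 9 * (a + b)" for a b j
    by (simp add: eval_nat_numeral algebra_simps)
  ultimately have "q * hecke_series (- q) q = - jtheta q (q ^ 2) * (appell_m q (q ^ 10) (q ^ 2) + appell_m q (q ^ 10) (1 / q ^ 2))"
    by (simp only:)
  moreover have "q * mock_phi q = qpoch_inf (- q) q / qpoch_inf q q * (q * hecke_series (- q) q)"
    unfolding mock_phi_hecke[OF assms] by (simp only: mult_ac)
  ultimately have "q * mock_phi q = - (qpoch_inf (- q) q / qpoch_inf q q * jtheta q (q ^ 2)) *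
      (appell_m q (q ^ 10) (q ^ 2) + appell_m q (q ^ 10) (1 / q ^ 2))"
    by (simp only: mult_minus_left mult_minus_right mult.assoc)
  then show ?thesis
    unfolding jtheta_prefactor[OF assms] by simp
qed

text \<open>The arguments are \<open>q ^ 4\<close> and \<open>q ^ 9\<close> in base
  \<open>q ^ 2\<close>, and the first contributes nothing. This uses \<open>i = 0\<close>: with
  \<open>i = 1\<close> the nonvanishing condition would fail at
  \<open>q ^ 6 * q ^ 4 = q ^ 10\<close>, where a pole compensates the zero of the theta
  factor.\<close>

theorem mock_psi_appell:
  assumes "nome q"
  shows "mock_psi q = - (appell_m (q ^ 3) (q ^ 10) (q ^ 4) + appell_m (q ^ 3) (q ^ 10) (1 / q ^ 4))"
proof -
  have q0: "q \<noteq> 0" using assms by (rule nome_nonzero)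
  have q2: "nome (q ^ 2)" and q10: "nome (q ^ 10)" using assms by (auto intro: nome_power)
  let ?L = "theta_appell_sym (q ^ 2) 0"
  have "jtheta (q ^ 4) (q ^ 2) = 0"
    using jtheta_shift[OF q2, of "q ^ 2"] q0 q2 by (simp flip: power_add)
  moreover have "?L (q ^ 4) = jtheta (q ^ 4) (q ^ 2) *
      (appell_m ((q ^ 2) ^ 3 / q ^ 4) ((q ^ 2) ^ 5) (q ^ 4) + appell_m ((q ^ 2) ^ 3 / q ^ 4) ((q ^ 2) ^ 5) (1 / q ^ 4))"
    by (rule theta_appell_sym_eq[OF q2])
       (use q0 jtheta_power_nonzero[OF assms, of 10 4] jtheta_power_nonzero[OF assms, of 10 12] in
         \<open>simp_all flip: power_mult power_add\<close>)
  ultimately have "?L (q ^ 4) = 0" by simp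
  moreover have "?L (q ^ 9) = jtheta (q ^ 9) (q ^ 2) * (appell_m (1 / q ^ 3) (q ^ 10) (q ^ 4) + appell_m (1 / q ^ 3) (q ^ 10) (1 / q ^ 4))"
  proof -
    have "(q ^ 2) ^ 3 / q ^ 9 = 1 / q ^ 3"
      using q0 by (simp add: frac_eq_eq flip: power_mult power_add)
    then show ?thesis
      using theta_appell_sym_eq[OF q2, of "q ^ 9" 0 "q ^ 4"] q0
        jtheta_power_nonzero[OF assms, of 10 9] jtheta_power_nonzero[OF assms, of 10 17]
      by (simp flip: power_mult power_add)
  qed
  moreover have "appell_m (1 / q ^ 3) (q ^ 10) (q ^ 4) = q ^ 3 * appell_m (q ^ 3) (q ^ 10) (1 / q ^ 4)"
    "appell_m (1 / q ^ 3) (q ^ 10) (1 / q ^ 4) = q ^ 3 * appell_m (q ^ 3) (q ^ 10) (q ^ 4)"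
    using appell_m_inverse[OF q10, of "q ^ 3" "1 / q ^ 4"] appell_m_inverse[OF q10, of "q ^ 3" "q ^ 4"] q0 by simp_all
  moreover have "jtheta (q ^ 9) (q ^ 2) * q ^ 16 = jtheta q (q ^ 2)"
    using jtheta_odd_power[OF assms, of 4] by simp
  moreover have "hecke_series (- (q ^ 3)) q = ?L (q ^ 4) + q ^ 11 * ?L (q ^ 9)"
    using hecke_series_appell[OF assms, of "- (q ^ 3)" 0] q0
    by (simp flip: power_add power_Suc power_mult)
  moreover have "q ^ 2 * (0 + q ^ 11 * (j * (q ^ 3 * b + q ^ 3 * a))) = j * q ^ 16 * (a + b)" for a b j
    by (simp add: eval_nat_numeral algebra_simps)
  ultimately have "q ^ 2 * hecke_series (- (q ^ 3)) q = jtheta q (q ^ 2) * (appell_m (q ^ 3) (q ^ 10) (q ^ 4) + appell_m (q ^ 3) (q ^ 10) (1 / q ^ 4))"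
    by (simp only:)
  moreover have "mock_psi q = - (qpoch_inf (- q) q / qpoch_inf q q * (q ^ 2 * hecke_series (- (q ^ 3)) q))"
    unfolding mock_psi_hecke[OF assms] by (simp only: mult_ac mult_minus_left mult_minus_right)
  ultimately have "mock_psi q = - (qpoch_inf (- q) q / qpoch_inf q q * jtheta q (q ^ 2)) *
      (appell_m (q ^ 3) (q ^ 10) (q ^ 4) + appell_m (q ^ 3) (q ^ 10) (1 / q ^ 4))"
    by (simp only: mult_minus_left mult_minus_right mult.assoc)
  then show ?thesis
    unfolding jtheta_prefactor[OF assms] by simp
qed

text \<open>The series is needed at \<open>s = q\<close> in
  \<open>hecke_series_square_appell\<close>. There \<open>j(q;q) = 0\<close> removes the
  contribution of \<open>s\<close>, and only that of \<open>- s\<close> remains; its theta factor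
  times the Bailey prefactor is 2.\<close>

theorem mock_X_appell:
  assumes "nome q"
  shows "mock_X q = appell_m (- (q ^ 2)) (q ^ 5) q + appell_m (- (q ^ 2)) (q ^ 5) (1 / q)"
proof -
  have q0: "q \<noteq> 0" using assms by (rule nome_nonzero)
  let ?L = "theta_appell_sym q 1"
  have "?L q = 0"
    using theta_appell_sym_eq[OF assms, of q 1 q] q0 assms
      jtheta_power_nonzero[OF assms, of 5 2] jtheta_power_nonzero[OF assms, of 5 4]
    by (simp flip: power_Suc2 power2_eq_square)
  moreover have "?L (- q) = jtheta (- q) q * (appell_m (- (q ^ 2)) (q ^ 5) q + appell_m (- (q ^ 2)) (q ^ 5) (1 / q))"
  proof -
    have "q ^ 3 / - q = - (q ^ 2)"
      using q0 by (simp add: power3_eq_cube power2_eq_square)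
    then show ?thesis
      using theta_appell_sym_eq[OF assms, of "- q" 1 q] q0
        jtheta_minus_power_nonzero[OF assms, of 5 2] jtheta_minus_power_nonzero[OF assms, of 5 4]
      by (simp flip: power_Suc2 power2_eq_square)
  qed
  moreover have "2 * hecke_series q (q ^ 2) = ?L q + ?L (- q)"
    using hecke_series_square_appell[OF assms q0, of 1] q0 by (simp add: power2_eq_square)
  moreover have "qpoch_inf q (q ^ 2) / qpoch_inf (q ^ 2) (q ^ 2) * jtheta (- q) q = 2"
  proof -
    have "qpoch_inf (- 1) q = 2 * qpoch_inf (- q) q"
      using qpoch_inf_step[OF nome_norm[OF assms], of "- 1"] by simp
    then have "jtheta (- q) q = 2 * qpoch_inf (- q) q * (qpoch_inf q q * qpoch_inf (- q) q)"
      using q0 by (simp add: jtheta_def mult_ac)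
    also have "qpoch_inf q q * qpoch_inf (- q) q = qpoch_inf (q ^ 2) (q ^ 2)"
      by (rule qpoch_inf_mult_neg[OF nome_norm[OF assms]])
    finally have "qpoch_inf q (q ^ 2) / qpoch_inf (q ^ 2) (q ^ 2) * jtheta (- q) q =
        2 * (qpoch_inf q (q ^ 2) * qpoch_inf (- q) q)"
      using qpoch_inf_self_nonzero[OF nome_power[OF assms, of 2]] by simp
    then show ?thesis
      unfolding qpoch_inf_euler[OF assms] by simp
  qed
  moreover have "2 * mock_X q = qpoch_inf q (q ^ 2) / qpoch_inf (q ^ 2) (q ^ 2) * (2 * hecke_series q (q ^ 2))"
    unfolding mock_X_hecke[OF assms] by simp
  ultimately have "2 * mock_X q = 2 * (appell_m (- (q ^ 2)) (q ^ 5) q + appell_m (- (q ^ 2)) (q ^ 5) (1 / q))"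
    by (metis add_0 mult.assoc)
  then show ?thesis by (simp only: mult_cancel_left) simp
qed

section \<open>Dissection of Appell functions\<close>

lemma jtheta_tri_has_sum:
  assumes "nome q" "c \<noteq> 0"
  shows "((\<lambda>n. q powi tri n * c powi n) has_sum jtheta (- c) q) UNIV"
  using jtheta_has_sum[OF assms(1), of "- c"] assms(2)
  by (simp add: mult.assoc mult.left_commute[of _ "q powi _"] neg_one_powi_uminus_mult)

text \<open>Split the double series by the parity of \<open>m + n\<close>. In the coordinates
  \<open>(a - b, a + b)\<close> and \<open>(a - b + 1, a + b)\<close> the quadratic form separates,
  and each part is a product of two theta series of base \<open>q ^ 2\<close>.\<close>

lemma jtheta_mult:
  assumes "nome q" "s \<noteq> 0" "t \<noteq> 0"
  shows "jtheta s q * jtheta t q =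
    jtheta (- (s * t)) (q ^ 2) * jtheta (- (q * (t / s))) (q ^ 2) -
    s * jtheta (- (q * (s * t))) (q ^ 2) * jtheta (- (t / s)) (q ^ 2)"
proof -
  have q: "q \<noteq> 0" using assms by (auto simp: nome_def)
  have q2: "nome (q ^ 2)" using assms by (auto intro: nome_power)
  define f where "f = (\<lambda>(m, n). ((- 1) powi m * q powi tri m * s powi m) * ((- 1) powi n * q powi tri n * t powi n))"
  have f: "(f has_sum (jtheta s q * jtheta t q)) (UNIV \<times> UNIV)"
    unfolding f_def using assms by (intro has_sum_times_banach jtheta_has_sum) auto
  have p2: "q powi (2 * k) = (q ^ 2) powi k" for k
    using power_int_mult[of q 2 k] by simp
  have sgn: "(- 1 :: complex) powi (a - b) * (- 1) powi (a + b) = 1" for a b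
  proof -
    have "(- 1 :: complex) powi (a - b) * (- 1) powi (a + b) = (- 1) powi (2 * a)"
      by (simp flip: power_int_add)
    also have "\<dots> = 1"
      using power_int_mult[of "- 1 :: complex" 2 a] by simp
    finally show ?thesis .
  qed
  define E O' where "E = (\<lambda>(a, b). (a - b, a + b)) ` (UNIV :: (int \<times> int) set)"
    and "O' = (\<lambda>(a, b). (a - b + 1, a + b)) ` (UNIV :: (int \<times> int) set)"
  have fE: "f (a - b, a + b) = ((q ^ 2) powi tri a * (s * t) powi a) * ((q ^ 2) powi tri b * (q * (t / s)) powi b)" for a b
  proof -
    have "tri (a - b) + tri (a + b) = 2 * tri a + 2 * tri b + b"
      using tri_add[of a b] tri_add[of a "- b"] tri_uminus[of b] by simp
    then have "q powi tri (a - b) * q powi tri (a + b) = (q ^ 2) powi tri a * (q ^ 2) powi tri b * q powi b"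
      using q by (simp add: p2[symmetric] flip: power_int_add)
    moreover have "s powi (a - b) * t powi (a + b) = (s * t) powi a * (t / s) powi b"
      using assms by (simp add: power_int_add power_int_diff power_int_mult_distrib power_int_divide_distrib)
    moreover have "f (a - b, a + b) = ((- 1) powi (a - b) * (- 1) powi (a + b)) *
        (q powi tri (a - b) * q powi tri (a + b)) * (s powi (a - b) * t powi (a + b))"
      by (simp add: f_def mult_ac)
    ultimately show ?thesis
      by (simp only: sgn power_int_mult_distrib[of q "t / s"]) (simp only: mult_ac mult_1_left)
  qed
  have fO: "f (a - b + 1, a + b) = - s * (((q ^ 2) powi tri a * (q * (s * t)) powi a) * ((q ^ 2) powi tri b * (t / s) powi b))" for a b
  proof -
    have "tri (a - b + 1) + tri (a + b) = 2 * tri a + 2 * tri b + a"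
      using tri_Suc[of "a - b"] tri_add[of a b] tri_add[of a "- b"] tri_uminus[of b] by simp
    then have "q powi tri (a - b + 1) * q powi tri (a + b) = (q ^ 2) powi tri a * (q ^ 2) powi tri b * q powi a"
      using q by (simp add: p2[symmetric] flip: power_int_add)
    moreover have "s powi (a - b + 1) * t powi (a + b) = s * ((s * t) powi a * (t / s) powi b)"
      using assms by (simp add: power_int_add power_int_diff power_int_mult_distrib power_int_divide_distrib)
    moreover have "f (a - b + 1, a + b) = ((- 1) powi (a - b + 1) * (- 1) powi (a + b)) *
        (q powi tri (a - b + 1) * q powi tri (a + b)) * (s powi (a - b + 1) * t powi (a + b))"
      by (simp add: f_def mult_ac)
    moreover have "(- 1 :: complex) powi (a - b + 1) * (- 1) powi (a + b) = - 1"
      using sgn[of a b] by (simp add: power_int_add)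
    ultimately show ?thesis
      by (simp only:) (simp add: power_int_mult_distrib mult_ac)
  qed
  have "(f has_sum (jtheta (- (s * t)) (q ^ 2) * jtheta (- (q * (t / s))) (q ^ 2))) E"
  proof -
    have "((\<lambda>(a, b). f (a - b, a + b)) has_sum (jtheta (- (s * t)) (q ^ 2) * jtheta (- (q * (t / s))) (q ^ 2))) (UNIV \<times> UNIV)"
      unfolding fE using assms q by (intro has_sum_times_banach jtheta_tri_has_sum q2) auto
    then show ?thesis
      unfolding E_def by (subst has_sum_reindex) (auto simp: inj_on_def o_def case_prod_unfold)
  qed
  moreover have "(f has_sum (- s * (jtheta (- (q * (s * t))) (q ^ 2) * jtheta (- (t / s)) (q ^ 2)))) O'"
  proof -
    have "((\<lambda>(a, b). ((q ^ 2) powi tri a * (q * (s * t)) powi a) * ((q ^ 2) powi tri b * (t / s) powi b))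
        has_sum (jtheta (- (q * (s * t))) (q ^ 2) * jtheta (- (t / s)) (q ^ 2))) (UNIV \<times> UNIV)"
      using assms q by (intro has_sum_times_banach jtheta_tri_has_sum q2) auto
    from has_sum_cmult_right[OF this, of "- s"]
    have "((\<lambda>(a, b). f (a - b + 1, a + b)) has_sum (- s * (jtheta (- (q * (s * t))) (q ^ 2) * jtheta (- (t / s)) (q ^ 2)))) (UNIV \<times> UNIV)"
      unfolding fO by (simp add: case_prod_unfold)
    then show ?thesis
      unfolding O'_def by (subst has_sum_reindex) (auto simp: inj_on_def o_def case_prod_unfold)
  qed
  moreover have "E \<inter> O' = {}"
    unfolding E_def O'_def by (auto; presburger)
  moreover have "E \<union> O' = UNIV \<times> UNIV"
  proof -
    have "(m, n) \<in> E \<union> O'" for m n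
    proof (cases "even (m + n)")
      case True
      then obtain a where "m + n = 2 * a" by blast
      then have "(m, n) = (\<lambda>(a, b). (a - b, a + b)) (a, n - a)" by auto
      then show ?thesis unfolding E_def by blast
    next
      case False
      then obtain a where "m + n = 2 * a + 1" using oddE by blast
      then have "(m, n) = (\<lambda>(a, b). (a - b + 1, a + b)) (a, n - a)" by auto
      then show ?thesis unfolding O'_def by blast
    qed
    then show ?thesis by auto
  qed
  ultimately have "(f has_sum (jtheta (- (s * t)) (q ^ 2) * jtheta (- (q * (t / s))) (q ^ 2) +
      - s * (jtheta (- (q * (s * t))) (q ^ 2) * jtheta (- (t / s)) (q ^ 2)))) (UNIV \<times> UNIV)"
    by (metis has_sum_Un_disjoint)
  then show ?thesis
    using has_sum_unique[OF f] by (simp add: mult.assoc)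
qed

text \<open>Splitting the Appell series by the parity of the index and writing
  \<open>1/(1 - a) = (1 + a)/(1 - a\<^sup>2)\<close> gives four Appell series for the base \<open>q\<^sup>4\<close>.\<close>

lemma appell_num_dissect:
  assumes "nome q" "u \<noteq> 0" "z \<noteq> 0" "jtheta u q \<noteq> 0"
    and j0: "jtheta (u ^ 2) (q ^ 4) \<noteq> 0" and j2: "jtheta (q ^ 2 * u ^ 2) (q ^ 4) \<noteq> 0"
  shows "appell_num u z q / jtheta u q =
    q ^ 3 * z ^ 2 * (appell_num (q ^ 4 * u ^ 2) (- (q ^ 3 * z ^ 2)) (q ^ 4) / jtheta (q ^ 4 * u ^ 2) (q ^ 4)) +
    u * (appell_num (u ^ 2) (- (q * z ^ 2)) (q ^ 4) / jtheta (u ^ 2) (q ^ 4)) -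
    q * z * (appell_num (q ^ 2 * u ^ 2) (- (q * z ^ 2)) (q ^ 4) / jtheta (q ^ 2 * u ^ 2) (q ^ 4)) -
    q ^ 2 * u * z * (appell_num (q ^ 2 * u ^ 2) (- (q ^ 3 * z ^ 2)) (q ^ 4) / jtheta (q ^ 2 * u ^ 2) (q ^ 4))"
proof -
  have q: "q \<noteq> 0" using assms by (auto simp: nome_def)
  have q4: "nome (q ^ 4)" using assms by (auto intro: nome_power)
  let ?A = "\<lambda>U Z. appell_num U Z (q ^ 4) / jtheta U (q ^ 4)"
  let ?f = "\<lambda>r. (- 1) powi r * q powi tri (r + 1) * z powi r / (1 - q powi r * u)"
  have j4: "jtheta (q ^ 4 * u ^ 2) (q ^ 4) \<noteq> 0"
    using jtheta_shift[OF q4, of "u ^ 2"] assms by simp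
  have S: "((\<lambda>k. (q ^ 4) powi tri (k + 1) * c powi k / (1 - (q ^ 4) powi k * U)) has_sum ?A U (- c)) UNIV"
    if "U \<noteq> 0" "c \<noteq> 0" "jtheta U (q ^ 4) \<noteq> 0" for U c
    using appell_series[OF q4 that(1) _ that(3), of "- c"] that(2)
    by (simp add: mult.assoc mult.left_commute[of _ "(q ^ 4) powi _"] neg_one_powi_uminus_mult)
  have m2: "(- 1 :: complex) powi (2 * k) = 1" for k
    using power_int_mult[of "- 1 :: complex" 2 k] by simp
  have p4: "q powi (4 * k) = (q ^ 4) powi k" and z2: "z powi (2 * k) = (z ^ 2) powi k" for k
    using power_int_mult[of q 4 k] power_int_mult[of z 2 k] by simp_all
  have q2k: "(q powi (2 * k)) ^ 2 = (q ^ 4) powi k" for k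
  proof -
    have "q powi (4 * k) = q powi (2 * k + 2 * k)" by simp
    also have "\<dots> = (q powi (2 * k)) ^ 2"
      using q by (simp only: power_int_add power2_eq_square simp_thms)
    finally show ?thesis by (simp add: p4)
  qed
  have nz: "q powi r * u \<noteq> 1" for r
  proof
    assume "q powi r * u = 1"
    then have "u = q powi (- r)" using q by (simp add: power_int_minus field_simps)
    then show False using jtheta_eq_0_iff[OF assms(1,2)] assms(4) by blast
  qed
  have nz2: "(q ^ 4) powi k * U \<noteq> 1" if "U \<noteq> 0" "jtheta U (q ^ 4) \<noteq> 0" for k U
  proof
    assume "(q ^ 4) powi k * U = 1"
    then have "U = (q ^ 4) powi (- k)" using q by (simp add: power_int_minus field_simps)
    then show False using jtheta_eq_0_iff[OF q4 that(1)] that(2) by blast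
  qed
  have frac: "1 / (1 - a) = (1 + a) / (1 - a ^ 2)" if "a \<noteq> 1" "a ^ 2 \<noteq> 1" for a :: complex
  proof -
    have "(1 + a) * (1 - a) = 1 - a ^ 2" by (simp add: algebra_simps power2_eq_square)
    then show ?thesis using that by (simp add: frac_eq_eq)
  qed
  let ?e1 = "\<lambda>k. (q ^ 4) powi tri (k + 1) * (q ^ 3 * z ^ 2) powi k / (1 - (q ^ 4) powi k * (q ^ 4 * u ^ 2))"
  let ?e2 = "\<lambda>k. (q ^ 4) powi tri (k + 1) * (q * z ^ 2) powi k / (1 - (q ^ 4) powi k * u ^ 2)"
  let ?o1 = "\<lambda>k. (q ^ 4) powi tri (k + 1) * (q * z ^ 2) powi k / (1 - (q ^ 4) powi k * (q ^ 2 * u ^ 2))"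
  let ?o2 = "\<lambda>k. (q ^ 4) powi tri (k + 1) * (q ^ 3 * z ^ 2) powi k / (1 - (q ^ 4) powi k * (q ^ 2 * u ^ 2))"
  have even: "?f (2 * k) = q ^ 3 * z ^ 2 * ?e1 (k - 1) + u * ?e2 k" for k
  proof -
    define w d where "w = (q ^ 4) powi tri k" and "d = 1 - (q ^ 4) powi k * u ^ 2"
    have sq: "(q powi (2 * k) * u) ^ 2 = (q ^ 4) powi k * u ^ 2"
      by (simp add: power_mult_distrib q2k)
    have t1: "tri (2 * k + 1) = 4 * tri k + 3 * k" unfolding tri_Suc tri_double by simp
    have "1 / (1 - q powi (2 * k) * u) = (1 + q powi (2 * k) * u) / d"
      unfolding d_def sq[symmetric] using nz[of "2 * k"] nz2[OF _ j0, of k] assms(2) sq by (intro frac) auto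
    then have "?f (2 * k) = q powi (4 * tri k + 3 * k) * z powi (2 * k) * ((1 + q powi (2 * k) * u) / d)"
      unfolding t1 m2 by (metis mult_1_left times_divide_eq_right mult_1_right)
    also have "\<dots> = w * q powi (3 * k) * (z ^ 2) powi k / d + u * (w * q powi (5 * k) * (z ^ 2) powi k / d)"
    proof -
      have "q powi (5 * k) = q powi (3 * k) * q powi (2 * k)"
        using q by (simp flip: power_int_add)
      moreover have "q powi (4 * tri k + 3 * k) = w * q powi (3 * k)"
        using q by (simp only: power_int_add p4 w_def simp_thms)
      ultimately show ?thesis
        unfolding z2 by (simp add: algebra_simps add_divide_distrib)
    qed
    \<comment> \<open>The power of the base \<open>q ^ 4\<close> is
      \<open>tri k = tri ((k - 1) + 1)\<close>, so this term is read at index \<open>k - 1\<close>,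
      which turns \<open>u ^ 2\<close> into \<open>q ^ 4 * u ^ 2\<close>.\<close>
    also have "w * q powi (3 * k) * (z ^ 2) powi k / d = q ^ 3 * z ^ 2 * ?e1 (k - 1)"
    proof -
      have U: "(q ^ 4) powi (k - 1) * (q ^ 4 * u ^ 2) = (q ^ 4) powi k * u ^ 2"
        using q by (simp add: power_int_diff)
      have "(q ^ 3) powi k = q powi (3 * k)"
        using power_int_mult[of q 3 k] by simp
      then have "q ^ 3 * z ^ 2 * (q ^ 3 * z ^ 2) powi (k - 1) = q powi (3 * k) * (z ^ 2) powi k"
        using q assms(3) by (simp add: power_int_diff power_int_mult_distrib)
      moreover have "q ^ 3 * z ^ 2 * ?e1 (k - 1) = w * (q ^ 3 * z ^ 2 * (q ^ 3 * z ^ 2) powi (k - 1)) / d"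
        unfolding U w_def d_def by (simp add: mult_ac)
      ultimately show ?thesis
        by (simp add: mult_ac)
    qed
    also have "w * q powi (5 * k) * (z ^ 2) powi k / d = ?e2 k"
    proof -
      have "q powi (5 * k) = (q ^ 4) powi k * q powi k"
        using q by (simp add: p4[symmetric] flip: power_int_add)
      then show ?thesis
        using q by (simp add: w_def d_def tri_Suc power_int_add power_int_mult_distrib mult_ac)
    qed
    finally show ?thesis .
  qed
  have odd: "?f (2 * k + 1) = - (q * z) * ?o1 k - q ^ 2 * u * z * ?o2 k" for k
  proof -
    define w d where "w = (q ^ 4) powi tri k" and "d = 1 - (q ^ 4) powi k * (q ^ 2 * u ^ 2)"
    have q1: "q powi (2 * k + 1) = q powi (2 * k) * q" "z powi (2 * k + 1) = (z ^ 2) powi k * z"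
      "(- 1 :: complex) powi (2 * k + 1) = - 1"
      using q assms(3) m2[of k] by (simp_all add: power_int_add z2)
    have sq: "(q powi (2 * k + 1) * u) ^ 2 = (q ^ 4) powi k * (q ^ 2 * u ^ 2)"
      unfolding q1 by (simp add: power_mult_distrib q2k)
    have t2: "tri (2 * k + 1 + 1) = 4 * tri k + 5 * k + 1"
      unfolding tri_Suc tri_double by simp
    have "1 / (1 - q powi (2 * k + 1) * u) = (1 + q powi (2 * k + 1) * u) / d"
      unfolding d_def sq[symmetric] using nz[of "2 * k + 1"] nz2[OF _ j2, of k] assms(2) q sq by (intro frac) auto
    then have "?f (2 * k + 1) = - (q powi (4 * tri k + 5 * k + 1)) * ((z ^ 2) powi k * z) * ((1 + q powi (2 * k) * q * u) / d)"
      unfolding t2 q1 by (metis mult_minus1 times_divide_eq_right mult_1_right)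
    also have "\<dots> = - (q * z) * (w * q powi (5 * k) * (z ^ 2) powi k / d) - q ^ 2 * u * z * (w * q powi (7 * k) * (z ^ 2) powi k / d)"
    proof -
      have "q powi (7 * k) = q powi (5 * k) * q powi (2 * k)"
        using q by (simp flip: power_int_add)
      moreover have "q powi (4 * tri k + 5 * k + 1) = w * q powi (5 * k) * q"
        using q by (simp only: power_int_add p4 w_def power_int_1_right simp_thms)
      ultimately show ?thesis
        by (simp add: algebra_simps add_divide_distrib power2_eq_square)
    qed
    also have "w * q powi (5 * k) * (z ^ 2) powi k / d = ?o1 k"
    proof -
      have "q powi (5 * k) = (q ^ 4) powi k * q powi k"
        using q by (simp add: p4[symmetric] flip: power_int_add)
      then show ?thesis
        using q by (simp add: w_def d_def tri_Suc power_int_add power_int_mult_distrib mult_ac)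
    qed
    also have "w * q powi (7 * k) * (z ^ 2) powi k / d = ?o2 k"
    proof -
      have "q powi (7 * k) = (q ^ 4) powi k * q powi (3 * k)"
        using q by (simp add: p4[symmetric] flip: power_int_add)
      moreover have "(q ^ 3) powi k = q powi (3 * k)"
        using power_int_mult[of q 3 k] by simp
      ultimately show ?thesis
        using q by (simp add: w_def d_def tri_Suc power_int_add power_int_mult_distrib mult_ac)
    qed
    finally show ?thesis .
  qed
  have e1: "(?e1 has_sum ?A (q ^ 4 * u ^ 2) (- (q ^ 3 * z ^ 2))) UNIV"
    using q assms by (intro S j4) auto
  have "((\<lambda>k. ?e1 (k - 1)) has_sum ?A (q ^ 4 * u ^ 2) (- (q ^ 3 * z ^ 2))) UNIV"
    using has_sum_reindex_bij_witness[of UNIV "\<lambda>k. k + 1" "\<lambda>k. k - 1" UNIV ?e1 "\<lambda>k. ?e1 (k - 1)"] e1 by simp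
  then have "((\<lambda>k. ?f (2 * k)) has_sum (q ^ 3 * z ^ 2 * ?A (q ^ 4 * u ^ 2) (- (q ^ 3 * z ^ 2)) + u * ?A (u ^ 2) (- (q * z ^ 2)))) UNIV"
    unfolding even using q assms by (intro has_sum_add has_sum_cmult_right S) auto
  moreover have "((\<lambda>k. ?f (2 * k + 1)) has_sum (- (q * z) * ?A (q ^ 2 * u ^ 2) (- (q * z ^ 2)) +
      - (q ^ 2 * u * z) * ?A (q ^ 2 * u ^ 2) (- (q ^ 3 * z ^ 2)))) UNIV"
  proof -
    have "((\<lambda>k. - (q * z) * ?o1 k + - (q ^ 2 * u * z) * ?o2 k) has_sum (- (q * z) * ?A (q ^ 2 * u ^ 2) (- (q * z ^ 2)) +
      - (q ^ 2 * u * z) * ?A (q ^ 2 * u ^ 2) (- (q ^ 3 * z ^ 2)))) UNIV"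
      using q assms by (intro has_sum_add has_sum_cmult_right S) auto
    then show ?thesis
      unfolding odd by simp
  qed
  ultimately have "(?f has_sum ((q ^ 3 * z ^ 2 * ?A (q ^ 4 * u ^ 2) (- (q ^ 3 * z ^ 2)) + u * ?A (u ^ 2) (- (q * z ^ 2))) +
      (- (q * z) * ?A (q ^ 2 * u ^ 2) (- (q * z ^ 2)) + - (q ^ 2 * u * z) * ?A (q ^ 2 * u ^ 2) (- (q ^ 3 * z ^ 2))))) UNIV"
    by (rule has_sum_even_odd)
  from has_sum_unique[OF appell_series[OF assms(1-4)] this] show ?thesis
    by simp
qed

lemma appell_num_eq_m:
  assumes "z \<noteq> 0" "jtheta z q \<noteq> 0" "y * z = u"
  shows "appell_num u z q / jtheta u q = - (jtheta z q * appell_m y q z / z)"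
  using assms by (auto simp: appell_m_def)

text \<open>The four series have only two first arguments, \<open>- (q * x ^ 2)\<close> and
  \<open>- (x ^ 2 / q)\<close>. Each occurs with two values of \<open>z\<close>, whose coefficients
  are the even and odd parts of \<open>j(z;q)\<close>. After a change to one common \<open>z\<close>
  these parts recombine and \<open>j(z;q)\<close> can be divided out.\<close>

lemma appell_m_dissect_change_z:
  assumes q: "nome q" and nz: "x \<noteq> 0" "z \<noteq> 0" and v: "v = x * z"
    and jz: "jtheta z q \<noteq> 0" and jv: "jtheta v q \<noteq> 0"
    and j0: "jtheta (v ^ 2) (q ^ 4) \<noteq> 0" and j2: "jtheta (q ^ 2 * v ^ 2) (q ^ 4) \<noteq> 0"
    and ja: "jtheta (- (q * z ^ 2)) (q ^ 4) \<noteq> 0" and jb: "jtheta (- (q ^ 3 * z ^ 2)) (q ^ 4) \<noteq> 0"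
  shows "jtheta z q * appell_m x q z =
    jtheta (- (q * z ^ 2)) (q ^ 4) * (appell_m (- (q * x ^ 2)) (q ^ 4) (- (q * z ^ 2)) - x / q * appell_m (- (x ^ 2 / q)) (q ^ 4) (- (q * z ^ 2))) -
    z * jtheta (- (q ^ 3 * z ^ 2)) (q ^ 4) * (appell_m (- (q * x ^ 2)) (q ^ 4) (- (q ^ 3 * z ^ 2)) - x / q * appell_m (- (x ^ 2 / q)) (q ^ 4) (- (q ^ 3 * z ^ 2)))"
proof -
  have q0: "q \<noteq> 0" using q by (rule nome_nonzero)
  have v0: "v \<noteq> 0" using nz v by simp
  define a b where "a = jtheta (- (q * z ^ 2)) (q ^ 4)" and "b = jtheta (- (q ^ 3 * z ^ 2)) (q ^ 4)"
  define m1a m2a m1b m2b where "m1a = appell_m (- (q * x ^ 2)) (q ^ 4) (- (q * z ^ 2))"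
    and "m2a = appell_m (- (x ^ 2 / q)) (q ^ 4) (- (q * z ^ 2))"
    and "m1b = appell_m (- (q * x ^ 2)) (q ^ 4) (- (q ^ 3 * z ^ 2))"
    and "m2b = appell_m (- (x ^ 2 / q)) (q ^ 4) (- (q ^ 3 * z ^ 2))"
  have Za: "- (q * z ^ 2) \<noteq> 0" and Zb: "- (q ^ 3 * z ^ 2) \<noteq> 0" using q0 nz by auto
  have "- (q * x ^ 2) * - (q ^ 3 * z ^ 2) = q ^ 4 * v ^ 2" "- (x ^ 2 / q) * - (q * z ^ 2) = v ^ 2"
    "- (q * x ^ 2) * - (q * z ^ 2) = q ^ 2 * v ^ 2" "- (x ^ 2 / q) * - (q ^ 3 * z ^ 2) = q ^ 2 * v ^ 2"
    using q0 by (simp_all add: v power_mult_distrib eval_nat_numeral field_simps)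
  note n = appell_num_eq_m[OF Zb jb this(1)] appell_num_eq_m[OF Za ja this(2)]
    appell_num_eq_m[OF Za ja this(3)] appell_num_eq_m[OF Zb jb this(4)]
  have "jtheta z q * appell_m x q z = - z * (appell_num v z q / jtheta v q)"
    using jz jv by (simp add: appell_m_def v)
  also have "\<dots> = - z * (q ^ 3 * z ^ 2 * (b * m1b / (q ^ 3 * z ^ 2)) + v * (a * m2a / (q * z ^ 2)) -
      q * z * (a * m1a / (q * z ^ 2)) - q ^ 2 * v * z * (b * m2b / (q ^ 3 * z ^ 2)))"
    unfolding appell_num_dissect[OF q v0 nz(2) jv j0 j2] n
      a_def b_def m1a_def m1b_def m2a_def m2b_def by simp
  also have "\<dots> = a * (m1a - x / q * m2a) - z * b * (m1b - x / q * m2b)"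
    unfolding v using q0 nz by (simp add: field_simps eval_nat_numeral)
  finally show ?thesis
    unfolding a_def b_def m1a_def m1b_def m2a_def m2b_def .
qed

text \<open>All four Appell functions are moved to the parameter \<open>z ^ 2\<close>. The four
  corrections combine into a single quotient: one pair of factors is the even-odd splitting of
  \<open>j(- v;q)\<close>, the other an instance of \<open>jtheta_mult\<close>.\<close>

theorem appell_m_dissect:
  assumes q: "nome q" and nz: "x \<noteq> 0" "z \<noteq> 0" and v: "v = x * z"
    and jz: "jtheta z q \<noteq> 0" and jz2: "jtheta (z ^ 2) (q ^ 4) \<noteq> 0" and jv: "jtheta v q \<noteq> 0"
    and j0: "jtheta (v ^ 2) (q ^ 4) \<noteq> 0" and j2: "jtheta (q ^ 2 * v ^ 2) (q ^ 4) \<noteq> 0"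
    and ja: "jtheta (- (q * z ^ 2)) (q ^ 4) \<noteq> 0" and jb: "jtheta (- (q ^ 3 * z ^ 2)) (q ^ 4) \<noteq> 0"
    and jA: "jtheta (- (q * v ^ 2)) (q ^ 4) \<noteq> 0" and jB: "jtheta (- (q ^ 3 * v ^ 2)) (q ^ 4) \<noteq> 0"
  shows "appell_m x q z = appell_m (- (q * x ^ 2)) (q ^ 4) (z ^ 2) - x / q * appell_m (- (x ^ 2 / q)) (q ^ 4) (z ^ 2) +
    z ^ 2 * qpoch_inf (q ^ 4) (q ^ 4) ^ 3 * jtheta (- q) (q ^ 4) * jtheta (- v) q *
      jtheta (1 / z) (q ^ 2) * jtheta (- (v ^ 2 * z)) (q ^ 2) /
    (v * jtheta z q * jtheta (z ^ 2) (q ^ 4) * (jtheta (- (q * v ^ 2)) (q ^ 4) * jtheta (- (q ^ 3 * v ^ 2)) (q ^ 4)) *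
      (jtheta (v ^ 2) (q ^ 4) * jtheta (q ^ 2 * v ^ 2) (q ^ 4)))"
proof -
  have q0: "q \<noteq> 0" using q by (rule nome_nonzero)
  have q2: "nome (q ^ 2)" and q4: "nome (q ^ 4)" using q by (auto intro: nome_power)
  have v0: "v \<noteq> 0" using nz v by simp
  define a b A B C0 C2 F0 F2 where "a = jtheta (- (q * z ^ 2)) (q ^ 4)" and "b = jtheta (- (q ^ 3 * z ^ 2)) (q ^ 4)"
    and "A = jtheta (- (q * v ^ 2)) (q ^ 4)" and "B = jtheta (- (q ^ 3 * v ^ 2)) (q ^ 4)"
    and "C0 = jtheta (v ^ 2) (q ^ 4)" and "C2 = jtheta (q ^ 2 * v ^ 2) (q ^ 4)"
    and "F0 = jtheta (v ^ 2 * z ^ 2) (q ^ 4)" and "F2 = jtheta (q ^ 2 * v ^ 2 * z ^ 2) (q ^ 4)"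
  define m1 m2 where "m1 = appell_m (- (q * x ^ 2)) (q ^ 4) (z ^ 2)" and "m2 = appell_m (- (x ^ 2 / q)) (q ^ 4) (z ^ 2)"
  define K where "K = z ^ 2 * qpoch_inf (q ^ 4) (q ^ 4) ^ 3 * jtheta (- q) (q ^ 4) / jtheta (z ^ 2) (q ^ 4)"
  have nzs: "a \<noteq> 0" "b \<noteq> 0" "A \<noteq> 0" "B \<noteq> 0" "C0 \<noteq> 0" "C2 \<noteq> 0"
    using ja jb jA jB j0 j2 by (simp_all add: a_def b_def A_def B_def C0_def C2_def)
  have xv: "x = v / z" using v nz by simp
  have jq3: "jtheta (- (q ^ 3)) (q ^ 4) = jtheta (- q) (q ^ 4)"
    using jtheta_reflect[OF q4, of "- q"] q0 by (simp add: eval_nat_numeral)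
  have Bq: "jtheta (- (v ^ 2 / q)) (q ^ 4) = v ^ 2 / q * B"
  proof -
    have e: "- (q ^ 3 * v ^ 2) / q ^ 4 = - (v ^ 2 / q)" using q0 by (simp add: eval_nat_numeral)
    show ?thesis
      using jtheta_shift_back[OF q4, of "- (q ^ 3 * v ^ 2)"] v0 q0 unfolding e by (simp add: B_def)
  qed
  have C4: "jtheta (q ^ 4 * v ^ 2) (q ^ 4) = - C0 / v ^ 2"
    using jtheta_shift[OF q4, of "v ^ 2"] v0 by (simp add: C0_def)
  have F4: "jtheta (q ^ 4 * v ^ 2 * z ^ 2) (q ^ 4) = - F0 / (v ^ 2 * z ^ 2)"
    using jtheta_shift[OF q4, of "v ^ 2 * z ^ 2"] v0 nz by (simp add: F0_def mult.assoc)
  have Z: "z ^ 2 \<noteq> 0" "- (q * z ^ 2) \<noteq> 0" "- (q ^ 3 * z ^ 2) \<noteq> 0" "- (q * x ^ 2) \<noteq> 0" "- (x ^ 2 / q) \<noteq> 0"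
    using q0 nz by auto
  have e: "- (q * x ^ 2) * z ^ 2 = - (q * v ^ 2)" "- (x ^ 2 / q) * z ^ 2 = - (v ^ 2 / q)"
      "- (q * z ^ 2) / z ^ 2 = - q" "- (q ^ 3 * z ^ 2) / z ^ 2 = - (q ^ 3)"
      "- (q * x ^ 2) * - (q * z ^ 2) = q ^ 2 * v ^ 2" "- (x ^ 2 / q) * - (q * z ^ 2) = v ^ 2"
      "- (q * x ^ 2) * - (q ^ 3 * z ^ 2) = q ^ 4 * v ^ 2" "- (x ^ 2 / q) * - (q ^ 3 * z ^ 2) = q ^ 2 * v ^ 2"
      "- (q * v ^ 2) * - (q * z ^ 2) = q ^ 2 * v ^ 2 * z ^ 2" "- (v ^ 2 / q) * - (q * z ^ 2) = v ^ 2 * z ^ 2"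
      "- (q * v ^ 2) * - (q ^ 3 * z ^ 2) = q ^ 4 * v ^ 2 * z ^ 2" "- (v ^ 2 / q) * - (q ^ 3 * z ^ 2) = q ^ 2 * v ^ 2 * z ^ 2"
    using q0 nz by (simp_all add: v power_mult_distrib eval_nat_numeral field_simps)
  have jY1: "jtheta (- (q * x ^ 2) * z ^ 2) (q ^ 4) \<noteq> 0" and jY2: "jtheta (- (x ^ 2 / q) * z ^ 2) (q ^ 4) \<noteq> 0"
    unfolding e Bq using nzs v0 q0 by (simp_all add: A_def)
  have j4: "jtheta (q ^ 4 * v ^ 2) (q ^ 4) \<noteq> 0"
    unfolding C4 using nzs v0 by simp
  note ch = appell_m_change_z[OF q4 _ Z(1) _ jz2]
  have d1a: "appell_m (- (q * x ^ 2)) (q ^ 4) (- (q * z ^ 2)) - m1 = K * F2 / (a * A * C2)"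
    using ch[OF Z(4,2) ja jY1] j2 unfolding e by (simp add: m1_def K_def F2_def a_def A_def C2_def mult_ac)
  have d2a: "appell_m (- (x ^ 2 / q)) (q ^ 4) (- (q * z ^ 2)) - m2 = K * F0 / (a * (v ^ 2 / q * B) * C0)"
    using ch[OF Z(5,2) ja jY2] j0 unfolding e Bq by (simp add: m2_def K_def F0_def a_def C0_def mult_ac)
  have d1b: "appell_m (- (q * x ^ 2)) (q ^ 4) (- (q ^ 3 * z ^ 2)) - m1 = K * (- F0 / (v ^ 2 * z ^ 2)) / (b * A * (- C0 / v ^ 2))"
    using ch[OF Z(4,3) jb jY1] j4 unfolding e F4 C4 jq3 by (simp add: m1_def K_def b_def A_def mult_ac)
  have d2b: "appell_m (- (x ^ 2 / q)) (q ^ 4) (- (q ^ 3 * z ^ 2)) - m2 = K * F2 / (b * (v ^ 2 / q * B) * C2)"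
    using ch[OF Z(5,3) jb jY2] j2 unfolding e Bq jq3 by (simp add: m2_def K_def F2_def b_def C2_def mult_ac)
  have ab: "jtheta z q = a - z * b"
    using jtheta_even_odd[OF q nz(2)] by (simp add: a_def b_def)
  have "jtheta z q * (appell_m x q z - (m1 - x / q * m2)) =
     a * (K * F2 / (a * A * C2) - x / q * (K * F0 / (a * (v ^ 2 / q * B) * C0))) -
     z * b * (K * (- F0 / (v ^ 2 * z ^ 2)) / (b * A * (- C0 / v ^ 2)) - x / q * (K * F2 / (b * (v ^ 2 / q * B) * C2)))"
    unfolding right_diff_distrib appell_m_dissect_change_z[OF q nz v jz jv j0 j2 ja jb]
      d1a[symmetric] d2a[symmetric] d1b[symmetric] d2b[symmetric]
    unfolding a_def[symmetric] b_def[symmetric] ab by (simp add: algebra_simps add_divide_distrib diff_divide_distrib)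
  also have "\<dots> = K * (A + v * B) * (C0 * F2 - 1 / z * (C2 * F0)) / (v * (A * B) * (C0 * C2))"
    unfolding xv using nzs q0 nz v0 by (simp add: field_simps power2_eq_square)
  also have "A + v * B = jtheta (- v) q"
    using jtheta_even_odd[OF q, of "- v"] v0 by (simp add: A_def B_def)
  \<comment> \<open>With \<open>s = 1 / z\<close> and \<open>t = - (v ^ 2 * z)\<close> one has
    \<open>s * t = - (v ^ 2)\<close> and \<open>t / s = - (v ^ 2 * z ^ 2)\<close>, which are the
    arguments behind \<open>C0\<close>, \<open>C2\<close>, \<open>F0\<close> and
    \<open>F2\<close>.\<close>
  also have "C0 * F2 - 1 / z * (C2 * F0) = jtheta (1 / z) (q ^ 2) * jtheta (- (v ^ 2 * z)) (q ^ 2)"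
  proof -
    have "(q ^ 2) ^ 2 = q ^ 4" by (simp flip: power_mult)
    then show ?thesis
      using jtheta_mult[OF q2, of "1 / z" "- (v ^ 2 * z)"] nz v0
      by (simp add: C0_def C2_def F0_def F2_def power2_eq_square mult_ac)
  qed
  finally have "jtheta z q * (appell_m x q z - (m1 - x / q * m2)) =
     K * jtheta (- v) q * (jtheta (1 / z) (q ^ 2) * jtheta (- (v ^ 2 * z)) (q ^ 2)) / (v * (A * B) * (C0 * C2))" .
  then have "appell_m x q z - (m1 - x / q * m2) =
     K * jtheta (- v) q * (jtheta (1 / z) (q ^ 2) * jtheta (- (v ^ 2 * z)) (q ^ 2)) / (v * (A * B) * (C0 * C2)) / jtheta z q"
    using jz by (metis nonzero_mult_div_cancel_left)
  then show ?thesis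
    unfolding K_def A_def B_def C0_def C2_def m1_def m2_def by (simp add: mult_ac diff_eq_eq add.commute)
qed

lemma jtheta_even_odd_section:
  assumes "nome q" "x \<noteq> 0"
  shows "jtheta x q * qpoch_inf (q ^ 2) (q ^ 2) ^ 2 = jtheta x (q ^ 2) * jtheta (q * x) (q ^ 2) * qpoch_inf q q"
  using jtheta_section[OF assms(1) _ assms(2), of 2] by (simp add: numeral_2_eq_2)

text \<open>The theta quotient of \<open>appell_m_dissect\<close>, with opposite sign and after cancelling
  common factors.\<close>

definition dissect_term :: "complex \<Rightarrow> complex \<Rightarrow> complex \<Rightarrow> complex" where
  "dissect_term v q z = z * (jtheta (- q) (q ^ 4) * qpoch_inf (q ^ 2) (q ^ 2) ^ 3 * qpoch_inf q q ^ 2 / qpoch_inf (q ^ 4) (q ^ 4) ^ 2) *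
     jtheta (- (v ^ 2 * z)) (q ^ 2) /
     (v * jtheta z q * jtheta (- z) (q ^ 2) * jtheta (- (q * v ^ 2)) (q ^ 2) * jtheta v q)"

text \<open>Pairs of theta functions of base \<open>q ^ 4\<close> are folded into ones of base
  \<open>q ^ 2\<close> and \<open>q\<close>. The factor \<open>j(- v;q)\<close> then cancels, and
  its nonvanishing together with that of \<open>j(v;q)\<close> supplies the conditions on
  \<open>v ^ 2\<close> in \<open>appell_m_dissect\<close>.\<close>

theorem appell_m_dissect_short:
  assumes q: "nome q" and nz: "x \<noteq> 0" "z \<noteq> 0" and v: "v = x * z"
    and jz: "jtheta z q \<noteq> 0" and jz2: "jtheta (z ^ 2) (q ^ 4) \<noteq> 0" and jv: "jtheta v q \<noteq> 0" and jmv: "jtheta (- v) q \<noteq> 0"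
    and ja: "jtheta (- (q * z ^ 2)) (q ^ 4) \<noteq> 0" and jb: "jtheta (- (q ^ 3 * z ^ 2)) (q ^ 4) \<noteq> 0"
    and jA: "jtheta (- (q * v ^ 2)) (q ^ 4) \<noteq> 0" and jB: "jtheta (- (q ^ 3 * v ^ 2)) (q ^ 4) \<noteq> 0"
  shows "appell_m x q z = appell_m (- (q * x ^ 2)) (q ^ 4) (z ^ 2) - x / q * appell_m (- (x ^ 2 / q)) (q ^ 4) (z ^ 2) -
    dissect_term v q z"
proof -
  have q0: "q \<noteq> 0" using q by (rule nome_nonzero)
  have q2: "nome (q ^ 2)" and q4: "nome (q ^ 4)" using q by (auto intro: nome_power)
  have q22: "(q ^ 2) ^ 2 = q ^ 4" by (simp flip: power_mult)
  have v0: "v \<noteq> 0" using nz v by simp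
  define e1 e2 e4 where "e1 = qpoch_inf q q" and "e2 = qpoch_inf (q ^ 2) (q ^ 2)" and "e4 = qpoch_inf (q ^ 4) (q ^ 4)"
  have e: "e1 \<noteq> 0" "e2 \<noteq> 0" "e4 \<noteq> 0"
    using qpoch_inf_self_nonzero q q2 q4 by (auto simp: e1_def e2_def e4_def)
  define A B C0 C2 where "A = jtheta (- (q * v ^ 2)) (q ^ 4)" and "B = jtheta (- (q ^ 3 * v ^ 2)) (q ^ 4)"
    and "C0 = jtheta (v ^ 2) (q ^ 4)" and "C2 = jtheta (q ^ 2 * v ^ 2) (q ^ 4)"
  have AB: "jtheta (- (q * v ^ 2)) (q ^ 2) * e4 ^ 2 = A * B * e2"
  proof -
    have e: "q ^ 2 * - (q * v ^ 2) = - (q ^ 3 * v ^ 2)" by (simp add: eval_nat_numeral)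
    show ?thesis
      using jtheta_even_odd_section[OF q2, of "- (q * v ^ 2)"] q0 v0 unfolding q22 e
      by (simp add: A_def B_def e2_def e4_def)
  qed
  have C: "jtheta v q * jtheta (- v) q * e4 ^ 2 = C0 * C2 * e1 ^ 2"
  proof -
    have "jtheta (v ^ 2) (q ^ 2) * e4 ^ 2 = C0 * C2 * e2"
      using jtheta_even_odd_section[OF q2, of "v ^ 2"] v0 unfolding q22
      by (simp add: C0_def C2_def e2_def e4_def)
    moreover have "jtheta (v ^ 2) (q ^ 2) * e1 ^ 2 = jtheta v q * jtheta (- v) q * e2"
      using jtheta_square[OF q v0] by (simp add: e1_def e2_def)
    ultimately have "e2 * (jtheta v q * jtheta (- v) q * e4 ^ 2) = e2 * (C0 * C2 * e1 ^ 2)"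
      by algebra
    then show ?thesis using e by simp
  qed
  have C_nz: "C0 \<noteq> 0" "C2 \<noteq> 0"
    using C jv jmv e by auto
  have Z: "jtheta (z ^ 2) (q ^ 4) * e2 ^ 2 = jtheta z (q ^ 2) * jtheta (- z) (q ^ 2) * e4"
    using jtheta_square[OF q2 nz(2)] unfolding q22 by (simp add: e2_def e4_def)
  have Z_nz: "jtheta z (q ^ 2) \<noteq> 0" "jtheta (- z) (q ^ 2) \<noteq> 0"
    using Z jz2 e by auto
  have AB_nz: "jtheta (- (q * v ^ 2)) (q ^ 2) \<noteq> 0"
    using AB jA jB e by (auto simp: A_def B_def)
  define jm where "jm = jtheta (- q) (q ^ 4)"
  have zz: "jtheta (z ^ 2) (q ^ 4) = jtheta z (q ^ 2) * jtheta (- z) (q ^ 2) * e4 / e2 ^ 2"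
    using Z e by (simp add: eq_divide_eq)
  have ab: "A * B = jtheta (- (q * v ^ 2)) (q ^ 2) * e4 ^ 2 / e2"
    using AB e by (simp add: eq_divide_eq)
  have cc: "C0 * C2 = jtheta v q * jtheta (- v) q * e4 ^ 2 / e1 ^ 2"
    using C e by (simp add: eq_divide_eq)
  have "z ^ 2 * e4 ^ 3 * jm * jtheta (- v) q * jtheta (1 / z) (q ^ 2) * jtheta (- (v ^ 2 * z)) (q ^ 2) /
    (v * jtheta z q * jtheta (z ^ 2) (q ^ 4) * (A * B) * (C0 * C2)) = - dissect_term v q z"
    unfolding zz ab cc jtheta_inverse[OF q2 nz(2)] dissect_term_def e1_def[symmetric] e2_def[symmetric] e4_def[symmetric] jm_def[symmetric]
    using jz jv jmv nz v0 e Z_nz AB_nz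
    by (simp add: divide_simps) (simp add: algebra_simps power2_eq_square power3_eq_cube)
  moreover have "jtheta (v ^ 2) (q ^ 4) \<noteq> 0" "jtheta (q ^ 2 * v ^ 2) (q ^ 4) \<noteq> 0"
    using C_nz by (simp_all add: C0_def C2_def)
  ultimately show ?thesis
    using appell_m_dissect[OF q nz v jz jz2 jv _ _ ja jb jA jB]
    unfolding jm_def e4_def A_def B_def C0_def C2_def by simp
qed

section \<open>The theta function identity\<close>

text \<open>By \<open>jtheta_mult\<close>, both products on the left expand in the same four theta
  functions of base \<open>c ^ 4\<close>. These are also the even and odd parts of the two theta
  functions of base \<open>- c\<close> on the right, so the identity becomes a factorisation of
  polynomials in them.\<close>

lemma jtheta_mixed_product:
  assumes "nome c" "t \<noteq> 0"
  shows "t * jtheta t (c ^ 2) * jtheta (- (c * t ^ 3)) (c ^ 2) + jtheta (t ^ 3) (c ^ 2) * jtheta (- (c * t)) (c ^ 2) =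
    jtheta (t ^ 2) (- c) * jtheta (- t) (- c)"
proof -
  have c0: "c \<noteq> 0" using assms by (auto simp: nome_def)
  have c2: "nome (c ^ 2)" and c4: "nome (c ^ 4)" and cm: "nome (- c)"
    using assms by (auto intro: nome_power nome_uminus)
  have c22: "(c ^ 2) ^ 2 = c ^ 4" by (simp flip: power_mult)
  define a b g d where "a = jtheta (c * t ^ 4) (c ^ 4)" and "b = jtheta (c ^ 3 * t ^ 4) (c ^ 4)"
    and "g = jtheta (c * t ^ 2) (c ^ 4)" and "d = jtheta (c ^ 3 * t ^ 2) (c ^ 4)"
  have 1: "jtheta t (c ^ 2) * jtheta (- (c * t ^ 3)) (c ^ 2) = a * d - t * b * g"
  proof -
    have e: "- (t * - (c * t ^ 3)) = c * t ^ 4" "- (c ^ 2 * (- (c * t ^ 3) / t)) = c ^ 3 * t ^ 2"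
      "- (c ^ 2 * (t * - (c * t ^ 3))) = c ^ 3 * t ^ 4" "- (- (c * t ^ 3) / t) = c * t ^ 2"
      using assms(2) by (simp_all add: eval_nat_numeral)
    show ?thesis
      using jtheta_mult[OF c2 assms(2), of "- (c * t ^ 3)"] assms(2) c0 unfolding c22 e
      by (simp add: a_def b_def g_def d_def)
  qed
  have 2: "jtheta (t ^ 3) (c ^ 2) * jtheta (- (c * t)) (c ^ 2) = a * g - t ^ 3 * b * d"
  proof -
    have e: "- (t ^ 3 * - (c * t)) = c * t ^ 4" "- (c ^ 2 * (- (c * t) / t ^ 3)) = c ^ 4 / (c * t ^ 2)"
      "- (c ^ 2 * (t ^ 3 * - (c * t))) = c ^ 3 * t ^ 4" "- (- (c * t) / t ^ 3) = c ^ 4 / (c ^ 3 * t ^ 2)"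
      using assms(2) c0 by (simp_all add: eval_nat_numeral)
    have "jtheta (c ^ 4 / (c * t ^ 2)) (c ^ 4) = g" "jtheta (c ^ 4 / (c ^ 3 * t ^ 2)) (c ^ 4) = d"
      using jtheta_reflect[OF c4] assms(2) c0 by (simp_all add: g_def d_def)
    moreover have "t ^ 3 \<noteq> 0" "- (c * t) \<noteq> 0" using assms(2) c0 by auto
    ultimately show ?thesis
      using jtheta_mult[OF c2, of "t ^ 3" "- (c * t)"] unfolding c22 e
      by (simp add: a_def b_def)
  qed
  have 3: "jtheta w (- c) = jtheta (c * w ^ 2) (c ^ 4) - w * jtheta (c ^ 3 * w ^ 2) (c ^ 4)" if "w \<noteq> 0" for w
    using jtheta_even_odd[OF cm that] by simp
  have 4: "jtheta (t ^ 2) (- c) = a - t ^ 2 * b" "jtheta (- t) (- c) = g + t * d"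
    using 3[of "t ^ 2"] 3[of "- t"] assms(2) by (simp_all add: a_def b_def g_def d_def flip: power_mult)
  show ?thesis
    unfolding mult.assoc[of t] 1 2 4 by (simp add: algebra_simps power2_eq_square power3_eq_cube)
qed

section \<open>Infinite products at powers of q\<close>

lemma qpoch_inf_square_split:
  assumes "norm p < 1" "c ^ 2 = p"
  shows "qpoch_inf (x ^ 2) p = qpoch_inf x p * qpoch_inf (- x) p * (qpoch_inf (c * x) p * qpoch_inf (- (c * x)) p)"
proof -
  have "p * x ^ 2 = (c * x) ^ 2"
    using assms(2) by (simp add: power_mult_distrib)
  then show ?thesis
    unfolding qpoch_inf_even_odd[OF assms(1), of "x ^ 2"]
    using qpoch_inf_mult_neg[OF assms(1), of x] qpoch_inf_mult_neg[OF assms(1), of "c * x"] by simp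
qed

lemma qpoch_inf_section_power:
  assumes "nome q" "m > 0" "k > 0"
  shows "qpoch_inf (q ^ a) (q ^ m) = (\<Prod>i<k. qpoch_inf (q ^ (m * i + a)) (q ^ (m * k)))"
    and "qpoch_inf (- (q ^ a)) (q ^ m) = (\<Prod>i<k. qpoch_inf (- (q ^ (m * i + a))) (q ^ (m * k)))"
  using qpoch_inf_section[OF nome_norm[OF nome_power[OF assms(1,2)]] assms(3), of "q ^ a"]
    qpoch_inf_section[OF nome_norm[OF nome_power[OF assms(1,2)]] assms(3), of "- (q ^ a)"]
  by (simp_all add: power_add power_mult)

lemma jtheta_power:
  assumes "nome q" "a < m"
  shows "jtheta (q ^ a) (q ^ m) = qpoch_inf (q ^ a) (q ^ m) * qpoch_inf (q ^ (m - a)) (q ^ m) * qpoch_inf (q ^ m) (q ^ m)"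
    and "jtheta (- (q ^ a)) (q ^ m) = qpoch_inf (- (q ^ a)) (q ^ m) * qpoch_inf (- (q ^ (m - a))) (q ^ m) * qpoch_inf (q ^ m) (q ^ m)"
proof -
  have "q ^ m / q ^ a = q ^ (m - a)"
    using assms nome_nonzero[OF assms(1)] by (simp add: power_diff)
  then show "jtheta (q ^ a) (q ^ m) = qpoch_inf (q ^ a) (q ^ m) * qpoch_inf (q ^ (m - a)) (q ^ m) * qpoch_inf (q ^ m) (q ^ m)"
    "jtheta (- (q ^ a)) (q ^ m) = qpoch_inf (- (q ^ a)) (q ^ m) * qpoch_inf (- (q ^ (m - a))) (q ^ m) * qpoch_inf (q ^ m) (q ^ m)"
    by (simp_all add: jtheta_def)
qed

lemma qpoch_inf_neg_base:
  assumes "nome q" "k > 0"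
  shows "qpoch_inf x (- (q ^ k)) = qpoch_inf x (q ^ (2 * k)) * qpoch_inf (- (q ^ k * x)) (q ^ (2 * k))"
proof -
  have "(- (q ^ k)) ^ 2 = q ^ (2 * k)" by (simp add: mult.commute flip: power_mult)
  then show ?thesis
    using qpoch_inf_even_odd[OF nome_norm[OF nome_uminus[OF nome_power[OF assms(1,2)]]], of x] by simp
qed


text \<open>Dissection sends the argument \<open>q ^ 3\<close> of psi to \<open>- (q ^ 16)\<close>,
  the argument of X at \<open>q ^ 8\<close>, and to \<open>- (1 / q ^ 4)\<close>, the inverse of
  that of phi at \<open>- (q ^ 4)\<close>. Inversion also exchanges \<open>q ^ 8\<close> and
  \<open>1 / q ^ 8\<close>, which is harmless because both are summed.\<close>

lemma mock_sum_dissect: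
  assumes q: "nome q"
  shows "mock_psi q + q * mock_phi (- (q ^ 4)) + mock_X (q ^ 8) =
    dissect_term (q ^ 7) (q ^ 10) (q ^ 4) + dissect_term (1 / q) (q ^ 10) (1 / q ^ 4)"
proof -
  have q0: "q \<noteq> 0" using q by (rule nome_nonzero)
  have nm: "nome (q ^ 4)" "nome (q ^ 8)" "nome (q ^ 10)" "nome (q ^ 40)" using q by (auto intro: nome_power)
  have inv_nz: "jtheta (1 / q ^ k) (q ^ m) \<noteq> 0" if "\<not> m dvd k" "m > 0" for k m
    using jtheta_powi_nonzero[OF q that(2), of "- int k"] that by (simp add: power_int_minus divide_inverse)
  have inv_m_nz: "jtheta (- (1 / q ^ k)) (q ^ m) \<noteq> 0" if "m > 0" for k m
    using jtheta_minus_powi_nonzero[OF q that, of "- int k"] by (simp add: power_int_minus divide_inverse)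
  note nz = jtheta_power_nonzero[OF q] jtheta_minus_power_nonzero[OF q] inv_nz inv_m_nz
  define A where "A = (\<lambda>z. appell_m (- (q ^ 16)) (q ^ 40) z)"
  define B where "B = (\<lambda>z. appell_m (- (1 / q ^ 4)) (q ^ 40) z)"
  define C where "C = (\<lambda>z. appell_m (- (q ^ 4)) (q ^ 40) z)"
  have D1: "appell_m (q ^ 3) (q ^ 10) (q ^ 4) = A (q ^ 8) - B (q ^ 8) / q ^ 7 - dissect_term (q ^ 7) (q ^ 10) (q ^ 4)"
  proof -
    have e: "q ^ 7 = q ^ 3 * q ^ 4" "(q ^ 4) ^ 2 = q ^ 8" "(q ^ 10) ^ 4 = q ^ 40" "- (q ^ 10 * q ^ 8) = - (q ^ 18)"
      "- ((q ^ 10) ^ 3 * q ^ 8) = - (q ^ 38)" "- (q ^ 10 * (q ^ 7) ^ 2) = - (q ^ 24)" "- ((q ^ 10) ^ 3 * (q ^ 7) ^ 2) = - (q ^ 44)"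
      by (simp_all flip: power_mult power_add)
    have f: "- (q ^ 10 * (q ^ 3) ^ 2) = - (q ^ 16)" "- ((q ^ 3) ^ 2 / q ^ 10) = - (1 / q ^ 4)" "q ^ 3 / q ^ 10 = 1 / q ^ 7"
      using q0 by (simp_all add: frac_eq_eq flip: power_mult power_add)
    show ?thesis
      using appell_m_dissect_short[OF nm(3) _ _ e(1)] q0 unfolding e(2-) f A_def B_def
      by (simp add: nz)
  qed
  have D2: "appell_m (q ^ 3) (q ^ 10) (1 / q ^ 4) = A (1 / q ^ 8) - B (1 / q ^ 8) / q ^ 7 - dissect_term (1 / q) (q ^ 10) (1 / q ^ 4)"
  proof -
    have e: "1 / q = q ^ 3 * (1 / q ^ 4)" "(1 / q ^ 4) ^ 2 = 1 / q ^ 8" "(q ^ 10) ^ 4 = q ^ 40" "- (q ^ 10 * (1 / q ^ 8)) = - (q ^ 2)"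
      "- ((q ^ 10) ^ 3 * (1 / q ^ 8)) = - (q ^ 22)" "- (q ^ 10 * (1 / q) ^ 2) = - (q ^ 8)" "- ((q ^ 10) ^ 3 * (1 / q) ^ 2) = - (q ^ 28)"
      using q0 by (simp_all add: power_one_over divide_eq_eq eq_divide_eq flip: power_mult power_add power_Suc power_Suc2)
    have f: "- (q ^ 10 * (q ^ 3) ^ 2) = - (q ^ 16)" "- ((q ^ 3) ^ 2 / q ^ 10) = - (1 / q ^ 4)" "q ^ 3 / q ^ 10 = 1 / q ^ 7"
      using q0 by (simp_all add: frac_eq_eq flip: power_mult power_add)
    have "jtheta (1 / q) (q ^ 10) \<noteq> 0" "jtheta (- (1 / q)) (q ^ 10) \<noteq> 0"
      using inv_nz[of 10 1] inv_m_nz[of 10 1] by simp_all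
    then show ?thesis
      using appell_m_dissect_short[OF nm(3) _ _ e(1)] q0 unfolding e(2-) f A_def B_def
      by (simp add: nz)
  qed
  have X: "mock_X (q ^ 8) = A (q ^ 8) + A (1 / q ^ 8)"
    using mock_X_appell[OF nm(2)] by (simp add: A_def flip: power_mult)
  have "- (q ^ 4) * mock_phi (- (q ^ 4)) = - (C (q ^ 8) + C (1 / q ^ 8))"
    using mock_phi_appell[OF nome_uminus[OF nm(1)]] by (simp add: C_def flip: power_mult)
  then have phi: "mock_phi (- (q ^ 4)) = (C (q ^ 8) + C (1 / q ^ 8)) / q ^ 4"
    using q0 by (simp add: field_simps)
  have B: "B (1 / q ^ 8) = - (q ^ 4) * C (q ^ 8)" "B (q ^ 8) = - (q ^ 4) * C (1 / q ^ 8)"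
    using appell_m_inverse[OF nm(4), of "- (q ^ 4)" "q ^ 8"] appell_m_inverse[OF nm(4), of "- (q ^ 4)" "1 / q ^ 8"] q0
    by (simp_all add: B_def C_def)
  have "q ^ 4 * q ^ 4 = q * q ^ 7" by (simp flip: power_add power_Suc)
  then have "q * ((C (q ^ 8) + C (1 / q ^ 8)) / q ^ 4) = - (B (q ^ 8) / q ^ 7 + B (1 / q ^ 8) / q ^ 7)"
    unfolding B using q0 by (simp add: frac_eq_eq flip: add_divide_distrib) (simp add: algebra_simps)
  then show ?thesis
    unfolding mock_psi_appell[OF q] D1 D2 X phi by simp
qed

text \<open>The two values of \<open>v\<close> are \<open>q ^ 3\<close> times \<open>q ^ 4\<close>
  and times \<open>1 / q ^ 4\<close>. Shifts, reflections and inversions bring the exponents into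
  one period; in the first term 18 becomes 2, 24 becomes 4 and 7 becomes 3.\<close>

lemma dissect_term_values:
  assumes q: "nome q" and K: "K = jtheta (- (q ^ 10)) (q ^ 40) * qpoch_inf (q ^ 20) (q ^ 20) ^ 3 * qpoch_inf (q ^ 10) (q ^ 10) ^ 2 / qpoch_inf (q ^ 40) (q ^ 40) ^ 2"
  shows "dissect_term (q ^ 7) (q ^ 10) (q ^ 4) = q * K * jtheta (- (q ^ 2)) (q ^ 20) /
      (jtheta (q ^ 4) (q ^ 10) * jtheta (- (q ^ 4)) (q ^ 20) ^ 2 * jtheta (q ^ 3) (q ^ 10))"
    and "dissect_term (1 / q) (q ^ 10) (1 / q ^ 4) = K * jtheta (- (q ^ 6)) (q ^ 20) /
      (jtheta (q ^ 4) (q ^ 10) * jtheta (- (q ^ 4)) (q ^ 20) * jtheta (- (q ^ 8)) (q ^ 20) * jtheta q (q ^ 10))"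
proof -
  have q0: "q \<noteq> 0" using q by (rule nome_nonzero)
  have nm: "nome (q ^ 10)" "nome (q ^ 20)" using q by (auto intro: nome_power)
  have b: "(q ^ 10) ^ 2 = q ^ 20" "(q ^ 10) ^ 4 = q ^ 40" by (simp_all flip: power_mult)
  have "jtheta (q ^ 20 / - (q ^ 2)) (q ^ 20) = jtheta (- (q ^ 2)) (q ^ 20)"
    "jtheta (q ^ 20 * - (q ^ 4)) (q ^ 20) = jtheta (- (q ^ 4)) (q ^ 20) / q ^ 4"
    "jtheta (q ^ 10 / q ^ 3) (q ^ 10) = jtheta (q ^ 3) (q ^ 10)"
    using jtheta_reflect[OF nm(2), of "- (q ^ 2)"] jtheta_shift[OF nm(2), of "- (q ^ 4)"] jtheta_reflect[OF nm(1), of "q ^ 3"] q0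
    by simp_all
  moreover have "q ^ 20 / - (q ^ 2) = - ((q ^ 7) ^ 2 * q ^ 4)" "q ^ 20 * - (q ^ 4) = - (q ^ 10 * (q ^ 7) ^ 2)" "q ^ 10 / q ^ 3 = q ^ 7"
    using q0 by (simp_all add: divide_eq_eq flip: power_mult power_add)
  ultimately have 1: "jtheta (- ((q ^ 7) ^ 2 * q ^ 4)) (q ^ 20) = jtheta (- (q ^ 2)) (q ^ 20)"
    "jtheta (- (q ^ 10 * (q ^ 7) ^ 2)) (q ^ 20) = jtheta (- (q ^ 4)) (q ^ 20) / q ^ 4"
    "jtheta (q ^ 7) (q ^ 10) = jtheta (q ^ 3) (q ^ 10)"
    by metis+
  have "q ^ 4 * q ^ 4 = q ^ 7 * q" by (simp flip: power_add power_Suc2)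
  then show "dissect_term (q ^ 7) (q ^ 10) (q ^ 4) = q * K * jtheta (- (q ^ 2)) (q ^ 20) /
      (jtheta (q ^ 4) (q ^ 10) * jtheta (- (q ^ 4)) (q ^ 20) ^ 2 * jtheta (q ^ 3) (q ^ 10))"
    unfolding dissect_term_def b 1 K[symmetric] using q0
    by (simp add: field_simps power2_eq_square) 
  have "jtheta (1 / - (q ^ 6)) (q ^ 20) = jtheta (- (q ^ 6)) (q ^ 20) / q ^ 6"
    "jtheta (1 / - (q ^ 4)) (q ^ 20) = jtheta (- (q ^ 4)) (q ^ 20) / q ^ 4"
    "jtheta (1 / q ^ 4) (q ^ 10) = - jtheta (q ^ 4) (q ^ 10) / q ^ 4" "jtheta (1 / q) (q ^ 10) = - jtheta q (q ^ 10) / q"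
    using q0 by (subst jtheta_inverse[OF nm(1)] jtheta_inverse[OF nm(2)]; simp)+
  moreover have "1 / - (q ^ 6) = - ((1 / q) ^ 2 * (1 / q ^ 4))" "1 / - (q ^ 4) = - (1 / q ^ 4)"
    using q0 by (simp_all add: power_one_over flip: power_mult power_add)
  ultimately have 2: "jtheta (- ((1 / q) ^ 2 * (1 / q ^ 4))) (q ^ 20) = jtheta (- (q ^ 6)) (q ^ 20) / q ^ 6"
    "jtheta (- (1 / q ^ 4)) (q ^ 20) = jtheta (- (q ^ 4)) (q ^ 20) / q ^ 4"
    "jtheta (1 / q ^ 4) (q ^ 10) = - jtheta (q ^ 4) (q ^ 10) / q ^ 4" "jtheta (1 / q) (q ^ 10) = - jtheta q (q ^ 10) / q"
    by metis+
  have 3: "- (q ^ 10 * (1 / q) ^ 2) = - (q ^ 8)"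
    using q0 by (simp add: power_one_over divide_eq_eq flip: power_add)
  show "dissect_term (1 / q) (q ^ 10) (1 / q ^ 4) = K * jtheta (- (q ^ 6)) (q ^ 20) /
      (jtheta (q ^ 4) (q ^ 10) * jtheta (- (q ^ 4)) (q ^ 20) * jtheta (- (q ^ 8)) (q ^ 20) * jtheta q (q ^ 10))"
    unfolding dissect_term_def b 2 3 K[symmetric] using q0
    by (simp add: field_simps eval_nat_numeral)
qed


lemma qpoch_inf_self_double:
  assumes "norm p < 1"
  shows "qpoch_inf (p ^ 2) (p ^ 2) = qpoch_inf p p * qpoch_inf (- p) p"
  using qpoch_inf_mult_neg[OF assms, of p] by simp

text \<open>Everything is rewritten in the products \<open>P k\<close> and \<open>M k\<close> of
  base \<open>q ^ 20\<close>. The only additive relation needed is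
  \<open>jtheta_mixed_product\<close>, which evaluates the numerator over the common denominator;
  the rest is cancellation.\<close>

lemma theta_sum_value:
  assumes q: "nome q" and K: "K = jtheta (- (q ^ 10)) (q ^ 40) * qpoch_inf (q ^ 20) (q ^ 20) ^ 3 * qpoch_inf (q ^ 10) (q ^ 10) ^ 2 / qpoch_inf (q ^ 40) (q ^ 40) ^ 2"
  shows "q * K * jtheta (- (q ^ 2)) (q ^ 20) /
      (jtheta (q ^ 4) (q ^ 10) * jtheta (- (q ^ 4)) (q ^ 20) ^ 2 * jtheta (q ^ 3) (q ^ 10)) +
    K * jtheta (- (q ^ 6)) (q ^ 20) /
      (jtheta (q ^ 4) (q ^ 10) * jtheta (- (q ^ 4)) (q ^ 20) * jtheta (- (q ^ 8)) (q ^ 20) * jtheta q (q ^ 10)) =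
    Jbar q 1 2 * jtheta (- (q ^ 6)) (- (q ^ 10)) / J q 2 8"
proof -
  have q0: "q \<noteq> 0" using q by (rule nome_nonzero)
  have nm: "nome (q ^ 4)" "nome (q ^ 5)" "nome (q ^ 20)" using q by (auto intro: nome_power)
  define P where "P = (\<lambda>k. qpoch_inf (q ^ k) (q ^ 20))"
  define M where "M = (\<lambda>k. qpoch_inf (- (q ^ k)) (q ^ 20))"
  have P_nz: "P k \<noteq> 0" if "k > 0" for k
  proof -
    have "(q ^ 20) ^ i * q ^ k \<noteq> 1" for i
      using nome_power_neq_1[OF q, of "20 * i + k"] that by (simp add: power_add power_mult)
    then show ?thesis by (simp add: P_def qpoch_inf_eq_0_iff[OF nome_norm[OF nm(3)]])
  qed
  have M_nz: "M k \<noteq> 0" if "k > 0" for k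
  proof -
    have "(q ^ 20) ^ i * - (q ^ k) \<noteq> 1" for i
    proof
      assume "(q ^ 20) ^ i * - (q ^ k) = 1"
      then have "(q ^ (20 * i + k)) ^ 2 = 1"
        by (metis power_add power_mult mult_minus_right power2_minus one_power2)
      then show False
        using nome_power_neq_1[OF q, of "(20 * i + k) * 2"] that by (simp flip: power_mult)
    qed
    then show ?thesis by (simp add: M_def qpoch_inf_eq_0_iff[OF nome_norm[OF nm(3)]])
  qed
  have sec: "qpoch_inf (q ^ a) (q ^ 10) = P a * P (a + 10)" "qpoch_inf (- (q ^ a)) (q ^ 10) = M a * M (a + 10)" for a
    using qpoch_inf_section_power[OF q, of 10 2 a] by (simp_all add: P_def M_def numeral_2_eq_2 add.commute)
  have neg: "qpoch_inf x (- (q ^ 5)) = qpoch_inf x (q ^ 10) * qpoch_inf (- (q ^ 5 * x)) (q ^ 10)"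
    "qpoch_inf x (- (q ^ 10)) = qpoch_inf x (q ^ 20) * qpoch_inf (- (q ^ 10 * x)) (q ^ 20)" for x
    using qpoch_inf_neg_base[OF q, of 5 x] qpoch_inf_neg_base[OF q, of 10 x] by simp_all
  \<comment> \<open>Odd exponents are grouped by residue modulo 10: \<open>PU\<close> and
    \<open>U\<close> collect those congruent to 1 or -1, \<open>PV\<close> and \<open>V\<close>
    those congruent to 3 or -3, and \<open>W\<close> those congruent to 5.\<close>
  define PU PV U V W where "PU = P 1 * P 11 * P 9 * P 19" and "PV = P 3 * P 13 * P 7 * P 17"
    and "U = M 1 * M 11 * M 9 * M 19" and "V = M 3 * M 13 * M 7 * M 17" and "W = M 5 * M 15"
  define E F where "E = M 2 * M 18" and "F = M 8 * M 12"
  have split: "P (2 * k) = P k * M k * (P (k + 10) * M (k + 10))" for k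
    using qpoch_inf_square_split[OF nome_norm[OF nm(3)], of "q ^ 10" "q ^ k"]
    by (simp add: P_def M_def power_add mult.commute flip: power_mult)
  have P2P18: "P 2 * P 18 = PU * U" and P6P14: "P 6 * P 14 = PV * V" and P8P12: "P 8 * P 12 = P 4 * M 4 * P 14 * M 14 * (P 6 * M 6 * P 16 * M 16)"
    using split[of 1] split[of 9] split[of 3] split[of 7] split[of 4] split[of 6]
    by (simp_all add: PU_def U_def PV_def V_def mult_ac)
  have th10: "jtheta q (q ^ 10) = PU * (P 10 * P 20)" "jtheta (q ^ 3) (q ^ 10) = PV * (P 10 * P 20)"
    "jtheta (q ^ 4) (q ^ 10) = P 4 * P 14 * P 6 * P 16 * (P 10 * P 20)"
    "jtheta (- (q ^ 8)) (q ^ 10) = E * F * (P 10 * P 20)" "jtheta (- (q ^ 6)) (q ^ 10) = M 4 * M 14 * M 6 * M 16 * (P 10 * P 20)"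
    using jtheta_power[OF q, of 1 10] jtheta_power[OF q, of 3 10] jtheta_power[OF q, of 4 10] jtheta_power[OF q, of 8 10] jtheta_power[OF q, of 6 10]
    unfolding sec by (simp_all add: PU_def PV_def E_def F_def mult_ac)
  have th20: "jtheta (- (q ^ 2)) (q ^ 20) = E * P 20" "jtheta (- (q ^ 4)) (q ^ 20) = M 4 * M 16 * P 20"
    "jtheta (- (q ^ 6)) (q ^ 20) = M 6 * M 14 * P 20" "jtheta (- (q ^ 8)) (q ^ 20) = F * P 20"
    using jtheta_power[OF q, of 2 20] jtheta_power[OF q, of 4 20] jtheta_power[OF q, of 6 20] jtheta_power[OF q, of 8 20]
    by (simp_all add: P_def M_def E_def F_def)
  have e10: "qpoch_inf (q ^ 10) (q ^ 10) = P 10 * P 20"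
    using sec(1)[of 10] by simp
  have e40: "qpoch_inf (q ^ 40) (q ^ 40) = P 20 * M 20"
    using qpoch_inf_self_double[OF nome_norm[OF nm(3)]] by (simp add: P_def M_def flip: power_mult)
  have j40: "jtheta (- (q ^ 10)) (q ^ 40) = M 10 * (P 20 * M 20)"
    using jtheta_power(2)[OF q, of 10 40] qpoch_inf_section_power(2)[OF q, of 20 2 10]
    unfolding e40 by (simp add: M_def numeral_2_eq_2)
  have Kv: "K = M 10 * P 10 ^ 2 * P 20 ^ 4 / M 20"
    unfolding K j40 e10 e40 P_def[THEN fun_cong, of 20, symmetric]
    using P_nz[of 20] M_nz[of 20] by (simp add: field_simps eval_nat_numeral)
  have jc: "jtheta (q ^ 2) (- (q ^ 5)) * jtheta (- q) (- (q ^ 5)) =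
      (P 2 * P 18) * (P 8 * P 12) * (U * V) * (P 4 * P 14 * P 6 * P 16) * (W * (P 10 * P 20)) ^ 2"
  proof -
    have "- (q ^ 5) / q ^ 2 = - (q ^ 3)" "- (q ^ 5) / - q = q ^ 4"
      "- (q ^ 5 * q ^ 2) = - (q ^ 7)" "- (q ^ 5 * - (q ^ 3)) = q ^ 8" "- (q ^ 5 * - (q ^ 5)) = q ^ 10" "- (q ^ 5 * - q) = q ^ 6"
      "- (q ^ 5 * q ^ 4) = - (q ^ 9)"
      using q0 by (simp_all add: divide_eq_eq flip: power_add power_Suc2)
    note e = this
    show ?thesis
      unfolding jtheta_def e neg sec using sec(2)[of 1] by (simp add: U_def V_def W_def mult_ac power2_eq_square)
  qed
  \<comment> \<open>The mixed product formula at \<open>c = q ^ 5\<close> and \<open>t = q\<close>,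
    written in these atoms.\<close>
  have mixed: "q * (PU * (P 10 * P 20)) * (E * F * (P 10 * P 20)) + PV * (P 10 * P 20) * (M 4 * M 14 * M 6 * M 16 * (P 10 * P 20)) =
      PU * U * (P 4 * M 4 * P 14 * M 14 * (P 6 * M 6 * P 16 * M 16)) * (U * V) * (P 4 * P 14 * P 6 * P 16) * (W * (P 10 * P 20)) ^ 2"
  proof -
    have e: "(q ^ 5) ^ 2 = q ^ 10" "- (q ^ 5 * q ^ 3) = - (q ^ 8)" "- (q ^ 5 * q) = - (q ^ 6)"
      by (simp_all flip: power_mult power_add power_Suc2)
    show ?thesis
      using jtheta_mixed_product[OF nm(2) q0] unfolding e th10 jc P2P18 P8P12 .
  qed
  have jbar: "Jbar q 1 2 = (U * V * W) ^ 2 * ((P 2 * P 18) * (P 6 * P 14) * (P 8 * P 12) * P 4 * P 16 * P 10 * P 20)"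
  proof -
    have "qpoch_inf (- q) (q ^ 2) = U * V * W"
      using qpoch_inf_section_power(2)[OF q, of 2 10 1]
      by (simp add: U_def V_def W_def M_def eval_nat_numeral lessThan_Suc mult_ac)
    moreover have "qpoch_inf (q ^ 2) (q ^ 2) = (P 2 * P 18) * (P 6 * P 14) * (P 8 * P 12) * P 4 * P 16 * P 10 * P 20"
      using qpoch_inf_section_power(1)[OF q, of 2 10 2]
      by (simp add: P_def eval_nat_numeral lessThan_Suc mult_ac)
    ultimately show ?thesis
      using jtheta_power(2)[OF q, of 1 2] by (simp add: Jbar_def power2_eq_square)
  qed
  have jneg: "jtheta (- (q ^ 6)) (- (q ^ 10)) = M 6 * P 16 * (P 4 * M 14) * (M 10 * P 20)"
  proof -
    have e: "- (q ^ 10) / - (q ^ 6) = q ^ 4" "- (q ^ 10 * - (q ^ 6)) = q ^ 16" "- (q ^ 10 * q ^ 4) = - (q ^ 14)"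
      "- (q ^ 10 * - (q ^ 10)) = q ^ 20"
      using q0 by (simp_all add: divide_eq_eq flip: power_add)
    show ?thesis
      unfolding jtheta_def e neg by (simp add: P_def M_def)
  qed
  have j28: "J q 2 8 = (P 2 * P 18) * (P 6 * P 14) * P 10 * (P 4 * M 4 * (P 16 * M 16) * ((P 8 * P 12) * F) * (P 20 * M 20))"
  proof -
    have "qpoch_inf (q ^ 2) (q ^ 8) * qpoch_inf (q ^ 6) (q ^ 8) = qpoch_inf (q ^ 2) (q ^ 4)"
      using qpoch_inf_section_power(1)[OF q, of 4 2 2] by (simp add: eval_nat_numeral lessThan_Suc mult_ac)
    also have "\<dots> = (P 2 * P 18) * (P 6 * P 14) * P 10"
      using qpoch_inf_section_power(1)[OF q, of 4 5 2]
      by (simp add: P_def eval_nat_numeral lessThan_Suc mult_ac)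
    finally have 1: "qpoch_inf (q ^ 2) (q ^ 8) * qpoch_inf (q ^ 6) (q ^ 8) = (P 2 * P 18) * (P 6 * P 14) * P 10" .
    have "qpoch_inf (q ^ 8) (q ^ 8) = qpoch_inf (q ^ 4) (q ^ 4) * qpoch_inf (- (q ^ 4)) (q ^ 4)"
      using qpoch_inf_self_double[OF nome_norm[OF nm(1)]] by (simp flip: power_mult)
    also have "\<dots> = P 4 * M 4 * (P 16 * M 16) * ((P 8 * P 12) * F) * (P 20 * M 20)"
      using qpoch_inf_section_power[OF q, of 4 5 4]
      by (simp add: P_def M_def F_def eval_nat_numeral lessThan_Suc mult_ac)
    finally have 2: "qpoch_inf (q ^ 8) (q ^ 8) = P 4 * M 4 * (P 16 * M 16) * ((P 8 * P 12) * F) * (P 20 * M 20)" .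
    show ?thesis
      using jtheta_power(1)[OF q, of 2 8] by (simp add: J_def 1 2)
  qed
  define p10 p20 m10 m20 A B C D a b c d where "p10 = P 10" and "p20 = P 20" and "m10 = M 10" and "m20 = M 20"
    and "A = P 4" and "B = P 14" and "C = P 6" and "D = P 16" and "a = M 4" and "b = M 14" and "c = M 6" and "d = M 16"
  note defs = this
  have nz: "PU \<noteq> 0" "PV \<noteq> 0" "U \<noteq> 0" "V \<noteq> 0" "W \<noteq> 0" "E \<noteq> 0" "F \<noteq> 0" "p10 \<noteq> 0" "p20 \<noteq> 0" "m10 \<noteq> 0" "m20 \<noteq> 0"
    "A \<noteq> 0" "B \<noteq> 0" "C \<noteq> 0" "D \<noteq> 0" "a \<noteq> 0" "b \<noteq> 0" "c \<noteq> 0" "d \<noteq> 0"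
    unfolding defs PU_def PV_def U_def V_def W_def E_def F_def using P_nz M_nz by simp_all
  \<comment> \<open>The atoms are not independent: this relation is held back until the last
    cancellation, where it removes \<open>PV\<close> from the denominator.\<close>
  have CB: "C * B = PV * V" using P6P14 unfolding defs .
  have mixed': "(p10 * p20) ^ 2 * (q * PU * E * F + PV * (a * b * c * d)) =
      (p10 * p20) ^ 2 * (PU * U ^ 2 * V * W ^ 2 * (A * B * C * D) ^ 2 * (a * b * c * d))"
    using mixed unfolding defs[symmetric] by (simp add: power2_eq_square algebra_simps)
  have "q * K * (E * p20) / (A * B * C * D * (p10 * p20) * (a * d * p20) ^ 2 * (PV * (p10 * p20))) +
      K * (c * b * p20) / (A * B * C * D * (p10 * p20) * (a * d * p20) * (F * p20) * (PU * (p10 * p20))) =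
      K * (q * PU * E * F + PV * (a * b * c * d)) / (A * B * C * D * p10 ^ 2 * p20 ^ 3 * a ^ 2 * d ^ 2 * PU * PV * F)"
    using nz by (simp add: divide_simps) (simp add: algebra_simps eval_nat_numeral)
  also have "q * PU * E * F + PV * (a * b * c * d) = PU * U ^ 2 * V * W ^ 2 * (A * B * C * D) ^ 2 * (a * b * c * d)"
    using mixed' nz by simp
  also have "K * (PU * U ^ 2 * V * W ^ 2 * (A * B * C * D) ^ 2 * (a * b * c * d)) /
      (A * B * C * D * p10 ^ 2 * p20 ^ 3 * a ^ 2 * d ^ 2 * PU * PV * F) =
      m10 * p20 / m20 * U ^ 2 * V * W ^ 2 * A * D * b * c * (C * B) / (a * d * PV * F)"
    unfolding Kv defs[symmetric] using nz by (simp add: divide_simps) (simp add: algebra_simps eval_nat_numeral)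
  also have "\<dots> = (U * V * W) ^ 2 * c * D * A * b * m10 * p20 / (a * F * d * m20)"
    unfolding CB using nz by (simp add: divide_simps) (simp add: algebra_simps eval_nat_numeral)
  also have "\<dots> = Jbar q 1 2 * jtheta (- (q ^ 6)) (- (q ^ 10)) / J q 2 8"
    unfolding jbar jneg j28 P2P18 P6P14 P8P12 defs[symmetric]
    using nz by (simp add: divide_simps)
  finally show ?thesis
    unfolding th10 th20 defs[symmetric] .
qed

theorem mainTheorem6:
  fixes q :: complex
  assumes "0 < norm q" and "norm q < 1"
  shows "mock_psi q + q * mock_phi (- (q ^ 4)) + mock_X (q ^ 8)
    = Jbar q 1 2 * jtheta (- (q ^ 6)) (- (q ^ 10)) / J q 2 8"
proof -
  have q: "nome q"
    using assms by (auto simp: nome_def)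
  show ?thesis
    unfolding mock_sum_dissect[OF q] dissect_term_values[OF q refl] theta_sum_value[OF q refl] ..
qed

end
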